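(* Let $\varphi\in L^{2}(\mathbb{R}^{2n})$ satisfy condition C and $\frac{1}{w_{\varphi}}\in L^{1}(\mathbb{T}^{n})$. Then the following are equivalent. (a) $\{T^{t}_{(k,l)}\varphi:(k,l)\in\mathbb{Z}^{2n}\}$ is Hilbertian. (b) $\|w_{\varphi}\|_{\infty}<\infty$. (c) $\{T^{t}_{(k,l)}\varphi:(k,l)\in\mathbb{Z}^{2n}\}$ is a Bessel sequence in $L^{2}(\mathbb{R}^{2n})$.
   Context: $\mathbb{T}^{n}$ is identified with $[0,1)^{n}$ with Lebesgue measure; $\|\cdot\|_\infty$ is the $L^{\infty}(\mathbb{T}^{n})$ norm. Twisted translation: for $\varphi\in L^{2}(\mathbb{R}^{2n})$ and $(k,l)\in\mathbb{Z}^{2n}$ (with $k,l\in\mathbb{Z}^n$), $T^{t}_{(k,l)}\varphi(x,y)=e^{\pi i(x\cdot l-y\cdot k)}\varphi(x-k,y-l)$, $(x,y)\in\mathbb{R}^{n}\times\mathbb{R}^{n}$. Kernel of the Weyl transform: for $f\in L^{2}(\mathbb{R}^{2n})$, $K_{f}(\xi,\eta)=\int_{\mathbb{R}^{n}}f(x,\eta-\xi)e^{i\pi x\cdot(\xi+\eta)}dx$ (interpreted in the $L^{2}$ sense as a partial Fourier transform; $f\mapsto K_f$ is an isometry of $L^{2}(\mathbb{R}^{2n})$). $w_{\varphi}(\xi)=\sum_{m\in\mathbb{Z}^{n}}\int_{\mathbb{R}^{n}}|K_{\varphi}(\xi+m,\eta)|^{2}d\eta$ for $\xi\in\mathbb{R}^{n}$;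 this is $\mathbb{Z}^{n}$-periodic and is regarded also as a function on $\mathbb{T}^{n}$; $1/w_\varphi$ is $+\infty$ where $w_\varphi=0$. Condition C: $\varphi$ satisfies condition C if for every $l\in\mathbb{Z}^{n}\setminus\{0\}$, $\sum_{m\in\mathbb{Z}^{n}}\int_{\mathbb{R}^{n}}K_{\varphi}(\xi+m,\eta)\overline{K_{\varphi}(\xi+m+l,\eta)}\,d\eta=0$ for a.e. $\xi\in\mathbb{T}^{n}$. A family $\{f_{j}:j\in\mathbb{Z}^{d}\}$ in a Hilbert space $\mathcal{H}$ is Hilbertian if $\{c_{j}\}\in\ell^{2}(\mathbb{Z}^{d})$ implies that $\sum_{j\in\mathbb{Z}^{d}}c_{j}f_{j}$ converges; it is a Bessel sequence if there is $B>0$ with $\sum_{j}|\langle f,f_{j}\rangle|^{2}\le B\|f\|^{2}$ for all $f\in\mathcal{H}$. Convergence of a series over $\mathbb{Z}^{d}$ means norm convergence in $\mathcal{H}$ of the partial sums over $\{j:\max_i|j_i|\le N\}$ as $N\to\infty$. *)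

theory Defs
  imports "HOL-Analysis.Analysis" "HOL-Probability.Essential_Supremum"
begin

section \<open>The Hilbert space of square-integrable functions\<close>

text \<open>Elements of \<open>L\<^sup>2(M)\<close> are represented by measurable functions; two functions that agree
  almost everywhere represent the same element.\<close>

definition L2 :: "'a measure \<Rightarrow> ('a \<Rightarrow> complex) set" where
  "L2 M = {f \<in> borel_measurable M. integrable M (\<lambda>x. (cmod (f x))\<^sup>2)}"

definition L2_norm :: "'a measure \<Rightarrow> ('a \<Rightarrow> complex) \<Rightarrow> real" where
  "L2_norm M f = sqrt (\<integral>x. (cmod (f x))\<^sup>2 \<partial>M)"

definition L2_inner :: "'a measure \<Rightarrow> ('a \<Rightarrow> complex) \<Rightarrow> ('a \<Rightarrow> complex) \<Rightarrow> complex" where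
  "L2_inner M f g = (\<integral>x. f x * cnj (g x) \<partial>M)"

definition L2_converges :: "'a measure \<Rightarrow> (nat \<Rightarrow> 'a \<Rightarrow> complex) \<Rightarrow> ('a \<Rightarrow> complex) \<Rightarrow> bool" where
  "L2_converges M u g \<longleftrightarrow> (\<forall>N. u N \<in> L2 M) \<and> g \<in> L2 M \<and>
     (\<lambda>N. L2_norm M (\<lambda>x. u N x - g x)) \<longlonglongrightarrow> 0"

section \<open>Families indexed by \<open>\<int>\<^sup>2\<^sup>n\<close>\<close>

text \<open>\<open>\<int>\<^sup>2\<^sup>n\<close> is represented as the product of two copies of \<open>\<int>\<^sup>n\<close>, and likewise \<open>\<real>\<^sup>2\<^sup>n\<close>.\<close>

definition lattice_box :: "nat \<Rightarrow> ((int^'n) \<times> (int^'n)) set" where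
  "lattice_box N = {(k, l). \<forall>i. \<bar>k $ i\<bar> \<le> int N \<and> \<bar>l $ i\<bar> \<le> int N}"

definition hilbertian :: "'a measure \<Rightarrow> ((int^'n) \<times> (int^'n) \<Rightarrow> 'a \<Rightarrow> complex) \<Rightarrow> bool" where
  "hilbertian M F \<longleftrightarrow> (\<forall>j. F j \<in> L2 M) \<and>
     (\<forall>c :: (int^'n) \<times> (int^'n) \<Rightarrow> complex. (\<lambda>j. (cmod (c j))\<^sup>2) summable_on UNIV \<longrightarrow>
       (\<exists>g. L2_converges M (\<lambda>N x. \<Sum>j\<in>lattice_box N. c j * F j x) g))"

definition bessel_sequence :: "'a measure \<Rightarrow> ((int^'n) \<times> (int^'n) \<Rightarrow> 'a \<Rightarrow> complex) \<Rightarrow> bool" where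
  "bessel_sequence M F \<longleftrightarrow> (\<forall>j. F j \<in> L2 M) \<and>
     (\<exists>B>0. \<forall>f\<in>L2 M.
       (\<Sum>\<^sub>\<infinity>j. ennreal ((cmod (L2_inner M f (F j)))\<^sup>2)) \<le> ennreal (B * (L2_norm M f)\<^sup>2))"

section \<open>Twisted translations and the kernel of the Weyl transform\<close>

definition vec_of_int :: "int^'n \<Rightarrow> real^'n" where
  "vec_of_int k = (\<chi> i. real_of_int (k $ i))"

definition twisted_translation ::
  "(int^'n) \<times> (int^'n) \<Rightarrow> ((real^'n) \<times> (real^'n) \<Rightarrow> complex) \<Rightarrow> (real^'n) \<times> (real^'n) \<Rightarrow> complex" where
  "twisted_translation = (\<lambda>(k, l) \<phi> (x, y).
     cis (pi * (x \<bullet> vec_of_int l - y \<bullet> vec_of_int k)) * \<phi> (x - vec_of_int k, y - vec_of_int l))"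

definition truncated_weyl_kernel ::
  "nat \<Rightarrow> ((real^'n) \<times> (real^'n) \<Rightarrow> complex) \<Rightarrow> (real^'n) \<times> (real^'n) \<Rightarrow> complex" where
  "truncated_weyl_kernel N f = (\<lambda>(\<xi>, \<eta>).
     LINT x:cball 0 (real N)|lborel. f (x, \<eta> - \<xi>) * cis (pi * (x \<bullet> (\<xi> + \<eta>))))"

text \<open>For \<open>f\<close> in \<open>L\<^sup>2(\<real>\<^sup>2\<^sup>n)\<close> the integral over all of \<open>\<real>\<^sup>n\<close> that defines the kernel need not
  converge absolutely. As usual for Fourier integrals of \<open>L\<^sup>2\<close> functions it is the limit in \<open>L\<^sup>2\<close>
  of the truncated integrals; by Plancherel's theorem this limit exists, and it is
  unique almost everywhere.\<close>

definition is_weyl_kernel ::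
  "((real^'n) \<times> (real^'n) \<Rightarrow> complex) \<Rightarrow> ((real^'n) \<times> (real^'n) \<Rightarrow> complex) \<Rightarrow> bool" where
  "is_weyl_kernel f K \<longleftrightarrow> L2_converges lborel (\<lambda>N. truncated_weyl_kernel N f) K"

definition weyl_kernel ::
  "((real^'n) \<times> (real^'n) \<Rightarrow> complex) \<Rightarrow> (real^'n) \<times> (real^'n) \<Rightarrow> complex" where
  "weyl_kernel f = (SOME K. is_weyl_kernel f K)"

section \<open>The periodic weight and condition C\<close>

definition torus :: "(real^'n) measure" where
  "torus = restrict_space lborel {\<xi>. \<forall>i. 0 \<le> \<xi> $ i \<and> \<xi> $ i < 1}"

definition weight :: "((real^'n) \<times> (real^'n) \<Rightarrow> complex) \<Rightarrow> real^'n \<Rightarrow> ennreal" where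
  "weight \<phi> \<xi> = (\<Sum>\<^sub>\<infinity>m :: int^'n.
     \<integral>\<^sup>+ \<eta>. ennreal ((cmod (weyl_kernel \<phi> (\<xi> + vec_of_int m, \<eta>)))\<^sup>2) \<partial>lborel)"

text \<open>Integrability of a function with values in \<open>[0, \<infinity>]\<close>, such as \<open>1 / weight \<phi>\<close>; in \<^typ>\<open>ennreal\<close>,
  \<open>1 / 0 = \<infinity>\<close>.\<close>

definition L1_ennreal :: "'a measure \<Rightarrow> ('a \<Rightarrow> ennreal) set" where
  "L1_ennreal M = {g \<in> borel_measurable M. (\<integral>\<^sup>+ x. g x \<partial>M) < \<infinity>}"

text \<open>By the Cauchy-Schwarz inequality the integrals below exist and their sum converges
  absolutely, for almost every \<open>\<xi>\<close>.\<close>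

definition condition_C :: "((real^'n) \<times> (real^'n) \<Rightarrow> complex) \<Rightarrow> bool" where
  "condition_C \<phi> \<longleftrightarrow> (\<forall>l :: int^'n. l \<noteq> 0 \<longrightarrow> (AE \<xi> in torus.
     ((\<lambda>m :: int^'n. \<integral>\<eta>. weyl_kernel \<phi> (\<xi> + vec_of_int m, \<eta>) *
         cnj (weyl_kernel \<phi> (\<xi> + vec_of_int m + vec_of_int l, \<eta>)) \<partial>lborel) has_sum 0) UNIV))"

end

theory Submission imports Defs begin

text \<open>
  All three conditions are equivalent to a synthesis bound, that is, to the existence of a constant \<open>B\<close>
  such that the squared norm of \<open>\<Sum>j. c j * F j\<close> is at most \<open>B * (\<Sum>j. \<bar>c j\<bar>\<^sup>2)\<close> for all finitely supported
  \<open>c\<close>, where \<open>F j\<close> is the twisted translation of \<open>\<phi>\<close> by \<open>j\<close>.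

  For the Bessel and the Hilbertian property this is true of every family in \<open>L\<^sup>2\<close>. The Bessel property is
  dual to the synthesis bound (\<open>synthesis_bound_imp_bessel\<close>, \<open>bessel_imp_synthesis_bound\<close>). The bound
  implies the Hilbertian property by completeness (\<open>synthesis_bound_imp_hilbertian\<close>). Conversely, if
  there is no bound, then there is none on the coefficients outside of any given box either, and a gliding
  hump produces square-summable coefficients with a divergent series (\<open>hilbertian_imp_synthesis_bound\<close>).

  The link to the weight is the Weyl transform. It is an isometry that turns the twisted translation by
  \<open>(k, l)\<close> into the map that takes a kernel \<open>K\<close> to \<open>(-1) ^ (k \<bullet> l) * e ^ (2 * pi * \<i> * k \<bullet> \<xi>) * K (\<xi> + l, \<eta>)\<close>.
  Hence the finite combination with coefficients \<open>c\<close> has the kernel \<open>\<Sum>l. p l \<xi> * K (\<xi> + l, \<eta>)\<close>, where each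
  \<open>p l\<close> is a trigonometric polynomial. Splitting \<open>\<xi>\<close> into a torus and a lattice part, condition C says that
  the translates by different \<open>l\<close> are orthogonal over almost every point of the torus. So the squared norm of
  the combination is \<open>\<Sum>l. \<integral> \<bar>p l \<xi>\<bar>\<^sup>2 * w \<xi>\<close>, integrated over the torus (\<open>twisted_combination_energy\<close>), whereas
  \<open>\<Sum>l. \<integral> \<bar>p l \<xi>\<bar>\<^sup>2\<close> is the squared norm of the coefficients. A bound on \<open>w\<close> is thus a synthesis bound.
  Conversely a synthesis bound says that \<open>\<integral> \<bar>p \<xi>\<bar>\<^sup>2 * w \<xi> \<le> B * \<integral> \<bar>p \<xi>\<bar>\<^sup>2\<close> for all trigonometric polynomials \<open>p\<close>,
  and by Stone-Weierstrass and inner regularity these suffice to conclude \<open>w \<le> B\<close> almost everywhere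
  (\<open>AE_le_if_trig_poly_integrals_le\<close>).

  The isometry rests on Plancherel's identity for functions with bounded support, which is derived from
  Parseval's identity: the values of the Fourier transform on a translate of the lattice are the Fourier
  coefficients of a modulated function. Parseval's identity in turn needs the completeness of the characters,
  which is another consequence of the same comparison of densities.
\<close>

section \<open>Cauchy-Schwarz and completeness in \<open>L\<^sup>2\<close>\<close>

lemma borel_measurable_cnj[measurable (raw)]:
  "f \<in> borel_measurable M \<Longrightarrow> (\<lambda>x. cnj (f x)) \<in> borel_measurable M"
  by (rule borel_measurable_continuous_on[OF continuous_on_cnj[OF continuous_on_id]])

text \<open>The squared norm with values in \<open>[0, \<infinity>]\<close>. It is defined for every measurable function, so that
  Tonelli's theorem and monotone limits apply before square-integrability is known.\<close>

definition energy :: "'a measure \<Rightarrow> ('a \<Rightarrow> complex) \<Rightarrow> ennreal" where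
  "energy M f = (\<integral>\<^sup>+ x. ennreal ((cmod (f x))\<^sup>2) \<partial>M)"

lemma L2_iff_energy: "f \<in> L2 M \<longleftrightarrow> f \<in> borel_measurable M \<and> energy M f < \<infinity>"
  by (auto simp: L2_def energy_def integrable_iff_bounded)

lemma L2_measurable[measurable_dest]: "f \<in> L2 M \<Longrightarrow> f \<in> borel_measurable M"
  by (simp add: L2_def)

lemma energy_eq_L2_norm: "f \<in> L2 M \<Longrightarrow> energy M f = ennreal ((L2_norm M f)\<^sup>2)"
  unfolding energy_def L2_norm_def
  by (subst nn_integral_eq_integral) (auto simp: L2_def)

lemma L2_norm_nonneg[simp]: "0 \<le> L2_norm M f"
  by (simp add: L2_norm_def)

lemma L2_norm_le_iff_energy:
  assumes "f \<in> L2 M" "0 \<le> r"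
  shows "(L2_norm M f)\<^sup>2 \<le> r \<longleftrightarrow> energy M f \<le> ennreal r"
  using assms by (simp add: energy_eq_L2_norm)

lemma energy_cong_AE: "AE x in M. f x = g x \<Longrightarrow> energy M f = energy M g"
  unfolding energy_def by (rule nn_integral_cong_AE) auto

lemma norm_add_power2_le: "(norm (a + b))\<^sup>2 \<le> 2 * (norm a)\<^sup>2 + 2 * (norm (b :: 'a::real_normed_vector))\<^sup>2"
proof -
  have "(norm (a + b))\<^sup>2 \<le> (norm a + norm b)\<^sup>2"
    by (intro power_mono norm_triangle_ineq) auto
  also have "\<dots> \<le> 2 * (norm a)\<^sup>2 + 2 * (norm b)\<^sup>2"
    using sum_squares_bound[of "norm a" "norm b"] by (simp add: power2_sum)
  finally show ?thesis .
qed

lemma energy_add_le: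
  assumes [measurable]: "f \<in> borel_measurable M" "g \<in> borel_measurable M"
  shows "energy M (\<lambda>x. f x + g x) \<le> 2 * energy M f + 2 * energy M g"
proof -
  have "energy M (\<lambda>x. f x + g x)
      \<le> (\<integral>\<^sup>+ x. 2 * ennreal ((cmod (f x))\<^sup>2) + 2 * ennreal ((cmod (g x))\<^sup>2) \<partial>M)"
    unfolding energy_def
  proof (rule nn_integral_mono)
    fix x
    have "ennreal ((cmod (f x + g x))\<^sup>2) \<le> ennreal (2 * (cmod (f x))\<^sup>2 + 2 * (cmod (g x))\<^sup>2)"
      by (intro ennreal_leI norm_add_power2_le)
    then show "ennreal ((cmod (f x + g x))\<^sup>2)
        \<le> 2 * ennreal ((cmod (f x))\<^sup>2) + 2 * ennreal ((cmod (g x))\<^sup>2)"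
      by (simp add: ennreal_plus ennreal_mult)
  qed
  also have "\<dots> = 2 * energy M f + 2 * energy M g"
    unfolding energy_def by (simp add: nn_integral_add nn_integral_cmult)
  finally show ?thesis .
qed

lemma L2_add: "f \<in> L2 M \<Longrightarrow> g \<in> L2 M \<Longrightarrow> (\<lambda>x. f x + g x) \<in> L2 M"
  using energy_add_le[of f M g]
  by (auto simp: L2_iff_energy ennreal_mult_less_top intro: order.strict_trans1)

lemma L2_cmult: "f \<in> L2 M \<Longrightarrow> (\<lambda>x. c * f x) \<in> L2 M"
  by (auto simp: L2_def norm_mult power_mult_distrib)

lemma L2_diff: "f \<in> L2 M \<Longrightarrow> g \<in> L2 M \<Longrightarrow> (\<lambda>x. f x - g x) \<in> L2 M"
  using L2_add[of f M "\<lambda>x. -1 * g x"] L2_cmult[of g M "-1"] by simp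

lemma L2_zero[simp]: "(\<lambda>x. 0) \<in> L2 M"
  by (simp add: L2_def)

lemma L2_sum: "(\<And>i. i \<in> I \<Longrightarrow> f i \<in> L2 M) \<Longrightarrow> (\<lambda>x. \<Sum>i\<in>I. f i x) \<in> L2 M"
  by (induction I rule: infinite_finite_induct) (auto intro: L2_add)

lemma L2_mult_integrable:
  assumes f: "f \<in> L2 M" and g: "g \<in> L2 M"
  shows "integrable M (\<lambda>x. f x * cnj (g x))"
proof (rule Bochner_Integration.integrable_bound)
  show "integrable M (\<lambda>x. (cmod (f x))\<^sup>2 + (cmod (g x))\<^sup>2)"
    using f g by (auto simp: L2_def)
  have [measurable]: "f \<in> borel_measurable M" "g \<in> borel_measurable M"
    using f g by (auto simp: L2_def)
  show "(\<lambda>x. f x * cnj (g x)) \<in> borel_measurable M"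
    by measurable
  show "AE x in M. norm (f x * cnj (g x)) \<le> norm ((cmod (f x))\<^sup>2 + (cmod (g x))\<^sup>2)"
  proof (rule AE_I2)
    fix x
    have "2 * (cmod (f x) * cmod (g x)) \<le> (cmod (f x))\<^sup>2 + (cmod (g x))\<^sup>2"
      using sum_squares_bound[of "cmod (f x)" "cmod (g x)"] by simp
    moreover have "0 \<le> cmod (f x) * cmod (g x)" by simp
    moreover have "norm (f x * cnj (g x)) = cmod (f x) * cmod (g x)"
      "norm ((cmod (f x))\<^sup>2 + (cmod (g x))\<^sup>2) = (cmod (f x))\<^sup>2 + (cmod (g x))\<^sup>2"
      by (simp_all add: norm_mult)
    ultimately show "norm (f x * cnj (g x)) \<le> norm ((cmod (f x))\<^sup>2 + (cmod (g x))\<^sup>2)"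
      by linarith
  qed
qed

lemma L2_inner_le:
  assumes f: "f \<in> L2 M" and g: "g \<in> L2 M"
  shows "cmod (L2_inner M f g) \<le> L2_norm M f * L2_norm M g"
proof -
  have [measurable]: "f \<in> borel_measurable M" "g \<in> borel_measurable M"
    using f g by (auto simp: L2_def)
  have "cmod (L2_inner M f g) \<le> (\<integral>x. cmod (f x * cnj (g x)) \<partial>M)"
    unfolding L2_inner_def by (rule integral_norm_bound)
  then have "ennreal (cmod (L2_inner M f g)) \<le> (\<integral>\<^sup>+x. ennreal (cmod (f x * cnj (g x))) \<partial>M)"
    by (subst nn_integral_eq_integral) (use L2_mult_integrable[OF f g] in auto)
  then have "(ennreal (cmod (L2_inner M f g)))\<^sup>2
      \<le> (\<integral>\<^sup>+x. ennreal (cmod (f x)) * ennreal (cmod (g x)) \<partial>M)\<^sup>2"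
    by (intro power_mono) (auto simp: norm_mult ennreal_mult)
  also have "\<dots> \<le> (\<integral>\<^sup>+x. (ennreal (cmod (f x)))\<^sup>2 \<partial>M) * (\<integral>\<^sup>+x. (ennreal (cmod (g x)))\<^sup>2 \<partial>M)"
    by (rule Cauchy_Schwarz_nn_integral) auto
  also have "\<dots> = energy M f * energy M g"
    by (simp add: energy_def ennreal_power)
  also have "\<dots> = ennreal ((L2_norm M f * L2_norm M g)\<^sup>2)"
    using f g by (simp add: energy_eq_L2_norm ennreal_mult power_mult_distrib)
  finally have "(cmod (L2_inner M f g))\<^sup>2 \<le> (L2_norm M f * L2_norm M g)\<^sup>2"
    by (simp add: ennreal_power)
  then show ?thesis
    by (rule power2_le_imp_le) simp
qed

lemma L2_norm_cmult: "L2_norm M (\<lambda>x. c * f x) = cmod c * L2_norm M f"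
  by (simp add: L2_norm_def norm_mult power_mult_distrib real_sqrt_mult)

lemma L2_norm_diff_commute: "L2_norm M (\<lambda>x. f x - g x) = L2_norm M (\<lambda>x. g x - f x)"
  by (simp add: L2_norm_def norm_minus_commute)

lemma L2_norm_power2_inner:
  "f \<in> L2 M \<Longrightarrow> complex_of_real ((L2_norm M f)\<^sup>2) = L2_inner M f f"
  unfolding L2_norm_def L2_inner_def complex_norm_square[symmetric] of_real_power[symmetric]
  by (simp only: integral_complex_of_real) (simp flip: of_real_power)

lemma L2_norm_triangle:
  assumes f: "f \<in> L2 M" and g: "g \<in> L2 M"
  shows "L2_norm M (\<lambda>x. f x + g x) \<le> L2_norm M f + L2_norm M g"
proof -
  have "complex_of_real ((L2_norm M (\<lambda>x. f x + g x))\<^sup>2)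
      = (\<integral>x. (f x * cnj (f x) + g x * cnj (g x)) + (f x * cnj (g x) + g x * cnj (f x)) \<partial>M)"
    unfolding L2_norm_power2_inner[OF L2_add[OF f g]] L2_inner_def
    by (rule Bochner_Integration.integral_cong) (auto simp: algebra_simps)
  also have "\<dots> = L2_inner M f f + L2_inner M g g + (L2_inner M f g + L2_inner M g f)"
    unfolding L2_inner_def
    using L2_mult_integrable[OF f f] L2_mult_integrable[OF f g]
      L2_mult_integrable[OF g f] L2_mult_integrable[OF g g] by simp
  finally have "complex_of_real ((L2_norm M (\<lambda>x. f x + g x))\<^sup>2)
      = complex_of_real ((L2_norm M f)\<^sup>2 + (L2_norm M g)\<^sup>2) + (L2_inner M f g + L2_inner M g f)"
    by (simp add: L2_norm_power2_inner[OF f, symmetric] L2_norm_power2_inner[OF g, symmetric])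
  then have "(L2_norm M (\<lambda>x. f x + g x))\<^sup>2
      = (L2_norm M f)\<^sup>2 + (L2_norm M g)\<^sup>2 + Re (L2_inner M f g + L2_inner M g f)"
    by (metis Re_complex_of_real plus_complex.sel(1))
  also have "Re (L2_inner M f g + L2_inner M g f) \<le> cmod (L2_inner M f g) + cmod (L2_inner M g f)"
    using complex_Re_le_cmod[of "L2_inner M f g"] complex_Re_le_cmod[of "L2_inner M g f"] by simp
  also have "\<dots> \<le> 2 * L2_norm M f * L2_norm M g"
    using L2_inner_le[OF f g] L2_inner_le[OF g f] by (simp add: mult.commute[of "L2_norm M g" "L2_norm M f"] mult.assoc)
  finally have "(L2_norm M (\<lambda>x. f x + g x))\<^sup>2 \<le> (L2_norm M f + L2_norm M g)\<^sup>2"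
    by (simp add: power2_sum)
  then show ?thesis
    by (rule power2_le_imp_le) simp
qed

lemma L2_norm_triangle_diff:
  assumes f: "f \<in> L2 M" and g: "g \<in> L2 M" and h: "h \<in> L2 M"
  shows "L2_norm M (\<lambda>x. f x - h x) \<le> L2_norm M (\<lambda>x. f x - g x) + L2_norm M (\<lambda>x. g x - h x)"
  using L2_norm_triangle[OF L2_diff[OF f g] L2_diff[OF g h]] by simp

lemma L2_norm_sum_le:
  assumes "\<And>i. i \<in> I \<Longrightarrow> f i \<in> L2 M"
  shows "L2_norm M (\<lambda>x. \<Sum>i\<in>I. f i x) \<le> (\<Sum>i\<in>I. L2_norm M (f i))"
  using assms
proof (induction I rule: infinite_finite_induct)
  case (insert i I)
  then show ?case
    using L2_norm_triangle[of "f i" M "\<lambda>x. \<Sum>i\<in>I. f i x"] by (force intro: L2_sum)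
qed (auto simp: L2_norm_def)

lemma L2_converges_norm:
  assumes "L2_converges M u g"
  shows "(\<lambda>N. L2_norm M (u N)) \<longlonglongrightarrow> L2_norm M g"
proof (rule LIM_zero_cancel, rule Lim_null_comparison)
  have u: "\<And>N. u N \<in> L2 M" and g: "g \<in> L2 M"
    and lim: "(\<lambda>N. L2_norm M (\<lambda>x. u N x - g x)) \<longlonglongrightarrow> 0"
    using assms by (auto simp: L2_converges_def)
  show "(\<lambda>N. L2_norm M (\<lambda>x. u N x - g x)) \<longlonglongrightarrow> 0" by fact
  show "\<forall>\<^sub>F N in sequentially. norm (L2_norm M (u N) - L2_norm M g) \<le> L2_norm M (\<lambda>x. u N x - g x)"
  proof (rule always_eventually, rule allI)
    fix N
    show "norm (L2_norm M (u N) - L2_norm M g) \<le> L2_norm M (\<lambda>x. u N x - g x)"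
      using L2_norm_triangle[OF L2_diff[OF u[of N] g] g]
        L2_norm_triangle[OF L2_diff[OF g u[of N]] u[of N]]
      by (simp add: L2_norm_diff_commute[of M g "u N"] abs_le_iff)
  qed
qed

lemma L2_converges_imp_Cauchy:
  assumes "L2_converges M u g" "e > 0"
  shows "\<exists>N. \<forall>m\<ge>N. \<forall>n\<ge>N. L2_norm M (\<lambda>x. u m x - u n x) < e"
proof -
  have u: "\<And>N. u N \<in> L2 M" and g: "g \<in> L2 M"
    and lim: "(\<lambda>N. L2_norm M (\<lambda>x. u N x - g x)) \<longlonglongrightarrow> 0"
    using assms by (auto simp: L2_converges_def)
  obtain N where N: "\<And>n. n \<ge> N \<Longrightarrow> L2_norm M (\<lambda>x. u n x - g x) < e/2"
    using LIMSEQ_D[OF lim, of "e/2"] \<open>e > 0\<close> by auto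
  show ?thesis
  proof (intro exI[of _ N] allI impI)
    fix m n assume "m \<ge> N" "n \<ge> N"
    then show "L2_norm M (\<lambda>x. u m x - u n x) < e"
      using L2_norm_triangle_diff[OF u[of m] g u[of n]] N[of m] N[of n]
      by (simp add: L2_norm_diff_commute[of M g "u n"])
  qed
qed

text \<open>The squared increments, weighted by \<open>4 ^ k\<close>, still have a finite total integral. Hence almost
  everywhere the weighted squares are bounded, and the increments decay like \<open>(1/2) ^ k\<close>.\<close>

lemma AE_convergent_if_fast_Cauchy:
  assumes u[measurable]: "\<And>k. v k \<in> borel_measurable M"
    and d: "\<And>k. energy M (\<lambda>x. v (Suc k) x - v k x) \<le> ennreal ((1/8)^k)"
  shows "AE x in M. convergent (\<lambda>k. v k x)"
proof -
  have "(\<integral>\<^sup>+x. (\<Sum>k. ennreal (4^k * (cmod (v (Suc k) x - v k x))\<^sup>2)) \<partial>M)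
      = (\<Sum>k. ennreal (4^k) * energy M (\<lambda>x. v (Suc k) x - v k x))"
    by (simp add: nn_integral_suminf energy_def ennreal_mult nn_integral_cmult)
  also have "\<dots> \<le> (\<Sum>k. ennreal ((1/2)^k))"
  proof (intro suminf_le allI)
    fix k
    have "ennreal (4^k) * energy M (\<lambda>x. v (Suc k) x - v k x) \<le> ennreal (4^k) * ennreal ((1/8)^k)"
      by (intro mult_left_mono d) simp
    also have "\<dots> = ennreal ((1/2)^k)"
      by (simp add: ennreal_mult[symmetric] power_mult_distrib[symmetric])
    finally show "ennreal (4^k) * energy M (\<lambda>x. v (Suc k) x - v k x) \<le> ennreal ((1/2)^k)" .
  qed auto
  also have "\<dots> = ennreal (\<Sum>k. (1/2)^k)"
    by (rule suminf_ennreal2) auto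
  finally have "(\<integral>\<^sup>+x. (\<Sum>k. ennreal (4^k * (cmod (v (Suc k) x - v k x))\<^sup>2)) \<partial>M) \<noteq> \<infinity>"
    by (auto simp: top_unique)
  then have "AE x in M. (\<Sum>k. ennreal (4^k * (cmod (v (Suc k) x - v k x))\<^sup>2)) \<noteq> \<infinity>"
    by (rule nn_integral_PInf_AE[rotated]) measurable
  then show ?thesis
  proof (rule AE_mp, intro AE_I2 impI)
    fix x assume fin: "(\<Sum>k. ennreal (4^k * (cmod (v (Suc k) x - v k x))\<^sup>2)) \<noteq> \<infinity>"
    have "summable (\<lambda>k. 4^k * (cmod (v (Suc k) x - v k x))\<^sup>2)"
      by (rule summable_suminf_not_top) (use fin in auto)
    then have "Bseq (\<lambda>k. 4^k * (cmod (v (Suc k) x - v k x))\<^sup>2)"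
      by (intro convergent_imp_Bseq) (auto dest: summable_LIMSEQ_zero simp: convergent_def)
    then obtain C where C: "C > 0" "\<And>k. norm (4^k * (cmod (v (Suc k) x - v k x))\<^sup>2) \<le> C"
      by (auto elim: BseqE)
    have "cmod (v (Suc k) x - v k x) \<le> sqrt C * (1/2)^k" for k
    proof (rule power2_le_imp_le)
      have sq: "(sqrt C * (1/2)^k)\<^sup>2 = C / 4^k"
      proof -
        have "((1/2 :: real)^k)\<^sup>2 = (1/4)^k"
          by (simp add: power2_eq_square flip: power_mult_distrib)
        then show ?thesis
          using C(1) by (simp add: power_mult_distrib power_one_over power_divide)
      qed
      then show "(cmod (v (Suc k) x - v k x))\<^sup>2 \<le> (sqrt C * (1/2)^k)\<^sup>2"
        unfolding sq using C(2)[of k] by (simp add: pos_le_divide_eq norm_mult mult.commute)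
    qed (use C in auto)
    then have "summable (\<lambda>k. v (Suc k) x - v k x)"
      by (intro summable_comparison_test[OF _ summable_mult[OF summable_geometric]]) auto
    then have "convergent (\<lambda>n. v n x - v 0 x)"
      unfolding summable_iff_convergent by (simp only: sum_lessThan_telescope[where f="\<lambda>k. v k x"])
    then have "convergent (\<lambda>n. (v n x - v 0 x) + v 0 x)"
      by (intro convergent_add convergent_const)
    then show "convergent (\<lambda>n. v n x)" by simp
  qed
qed

text \<open>Riesz-Fischer: a subsequence with fast decaying increments converges almost everywhere, and
  Fatou's lemma turns the Cauchy condition into convergence in norm to the pointwise limit.\<close>

theorem L2_complete:
  assumes u: "\<And>N. u N \<in> L2 M"
    and cauchy: "\<And>e. e > 0 \<Longrightarrow> \<exists>N. \<forall>m\<ge>N. \<forall>n\<ge>N. L2_norm M (\<lambda>x. u m x - u n x) < e"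
  shows "\<exists>g. L2_converges M u g"
proof -
  have um[measurable]: "u N \<in> borel_measurable M" for N
    using u by (simp add: L2_def)
  have "\<forall>k. \<exists>N. \<forall>m\<ge>N. \<forall>n\<ge>N. L2_norm M (\<lambda>x. u m x - u n x) < sqrt ((1/8)^k)"
    by (intro allI cauchy) simp
  then obtain N0 where N0: "\<And>k m n. m \<ge> N0 k \<Longrightarrow> n \<ge> N0 k
      \<Longrightarrow> L2_norm M (\<lambda>x. u m x - u n x) < sqrt ((1/8)^k)"
    by metis
  \<comment> \<open>Summation makes the thresholds strictly increasing.\<close>
  define r where "r = (\<lambda>k. \<Sum>i\<le>k. N0 i + 1)"
  have r_mono: "strict_mono r"
    by (rule strict_monoI_Suc) (simp add: r_def)
  have r_ge: "r k \<ge> N0 k" for k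
    unfolding r_def by (induction k) auto
  have "AE x in M. convergent (\<lambda>k. u (r k) x)"
  proof (rule AE_convergent_if_fast_Cauchy)
    fix k
    have "L2_norm M (\<lambda>x. u (r (Suc k)) x - u (r k) x) < sqrt ((1/8)^k)"
      using r_ge[of k] strict_monoD[OF r_mono, of k "Suc k"] by (intro N0) auto
    then have "(L2_norm M (\<lambda>x. u (r (Suc k)) x - u (r k) x))\<^sup>2 \<le> (1/8)^k"
      using real_less_rsqrt[of "L2_norm M (\<lambda>x. u (r (Suc k)) x - u (r k) x)"]
      by (metis L2_norm_nonneg less_eq_real_def power_mono real_sqrt_pow2 zero_le_divide_1_iff
          zero_le_numeral zero_le_power)
    then show "energy M (\<lambda>x. u (r (Suc k)) x - u (r k) x) \<le> ennreal ((1/8)^k)"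
      by (subst (asm) L2_norm_le_iff_energy) (auto intro: L2_diff u)
  qed simp
  then have conv: "AE x in M. (\<lambda>k. u (r k) x) \<longlonglongrightarrow> lim (\<lambda>k. u (r k) x)"
    by (simp add: convergent_LIMSEQ_iff)
  define g where "g = (\<lambda>x. lim (\<lambda>k. u (r k) x))"
  have [measurable]: "g \<in> borel_measurable M"
    unfolding g_def by (rule borel_measurable_lim_metric) simp
  \<comment> \<open>The bound is uniform over the subsequence and survives its limit by Fatou's lemma.\<close>
  have fatou: "energy M (\<lambda>x. u m x - g x) \<le> ennreal (e\<^sup>2)"
    if e: "e > 0" and N: "\<And>m n. m \<ge> N \<Longrightarrow> n \<ge> N \<Longrightarrow> L2_norm M (\<lambda>x. u m x - u n x) < e"
      and m: "m \<ge> N" for e N m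
  proof -
    have "energy M (\<lambda>x. u m x - g x)
        = (\<integral>\<^sup>+x. liminf (\<lambda>k. ennreal ((cmod (u m x - u (r k) x))\<^sup>2)) \<partial>M)"
      unfolding energy_def
    proof (rule nn_integral_cong_AE, rule AE_mp[OF conv], intro AE_I2 impI)
      fix x assume "(\<lambda>k. u (r k) x) \<longlonglongrightarrow> lim (\<lambda>k. u (r k) x)"
      then have "(\<lambda>k. ennreal ((cmod (u m x - u (r k) x))\<^sup>2)) \<longlonglongrightarrow> ennreal ((cmod (u m x - g x))\<^sup>2)"
        unfolding g_def by (intro tendsto_intros) auto
      then show "ennreal ((cmod (u m x - g x))\<^sup>2) = liminf (\<lambda>k. ennreal ((cmod (u m x - u (r k) x))\<^sup>2))"
        by (rule lim_imp_Liminf[OF trivial_limit_sequentially, symmetric])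
    qed
    also have "\<dots> \<le> liminf (\<lambda>k. energy M (\<lambda>x. u m x - u (r k) x))"
      unfolding energy_def by (rule nn_integral_liminf) simp
    also have "\<dots> \<le> ennreal (e\<^sup>2)"
    proof (rule Liminf_le)
      have "eventually (\<lambda>k. k \<ge> N) sequentially"
        by (rule eventually_ge_at_top)
      then show "\<forall>\<^sub>F k in sequentially. energy M (\<lambda>x. u m x - u (r k) x) \<le> ennreal (e\<^sup>2)"
      proof eventually_elim
        case (elim k)
        then have "r k \<ge> N"
          using seq_suble[OF r_mono, of k] by simp
        then have "(L2_norm M (\<lambda>x. u m x - u (r k) x))\<^sup>2 \<le> e\<^sup>2"
          using N[OF m] by (intro power_mono) (auto intro: less_imp_le)
        then show ?case
          by (subst (asm) L2_norm_le_iff_energy) (auto intro: L2_diff u)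
      qed
    qed simp
    finally show ?thesis .
  qed
  have diff: "(\<lambda>x. u m x - g x) \<in> L2 M \<and> L2_norm M (\<lambda>x. u m x - g x) \<le> e"
    if e: "e > 0" and N: "\<And>m n. m \<ge> N \<Longrightarrow> n \<ge> N \<Longrightarrow> L2_norm M (\<lambda>x. u m x - u n x) < e"
      and m: "m \<ge> N" for e N m
  proof
    show d: "(\<lambda>x. u m x - g x) \<in> L2 M"
      using fatou[OF that] by (auto simp: L2_iff_energy intro: order.strict_trans1)
    show "L2_norm M (\<lambda>x. u m x - g x) \<le> e"
      using fatou[OF that] L2_norm_le_iff_energy[OF d, of "e\<^sup>2"] e
      by (auto intro: power2_le_imp_le)
  qed
  have "g \<in> L2 M"
  proof -
    obtain N where N: "\<forall>m\<ge>N. \<forall>n\<ge>N. L2_norm M (\<lambda>x. u m x - u n x) < 1"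
      using cauchy[of 1] by auto
    then have "(\<lambda>x. u N x - g x) \<in> L2 M"
      using diff[of 1 N N] by auto
    from L2_diff[OF u[of N] this] show ?thesis by simp
  qed
  moreover have "(\<lambda>m. L2_norm M (\<lambda>x. u m x - g x)) \<longlonglongrightarrow> 0"
  proof (rule LIMSEQ_I)
    fix e :: real assume "e > 0"
    then obtain N where N: "\<forall>m\<ge>N. \<forall>n\<ge>N. L2_norm M (\<lambda>x. u m x - u n x) < e/2"
      using cauchy[of "e/2"] by auto
    then show "\<exists>N. \<forall>m\<ge>N. norm (L2_norm M (\<lambda>x. u m x - g x) - 0) < e"
      using diff[of "e/2" N] \<open>e > 0\<close> by (intro exI[of _ N]) force
  qed
  ultimately show ?thesis
    using u by (auto simp: L2_converges_def)
qed

section \<open>Hilbertian families, Bessel sequences and synthesis bounds\<close>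

text \<open>Boundedness of the synthesis operator, restricted to finitely supported coefficients. It is the
  common reformulation of the Hilbertian property, the Bessel property, and the boundedness of the
  weight.\<close>

definition synthesis_bound :: "'a measure \<Rightarrow> ('j \<Rightarrow> 'a \<Rightarrow> complex) \<Rightarrow> real \<Rightarrow> bool" where
  "synthesis_bound M F B \<longleftrightarrow> (\<forall>J c. finite J \<longrightarrow>
     (L2_norm M (\<lambda>x. \<Sum>j\<in>J. c j * F j x))\<^sup>2 \<le> B * (\<Sum>j\<in>J. (cmod (c j))\<^sup>2))"

lemma synthesis_boundD:
  "synthesis_bound M F B \<Longrightarrow> finite J \<Longrightarrow>
    (L2_norm M (\<lambda>x. \<Sum>j\<in>J. c j * F j x))\<^sup>2 \<le> B * (\<Sum>j\<in>J. (cmod (c j))\<^sup>2)"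
  by (simp add: synthesis_bound_def)

lemma L2_inner_sum_right:
  assumes f: "f \<in> L2 M" and F: "\<And>j. j \<in> J \<Longrightarrow> F j \<in> L2 M"
  shows "L2_inner M f (\<lambda>x. \<Sum>j\<in>J. c j * F j x) = (\<Sum>j\<in>J. cnj (c j) * L2_inner M f (F j))"
proof -
  have "L2_inner M f (\<lambda>x. \<Sum>j\<in>J. c j * F j x) = (\<integral>x. (\<Sum>j\<in>J. cnj (c j) * (f x * cnj (F j x))) \<partial>M)"
    unfolding L2_inner_def
    by (rule Bochner_Integration.integral_cong) (auto simp: sum_distrib_left algebra_simps)
  also have "\<dots> = (\<Sum>j\<in>J. cnj (c j) * L2_inner M f (F j))"
    unfolding L2_inner_def
    by (subst Bochner_Integration.integral_sum) (auto intro!: integrable_mult_right L2_mult_integrable f F)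
  finally show ?thesis .
qed

lemma mult_right_cancel_le_nonneg: "x * x \<le> y * x \<Longrightarrow> 0 \<le> x \<Longrightarrow> 0 \<le> y \<Longrightarrow> x \<le> (y :: real)"
  by (cases "x = 0") (auto simp: mult_le_cancel_right)

text \<open>Duality: with \<open>S\<close> the synthesis of the coefficients \<open>\<langle>f, F j\<rangle>\<close>, the sum \<open>s\<close> of their squares is
  \<open>\<langle>f, S\<rangle> \<le> norm f * sqrt (B * s)\<close>, and one factor \<open>sqrt s\<close> cancels.\<close>

lemma synthesis_bound_imp_coefficient_bound:
  assumes F: "\<And>j. F j \<in> L2 M" and B: "synthesis_bound M F B" and "B \<ge> 0"
    and f: "f \<in> L2 M" and J: "finite J"
  shows "(\<Sum>j\<in>J. (cmod (L2_inner M f (F j)))\<^sup>2) \<le> B * (L2_norm M f)\<^sup>2"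
proof -
  define a where "a = (\<lambda>j. L2_inner M f (F j))"
  define S where "S = (\<lambda>x. \<Sum>j\<in>J. a j * F j x)"
  define s where "s = (\<Sum>j\<in>J. (cmod (a j))\<^sup>2)"
  have S: "S \<in> L2 M" unfolding S_def by (intro L2_sum L2_cmult F)
  have s0: "0 \<le> s" by (auto simp: s_def intro: sum_nonneg)
  have "L2_inner M f S = complex_of_real s"
    unfolding S_def L2_inner_sum_right[OF f F] s_def a_def[symmetric]
    unfolding a_def of_real_sum complex_norm_square by (simp add: mult.commute)
  then have "s \<le> L2_norm M f * L2_norm M S"
    using L2_inner_le[OF f S] s0 by simp
  then have "s\<^sup>2 \<le> (L2_norm M f)\<^sup>2 * (L2_norm M S)\<^sup>2"
    using power_mono[OF _ s0] by (metis power_mult_distrib)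
  also have "\<dots> \<le> (L2_norm M f)\<^sup>2 * (B * s)"
    using synthesis_boundD[OF B J, of a] unfolding S_def s_def by (intro mult_left_mono) auto
  finally have "s * s \<le> (B * (L2_norm M f)\<^sup>2) * s"
    by (simp add: power2_eq_square algebra_simps)
  then have "s \<le> B * (L2_norm M f)\<^sup>2"
    by (rule mult_right_cancel_le_nonneg) (use \<open>B \<ge> 0\<close> s0 in auto)
  then show ?thesis
    by (simp add: s_def a_def)
qed

lemma synthesis_bound_mono:
  "synthesis_bound M F B \<Longrightarrow> B \<le> B' \<Longrightarrow> synthesis_bound M F B'"
  unfolding synthesis_bound_def by (meson mult_right_mono order_trans sum_nonneg zero_le_power2)

lemma synthesis_bound_imp_bessel:
  fixes F :: "(int^'n) \<times> (int^'n) \<Rightarrow> 'a \<Rightarrow> complex"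
  assumes F: "\<And>j. F j \<in> L2 M" and B: "synthesis_bound M F B"
  shows "bessel_sequence M F"
proof -
  define B' where "B' = max B 1"
  have B': "B' > 0" "synthesis_bound M F B'"
    using synthesis_bound_mono[OF B, of B'] by (auto simp: B'_def)
  have "(\<Sum>\<^sub>\<infinity>j. ennreal ((cmod (L2_inner M f (F j)))\<^sup>2)) \<le> ennreal (B' * (L2_norm M f)\<^sup>2)"
    if f: "f \<in> L2 M" for f
  proof (subst nonneg_infsum_complete, simp, rule SUP_least)
    fix J :: "((int^'n) \<times> (int^'n)) set" assume "J \<in> {J. finite J \<and> J \<subseteq> UNIV}"
    then have J: "finite J" by simp
    show "(\<Sum>j\<in>J. ennreal ((cmod (L2_inner M f (F j)))\<^sup>2)) \<le> ennreal (B' * (L2_norm M f)\<^sup>2)"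
      using synthesis_bound_imp_coefficient_bound[OF F B'(2) _ f J] B'
      by (simp add: sum_ennreal ennreal_leI)
  qed
  then show ?thesis
    unfolding bessel_sequence_def using F B' by blast
qed

text \<open>The same duality in the other direction: \<open>\<langle>f, f\<rangle>\<close> for a finite combination \<open>f\<close> is expanded in one
  argument only and estimated by Cauchy-Schwarz.\<close>

lemma bessel_imp_synthesis_bound:
  fixes F :: "(int^'n) \<times> (int^'n) \<Rightarrow> 'a \<Rightarrow> complex"
  assumes "bessel_sequence M F"
  shows "\<exists>B. synthesis_bound M F B"
proof -
  have F: "\<And>j. F j \<in> L2 M" using assms unfolding bessel_sequence_def by blast
  obtain B where B: "B > 0" and bessel: "\<And>f. f \<in> L2 M \<Longrightarrow>
      (\<Sum>\<^sub>\<infinity>j. ennreal ((cmod (L2_inner M f (F j)))\<^sup>2)) \<le> ennreal (B * (L2_norm M f)\<^sup>2)"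
    using assms by (auto simp: bessel_sequence_def)
  have "synthesis_bound M F B"
    unfolding synthesis_bound_def
  proof (intro allI impI)
    fix J :: "((int^'n) \<times> (int^'n)) set" and c :: "(int^'n) \<times> (int^'n) \<Rightarrow> complex"
    assume J: "finite J"
    define f where "f = (\<lambda>x. \<Sum>j\<in>J. c j * F j x)"
    have f: "f \<in> L2 M" unfolding f_def by (intro L2_sum L2_cmult F)
    define s where "s = (\<Sum>j\<in>J. (cmod (c j))\<^sup>2)"
    have s0: "s \<ge> 0" by (auto simp: s_def intro: sum_nonneg)
    have "ennreal (\<Sum>j\<in>J. (cmod (L2_inner M f (F j)))\<^sup>2) = (\<Sum>j\<in>J. ennreal ((cmod (L2_inner M f (F j)))\<^sup>2))"
      by (simp add: sum_ennreal)
    also have "\<dots> \<le> (\<Sum>\<^sub>\<infinity>j. ennreal ((cmod (L2_inner M f (F j)))\<^sup>2))"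
      by (subst nonneg_infsum_complete) (use J in \<open>auto intro: SUP_upper\<close>)
    also have "\<dots> \<le> ennreal (B * (L2_norm M f)\<^sup>2)" by (rule bessel[OF f])
    finally have coeffs: "(\<Sum>j\<in>J. (cmod (L2_inner M f (F j)))\<^sup>2) \<le> B * (L2_norm M f)\<^sup>2"
      using B by (subst (asm) ennreal_le_iff) auto
    have "(L2_norm M f)\<^sup>2 = cmod (L2_inner M f f)"
      by (simp add: L2_norm_power2_inner[OF f, symmetric] norm_power)
    also have "\<dots> = cmod (\<Sum>j\<in>J. cnj (c j) * L2_inner M f (F j))"
      by (subst (2) f_def) (simp add: L2_inner_sum_right[OF f F])
    also have "\<dots> \<le> (\<Sum>j\<in>J. cmod (c j) * cmod (L2_inner M f (F j)))"
      by (rule order_trans[OF norm_sum]) (simp add: norm_mult)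
    finally have "((L2_norm M f)\<^sup>2)\<^sup>2 \<le> (\<Sum>j\<in>J. cmod (c j) * cmod (L2_inner M f (F j)))\<^sup>2"
      by (intro power_mono) auto
    also have "\<dots> \<le> s * (\<Sum>j\<in>J. (cmod (L2_inner M f (F j)))\<^sup>2)"
      unfolding s_def by (rule Cauchy_Schwarz_ineq_sum)
    also have "\<dots> \<le> s * (B * (L2_norm M f)\<^sup>2)"
      using coeffs s0 by (intro mult_left_mono)
    finally have "(L2_norm M f)\<^sup>2 * (L2_norm M f)\<^sup>2 \<le> (B * s) * (L2_norm M f)\<^sup>2"
      by (simp add: power2_eq_square algebra_simps)
    then have "(L2_norm M f)\<^sup>2 \<le> B * s"
      by (rule mult_right_cancel_le_nonneg) (use B s0 in auto)
    then show "(L2_norm M (\<lambda>x. \<Sum>j\<in>J. c j * F j x))\<^sup>2 \<le> B * (\<Sum>j\<in>J. (cmod (c j))\<^sup>2)"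
      by (simp add: f_def s_def)
  qed
  then show ?thesis ..
qed

lemma finite_lattice_box[simp]: "finite (lattice_box N :: ((int^'n) \<times> (int^'n)) set)"
proof -
  let ?A = "(\<lambda>f. \<chi> i. f i) ` (PiE UNIV (\<lambda>_::'n. {- int N..int N}))"
  have "k \<in> ?A" if "\<forall>i. \<bar>k $ i\<bar> \<le> int N" for k :: "int^'n"
    by (rule image_eqI[of _ _ "\<lambda>i. k $ i"]) (use that in \<open>auto simp: abs_le_iff minus_le_iff\<close>)
  then have "lattice_box N \<subseteq> ?A \<times> ?A"
    unfolding lattice_box_def by blast
  then show ?thesis
    by (rule finite_subset) (intro finite_cartesian_product finite_imageI finite_PiE; simp)
qed

lemma lattice_box_mono: "m \<le> n \<Longrightarrow> lattice_box m \<subseteq> lattice_box n"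
  unfolding lattice_box_def by (fastforce intro: order_trans)

lemma finite_subset_lattice_box:
  fixes J :: "((int^'n) \<times> (int^'n)) set"
  assumes "finite J" shows "\<exists>N\<ge>m. J \<subseteq> lattice_box N"
  using assms
proof induction
  case (insert j J)
  then obtain N where N: "N \<ge> m" "J \<subseteq> lattice_box N" by auto
  obtain k l where j: "j = (k, l)" by force
  define P where "P = Max (range (\<lambda>i. nat \<bar>k $ i\<bar>) \<union> range (\<lambda>i. nat \<bar>l $ i\<bar>))"
  have "nat \<bar>k $ i\<bar> \<le> P" "nat \<bar>l $ i\<bar> \<le> P" for i
    unfolding P_def by (intro Max_ge; auto)+
  then have "\<bar>k $ i\<bar> \<le> int (max N P)" "\<bar>l $ i\<bar> \<le> int (max N P)" for i
    by (meson nat_le_iff max.cobounded2 order_trans)+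
  then have "j \<in> lattice_box (max N P)"
    unfolding j lattice_box_def by simp
  then show ?case
    using N lattice_box_mono[of N "max N P"] by (intro exI[of _ "max N P"]) auto
qed auto

text \<open>Square-summability makes the partial sums of the squared coefficients a Cauchy sequence, and the
  synthesis bound transports this to the partial sums in \<open>L\<^sup>2\<close>.\<close>

lemma synthesis_bound_imp_converges:
  fixes X :: "nat \<Rightarrow> 'j set"
  assumes F: "\<And>j. F j \<in> L2 M" and B: "synthesis_bound M F B"
    and X: "incseq X" "\<And>N. finite (X N)"
    and c: "(\<lambda>j. (cmod (c j))\<^sup>2) summable_on UNIV"
  shows "\<exists>g. L2_converges M (\<lambda>N x. \<Sum>j\<in>X N. c j * F j x) g"
proof (rule L2_complete)
  show "(\<lambda>x. \<Sum>j\<in>X N. c j * F j x) \<in> L2 M" for N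
    by (intro L2_sum L2_cmult F)
next
  fix e :: real assume e: "e > 0"
  define s where "s = (\<lambda>N. \<Sum>j\<in>X N. (cmod (c j))\<^sup>2)"
  have "incseq s"
    unfolding s_def incseq_def by (auto intro!: sum_mono2 X(2) dest: X(1)[THEN incseqD])
  moreover have "s N \<le> (\<Sum>\<^sub>\<infinity>j. (cmod (c j))\<^sup>2)" for N
    unfolding s_def by (rule finite_sum_le_infsum[OF c]) (auto simp: X)
  ultimately have "Cauchy s"
    by (meson LIMSEQ_imp_Cauchy incseq_convergent)
  moreover have "e\<^sup>2 / (\<bar>B\<bar> + 1) > 0" using e by simp
  ultimately obtain N where N: "\<And>m n. m \<ge> N \<Longrightarrow> n \<ge> N \<Longrightarrow> norm (s m - s n) < e\<^sup>2 / (\<bar>B\<bar> + 1)"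
    using CauchyD by blast
  have *: "L2_norm M (\<lambda>x. (\<Sum>j\<in>X m. c j * F j x) - (\<Sum>j\<in>X n. c j * F j x)) < e"
    if "n \<ge> N" "m \<ge> n" for m n
  proof -
    have sub: "X n \<subseteq> (X m)"
      using that by (intro incseqD[OF X(1)])
    have "(L2_norm M (\<lambda>x. \<Sum>j\<in>X m - X n. c j * F j x))\<^sup>2
        \<le> B * (\<Sum>j\<in>X m - X n. (cmod (c j))\<^sup>2)"
      by (rule synthesis_boundD[OF B]) (auto simp: X)
    also have "\<dots> = B * (s m - s n)"
      unfolding s_def using sub by (subst sum_diff) (auto simp: X)
    also have "\<dots> \<le> (\<bar>B\<bar> + 1) * norm (s m - s n)"
      using \<open>incseq s\<close>[THEN incseqD, OF that(2)] by (intro mult_mono) auto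
    also have "\<dots> < e\<^sup>2"
      using N[of m n] that by (simp add: field_simps)
    finally have "L2_norm M (\<lambda>x. \<Sum>j\<in>X m - X n. c j * F j x) < e"
      using e by (auto intro: power_less_imp_less_base)
    then show ?thesis
      using sub by (subst (asm) sum_diff) (auto simp: X)
  qed
  show "\<exists>N. \<forall>m\<ge>N. \<forall>n\<ge>N. L2_norm M (\<lambda>x. (\<Sum>j\<in>X m. c j * F j x) -
      (\<Sum>j\<in>X n. c j * F j x)) < e"
  proof (intro exI[of _ N] allI impI)
    fix m n assume "m \<ge> N" "n \<ge> N"
    then show "L2_norm M (\<lambda>x. (\<Sum>j\<in>X m. c j * F j x) -
        (\<Sum>j\<in>X n. c j * F j x)) < e"
      using *[of n m] *[of m n]
        L2_norm_diff_commute[of M "\<lambda>x. \<Sum>j\<in>X m. c j * F j x"]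
      by (cases "m \<le> n") auto
  qed
qed

lemma synthesis_bound_imp_hilbertian:
  fixes F :: "(int^'n) \<times> (int^'n) \<Rightarrow> 'a \<Rightarrow> complex"
  assumes F: "\<And>j. F j \<in> L2 M" and B: "synthesis_bound M F B"
  shows "hilbertian M F"
proof -
  have "incseq (lattice_box :: nat \<Rightarrow> ((int^'n) \<times> (int^'n)) set)"
    by (simp add: incseq_def lattice_box_mono)
  then show ?thesis
    unfolding hilbertian_def
    by (intro conjI allI impI F synthesis_bound_imp_converges[OF F B] finite_lattice_box)
qed

lemma L2_norm_add_power2_le:
  assumes "f \<in> L2 M" "g \<in> L2 M"
  shows "(L2_norm M (\<lambda>x. f x + g x))\<^sup>2 \<le> 2 * (L2_norm M f)\<^sup>2 + 2 * (L2_norm M g)\<^sup>2"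
proof -
  have "(L2_norm M (\<lambda>x. f x + g x))\<^sup>2 \<le> (L2_norm M f + L2_norm M g)\<^sup>2"
    by (intro power_mono L2_norm_triangle assms) auto
  also have "\<dots> \<le> 2 * (L2_norm M f)\<^sup>2 + 2 * (L2_norm M g)\<^sup>2"
    using sum_squares_bound[of "L2_norm M f" "L2_norm M g"] by (simp add: power2_sum)
  finally show ?thesis .
qed

lemma L2_norm_finite_combination_le:
  assumes F: "\<And>j. j \<in> J \<Longrightarrow> F j \<in> L2 M"
  shows "(L2_norm M (\<lambda>x. \<Sum>j\<in>J. c j * F j x))\<^sup>2
    \<le> (\<Sum>j\<in>J. (L2_norm M (F j))\<^sup>2) * (\<Sum>j\<in>J. (cmod (c j))\<^sup>2)"
proof -
  have "L2_norm M (\<lambda>x. \<Sum>j\<in>J. c j * F j x) \<le> (\<Sum>j\<in>J. L2_norm M (F j) * cmod (c j))"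
    by (rule order_trans[OF L2_norm_sum_le]) (auto intro: L2_cmult F simp: L2_norm_cmult mult.commute)
  then have "(L2_norm M (\<lambda>x. \<Sum>j\<in>J. c j * F j x))\<^sup>2 \<le> (\<Sum>j\<in>J. L2_norm M (F j) * cmod (c j))\<^sup>2"
    by (intro power_mono) auto
  also have "\<dots> \<le> (\<Sum>j\<in>J. (L2_norm M (F j))\<^sup>2) * (\<Sum>j\<in>J. (cmod (c j))\<^sup>2)"
    by (rule Cauchy_Schwarz_ineq_sum)
  finally show ?thesis .
qed

text \<open>One hump. On a fixed box the synthesis is bounded because the box is finite, so unboundedness has
  to come from coefficients outside of the box. Scaling makes the hump large and its coefficients
  small at the same time.\<close>

lemma unbounded_synthesis_beyond_box:
  fixes F :: "(int^'n) \<times> (int^'n) \<Rightarrow> 'a \<Rightarrow> complex"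
  assumes F: "\<And>j. F j \<in> L2 M" and unbounded: "\<nexists>B. synthesis_bound M F B"
  shows "\<exists>N' c. N' > N \<and> (\<forall>j. j \<notin> lattice_box N' - lattice_box N \<longrightarrow> c j = 0) \<and>
    (\<Sum>j\<in>lattice_box N'. (cmod (c j))\<^sup>2) \<le> (1/2)^i \<and>
    1 \<le> L2_norm M (\<lambda>x. \<Sum>j\<in>lattice_box N'. c j * F j x)"
proof -
  define C where "C = (\<Sum>j\<in>lattice_box N. (L2_norm M (F j))\<^sup>2)"
  obtain J c where J: "finite J" and big:
      "(L2_norm M (\<lambda>x. \<Sum>j\<in>J. c j * F j x))\<^sup>2 > (2 * C + 2 * 2^i) * (\<Sum>j\<in>J. (cmod (c j))\<^sup>2)"
    using unbounded unfolding synthesis_bound_def not_ex not_all not_imp not_le by blast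
  define s where "s = (\<Sum>j\<in>J. (cmod (c j))\<^sup>2)"
  obtain N' where N': "N' \<ge> Suc N" "J \<subseteq> lattice_box N'"
    using finite_subset_lattice_box[OF J] by blast
  define J1 where "J1 = J \<inter> lattice_box N"
  define J2 where "J2 = J - lattice_box N"
  have J12: "finite J1" "finite J2" "J1 \<inter> J2 = {}" "J = J1 \<union> J2"
    using J by (auto simp: J1_def J2_def)
  define f where "f = (\<lambda>A x. \<Sum>j\<in>A. c j * F j x)"
  have f: "f A \<in> L2 M" for A unfolding f_def by (intro L2_sum L2_cmult F)
  have fJ: "(\<lambda>x. \<Sum>j\<in>J. c j * F j x) = f J" by (simp add: f_def)
  have "f J = (\<lambda>x. f J1 x + f J2 x)"
    unfolding f_def J12(4) using J12 by (intro ext sum.union_disjoint) auto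
  then have "(L2_norm M (f J))\<^sup>2 \<le> 2 * (L2_norm M (f J1))\<^sup>2 + 2 * (L2_norm M (f J2))\<^sup>2"
    using L2_norm_add_power2_le[OF f f] by simp
  moreover have "(L2_norm M (f J1))\<^sup>2 \<le> C * s"
  proof -
    have "(L2_norm M (f J1))\<^sup>2 \<le> (\<Sum>j\<in>J1. (L2_norm M (F j))\<^sup>2) * (\<Sum>j\<in>J1. (cmod (c j))\<^sup>2)"
      unfolding f_def by (rule L2_norm_finite_combination_le) (rule F)
    also have "\<dots> \<le> C * s"
      unfolding C_def s_def J1_def using J by (intro mult_mono sum_mono2 sum_nonneg) auto
    finally show ?thesis .
  qed
  ultimately have t: "(L2_norm M (f J2))\<^sup>2 > 2^i * s"
    using big unfolding s_def[symmetric] fJ by (simp add: algebra_simps)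
  have s0: "s \<ge> 0" unfolding s_def by (auto intro: sum_nonneg)
  define t where "t = L2_norm M (f J2)"
  have t0: "t > 0"
  proof -
    have "0 \<le> 2^i * s" using s0 by simp
    then have "t\<^sup>2 > 0" using t unfolding t_def by linarith
    then show ?thesis using L2_norm_nonneg[of M "f J2"] by (auto simp: t_def less_le)
  qed
  define c' where "c' = (\<lambda>j. if j \<in> J2 then c j / t else 0)"
  have J2N': "J2 \<subseteq> lattice_box N'" using N' by (auto simp: J2_def)
  have "(\<Sum>j\<in>lattice_box N'. (cmod (c' j))\<^sup>2) = (\<Sum>j\<in>J2. (cmod (c j / t))\<^sup>2)"
    using J2N' by (intro sum.mono_neutral_cong_right) (auto simp: c'_def)
  also have "\<dots> = (\<Sum>j\<in>J2. (cmod (c j))\<^sup>2) / t\<^sup>2"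
    by (simp add: norm_divide power_divide sum_divide_distrib)
  also have "\<dots> \<le> s / t\<^sup>2"
    unfolding s_def by (intro divide_right_mono sum_mono2) (auto simp: J2_def J)
  also have "\<dots> \<le> (1/2)^i"
    using t t0 by (simp add: t_def[symmetric] field_simps power_one_over)
  finally have small: "(\<Sum>j\<in>lattice_box N'. (cmod (c' j))\<^sup>2) \<le> (1/2)^i" .
  have "(\<lambda>x. \<Sum>j\<in>lattice_box N'. c' j * F j x) = (\<lambda>x. \<Sum>j\<in>J2. (c j / t) * F j x)"
    using J2N' by (intro ext sum.mono_neutral_cong_right) (auto simp: c'_def)
  also have "\<dots> = (\<lambda>x. (1 / complex_of_real t) * f J2 x)"
    by (simp add: f_def sum_distrib_left)
  finally have "L2_norm M (\<lambda>x. \<Sum>j\<in>lattice_box N'. c' j * F j x) = 1"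
    using t0 by (simp only: L2_norm_cmult) (simp add: norm_divide t_def[symmetric])
  moreover have "\<forall>j. j \<notin> lattice_box N' - lattice_box N \<longrightarrow> c' j = 0"
    using J2N' by (auto simp: c'_def J2_def)
  ultimately show ?thesis
    using N' small by (intro exI[of _ N'] exI[of _ c']) auto
qed

text \<open>Gliding hump: humps in successive disjoint annuli add up to a square-summable coefficient family
  whose partial sums over the boxes move by at least \<open>1\<close> infinitely often.\<close>

lemma hilbertian_imp_synthesis_bound:
  fixes F :: "(int^'n) \<times> (int^'n) \<Rightarrow> 'a \<Rightarrow> complex"
  assumes hilb: "hilbertian M F"
  shows "\<exists>B. synthesis_bound M F B"
proof (rule ccontr)
  assume unbounded: "\<nexists>B. synthesis_bound M F B"
  have F: "\<And>j. F j \<in> L2 M" using hilb unfolding hilbertian_def by blast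
  define hump where "hump = (\<lambda>N i N' c. N' > N \<and>
    (\<forall>j. j \<notin> lattice_box N' - lattice_box N \<longrightarrow> c j = 0) \<and>
    (\<Sum>j\<in>lattice_box N'. (cmod (c j))\<^sup>2) \<le> (1/2)^i \<and>
    1 \<le> L2_norm M (\<lambda>x. \<Sum>j\<in>lattice_box N'. c j * F j x))"
  have "\<exists>N' c. hump N i N' c" for N i
    unfolding hump_def by (rule unbounded_synthesis_beyond_box[OF F unbounded])
  then obtain next_box coeff where "\<And>N i. hump N i (next_box N i) (coeff N i)"
    by metis
  then have hump: "next_box N i > N"
      "j \<notin> lattice_box (next_box N i) - lattice_box N \<Longrightarrow> coeff N i j = 0"
      "(\<Sum>j\<in>lattice_box (next_box N i). (cmod (coeff N i j))\<^sup>2) \<le> (1/2)^i"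
      "1 \<le> L2_norm M (\<lambda>x. \<Sum>j\<in>lattice_box (next_box N i). coeff N i j * F j x)" for N i j
    unfolding hump_def by blast+
  define r where "r = rec_nat 0 (\<lambda>i N. next_box N i)"
  have r_Suc: "r (Suc i) = next_box (r i) i" for i by (simp add: r_def)
  have r: "strict_mono r"
    by (rule strict_monoI_Suc) (simp add: r_Suc hump(1))
  \<comment> \<open>Each index is served by the first hump whose outer box contains it; inside of the first box this
    choice yields the coefficient \<open>0\<close>.\<close>
  define c where "c = (\<lambda>j. coeff (r (LEAST i. j \<in> lattice_box (r (Suc i)))) (LEAST i. j \<in> lattice_box (r (Suc i))) j)"
  have c_eq: "c j = coeff (r i) i j" if j: "j \<in> lattice_box (r (Suc i)) - lattice_box (r i)" for i j
  proof -
    have "(LEAST i. j \<in> lattice_box (r (Suc i))) = i"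
    proof (rule Least_equality)
      fix k assume k: "j \<in> lattice_box (r (Suc k))"
      show "i \<le> k"
      proof (rule ccontr)
        assume "\<not> i \<le> k"
        then have "r (Suc k) \<le> r i" using strict_mono_less_eq[OF r] by auto
        then show False using lattice_box_mono[of "r (Suc k)" "r i"] k j by auto
      qed
    qed (use j in auto)
    then show ?thesis by (simp add: c_def)
  qed
  have c_0: "c j = 0" if "j \<in> lattice_box (r 0)" for j
  proof -
    have "j \<in> lattice_box (r (Suc 0))"
      using that lattice_box_mono[of "r 0" "r (Suc 0)"] strict_mono_less_eq[OF r, of 0 "Suc 0"] by auto
    then have "(LEAST i. j \<in> lattice_box (r (Suc i))) = 0" by (intro Least_equality) auto
    then show ?thesis using that by (simp add: c_def hump(2))
  qed
  have sub: "lattice_box (r k) \<subseteq> lattice_box (r (Suc k))" for k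
    by (rule lattice_box_mono) (simp add: strict_mono_less_eq[OF r])
  have partial: "(\<Sum>j\<in>lattice_box (r k). (cmod (c j))\<^sup>2) \<le> (\<Sum>i<k. (1/2)^i)" for k
  proof (induction k)
    case (Suc k)
    have "(\<Sum>j\<in>lattice_box (r (Suc k)). (cmod (c j))\<^sup>2)
        = (\<Sum>j\<in>lattice_box (r (Suc k)) - lattice_box (r k). (cmod (c j))\<^sup>2)
          + (\<Sum>j\<in>lattice_box (r k). (cmod (c j))\<^sup>2)"
      by (rule sum.subset_diff[OF sub]) simp
    also have "(\<Sum>j\<in>lattice_box (r (Suc k)) - lattice_box (r k). (cmod (c j))\<^sup>2)
        = (\<Sum>j\<in>lattice_box (r (Suc k)) - lattice_box (r k). (cmod (coeff (r k) k j))\<^sup>2)"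
      by (intro sum.cong) (auto simp: c_eq)
    also have "\<dots> \<le> (\<Sum>j\<in>lattice_box (r (Suc k)). (cmod (coeff (r k) k j))\<^sup>2)"
      by (rule sum_mono2) auto
    also have "\<dots> \<le> (1/2)^k" using hump(3)[where N = "r k" and i = k] by (simp add: r_Suc)
    finally show ?case using Suc by simp
  qed (simp add: c_0)
  have "(\<lambda>j. (cmod (c j))\<^sup>2) summable_on UNIV"
  proof (rule nonneg_bdd_above_summable_on)
    show "bdd_above (sum (\<lambda>j. (cmod (c j))\<^sup>2) ` {F. F \<subseteq> UNIV \<and> finite F})"
    proof (rule bdd_aboveI2)
      fix J :: "((int^'n) \<times> (int^'n)) set" assume "J \<in> {F. F \<subseteq> UNIV \<and> finite F}"
      then obtain N where N: "J \<subseteq> lattice_box N"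
        using finite_subset_lattice_box[of J 0] by auto
      then have JN: "J \<subseteq> lattice_box (r N)"
        using lattice_box_mono[OF seq_suble[OF r, of N]] by auto
      have "(\<Sum>j\<in>J. (cmod (c j))\<^sup>2) \<le> (\<Sum>j\<in>lattice_box (r N). (cmod (c j))\<^sup>2)"
        using JN by (intro sum_mono2) auto
      also have "\<dots> \<le> (\<Sum>i<N. (1/2)^i)" by (rule partial)
      also have "\<dots> \<le> 2"
        by (subst sum_gp_strict) (auto simp: field_simps)
      finally show "(\<Sum>j\<in>J. (cmod (c j))\<^sup>2) \<le> 2" .
    qed
  qed auto
  then obtain g where g: "L2_converges M (\<lambda>N x. \<Sum>j\<in>lattice_box N. c j * F j x) g"
    using hilb by (auto simp: hilbertian_def)
  then obtain N where N: "\<And>m n. m \<ge> N \<Longrightarrow> n \<ge> N \<Longrightarrow> L2_norm M (\<lambda>x. (\<Sum>j\<in>lattice_box m. c j * F j x) -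
      (\<Sum>j\<in>lattice_box n. c j * F j x)) < 1"
    using L2_converges_imp_Cauchy[OF g, of 1] by auto
  have "(\<lambda>x. (\<Sum>j\<in>lattice_box (r (Suc N)). c j * F j x) - (\<Sum>j\<in>lattice_box (r N). c j * F j x))
      = (\<lambda>x. \<Sum>j\<in>lattice_box (r (Suc N)). coeff (r N) N j * F j x)"
  proof
    fix x
    have "(\<Sum>j\<in>lattice_box (r (Suc N)). c j * F j x) - (\<Sum>j\<in>lattice_box (r N). c j * F j x)
        = (\<Sum>j\<in>lattice_box (r (Suc N)) - lattice_box (r N). c j * F j x)"
      by (rule sum_diff[symmetric]) (auto intro: sub[THEN subsetD])
    also have "\<dots> = (\<Sum>j\<in>lattice_box (r (Suc N)). coeff (r N) N j * F j x)"
      by (rule sum.mono_neutral_cong_left) (auto simp: c_eq r_Suc hump(2))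
    finally show "(\<Sum>j\<in>lattice_box (r (Suc N)). c j * F j x) - (\<Sum>j\<in>lattice_box (r N). c j * F j x)
        = (\<Sum>j\<in>lattice_box (r (Suc N)). coeff (r N) N j * F j x)" .
  qed
  moreover have "r N \<ge> N" "r (Suc N) \<ge> N"
    using seq_suble[OF r, of N] seq_suble[OF r, of "Suc N"] by auto
  ultimately show False
    using N[of "r (Suc N)" "r N"] hump(4)[of "r N" N] by (simp add: r_Suc)
qed

section \<open>Sums over countable index sets\<close>

text \<open>An exhaustion of a countable index set by finite sets, so that sums over the lattice become
  monotone limits of finite sums.\<close>

definition initial_indices :: "nat \<Rightarrow> 'j::countable set" where
  "initial_indices N = from_nat ` {..<N}"

lemma finite_initial_indices[simp]: "finite (initial_indices N)"
  by (simp add: initial_indices_def)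

lemma incseq_initial_indices: "incseq initial_indices"
  by (auto simp: incseq_def initial_indices_def)

lemma finite_subset_initial_indices:
  assumes "finite J" shows "\<exists>N. J \<subseteq> initial_indices N"
proof
  have "j = from_nat (to_nat j) \<and> to_nat j < Suc (Max (to_nat ` J))" if "j \<in> J" for j
    using assms that by (simp add: le_imp_less_Suc)
  then show "J \<subseteq> initial_indices (Suc (Max (to_nat ` J)))"
    unfolding initial_indices_def by blast
qed

lemma nn_integral_count_space_SUP:
  fixes f :: "'j::countable \<Rightarrow> ennreal"
  shows "(\<integral>\<^sup>+j. f j \<partial>count_space UNIV) = (SUP N. \<Sum>j\<in>initial_indices N. f j)"
proof -
  have "f j = (SUP N. f j * indicator (initial_indices N) j)" for j
  proof (rule antisym)
    obtain N where "j \<in> initial_indices N"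
      using finite_subset_initial_indices[of "{j}"] by auto
    then show "f j \<le> (SUP N. f j * indicator (initial_indices N) j)"
      by (intro SUP_upper2[of N]) auto
  qed (auto intro!: SUP_least split: split_indicator)
  then have "(\<integral>\<^sup>+j. f j \<partial>count_space UNIV)
      = (\<integral>\<^sup>+j. (SUP N. f j * indicator (initial_indices N) j) \<partial>count_space UNIV)"
    by presburger
  also have "\<dots> = (SUP N. \<integral>\<^sup>+j. f j * indicator (initial_indices N) j \<partial>count_space UNIV)"
    using incseqD[OF incseq_initial_indices]
    by (intro nn_integral_monotone_convergence_SUP)
       (auto simp: incseq_def le_fun_def split: split_indicator)
  also have "\<dots> = (SUP N. \<Sum>j\<in>initial_indices N. f j)"
    by (simp add: nn_integral_count_space_indicator[symmetric] nn_integral_count_space_finite)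
  finally show ?thesis .
qed

lemma infsum_ennreal_eq_nn_integral:
  fixes f :: "'j::countable \<Rightarrow> ennreal"
  shows "(\<Sum>\<^sub>\<infinity>j. f j) = (\<integral>\<^sup>+j. f j \<partial>count_space UNIV)"
proof -
  have "(\<Sum>\<^sub>\<infinity>j. f j) = (SUP J\<in>{J. finite J \<and> J \<subseteq> UNIV}. sum f J)"
    by (rule nonneg_infsum_complete) simp
  also have "\<dots> = (SUP N. \<Sum>j\<in>initial_indices N. f j)"
  proof (rule antisym)
    show "(SUP J\<in>{J. finite J \<and> J \<subseteq> UNIV}. sum f J) \<le> (SUP N. \<Sum>j\<in>initial_indices N. f j)"
    proof (rule SUP_least)
      fix J :: "'j set" assume "J \<in> {J. finite J \<and> J \<subseteq> UNIV}"
      then obtain N where "J \<subseteq> initial_indices N"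
        using finite_subset_initial_indices[of J] by auto
      then show "sum f J \<le> (SUP N. \<Sum>j\<in>initial_indices N. f j)"
        by (intro SUP_upper2[of N] sum_mono2) auto
    qed
  qed (auto intro!: SUP_least SUP_upper)
  finally show ?thesis
    by (simp add: nn_integral_count_space_SUP)
qed

lemma nn_integral_count_space_commute:
  fixes f :: "'j::countable \<Rightarrow> 'a \<Rightarrow> ennreal"
  assumes [measurable]: "\<And>j. f j \<in> borel_measurable M"
  shows "(\<integral>\<^sup>+x. (\<integral>\<^sup>+j. f j x \<partial>count_space UNIV) \<partial>M) = (\<integral>\<^sup>+j. (\<integral>\<^sup>+x. f j x \<partial>M) \<partial>count_space UNIV)"
proof -
  have "(\<integral>\<^sup>+x. (\<integral>\<^sup>+j. f j x \<partial>count_space UNIV) \<partial>M)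
      = (\<integral>\<^sup>+x. (SUP N. \<Sum>j\<in>initial_indices N. f j x) \<partial>M)"
    by (simp add: nn_integral_count_space_SUP)
  also have "\<dots> = (SUP N. \<integral>\<^sup>+x. (\<Sum>j\<in>initial_indices N. f j x) \<partial>M)"
    using incseqD[OF incseq_initial_indices]
    by (intro nn_integral_monotone_convergence_SUP) (auto simp: incseq_def le_fun_def intro!: sum_mono2)
  also have "\<dots> = (SUP N. \<Sum>j\<in>initial_indices N. \<integral>\<^sup>+x. f j x \<partial>M)"
    by (simp add: nn_integral_sum)
  finally show ?thesis
    by (simp add: nn_integral_count_space_SUP)
qed

lemma borel_measurable_nn_integral_count_space:
  fixes f :: "'j::countable \<Rightarrow> 'a \<Rightarrow> ennreal"
  assumes [measurable]: "\<And>j. f j \<in> borel_measurable M"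
  shows "(\<lambda>x. \<integral>\<^sup>+j. f j x \<partial>count_space UNIV) \<in> borel_measurable M"
  unfolding nn_integral_count_space_SUP by measurable

section \<open>The torus and the lattice\<close>

definition cell :: "(real^'n) set" where
  "cell = {\<xi>. \<forall>i. 0 \<le> \<xi> $ i \<and> \<xi> $ i < 1}"

lemma torus_eq: "torus = restrict_space lborel cell"
  by (simp add: torus_def cell_def)

lemma borel_measurable_vec_component[measurable (raw)]:
  fixes f :: "'a \<Rightarrow> real^'n"
  assumes "f \<in> borel_measurable M"
  shows "(\<lambda>x. f x $ i) \<in> borel_measurable M"
  by (rule borel_measurable_continuous_on[OF _ assms]) (intro continuous_intros)

lemma cell_measurable[measurable]: "cell \<in> sets borel"
proof -
  have "cell = (\<Inter>i. {\<xi> :: real^'n \<in> space borel. 0 \<le> \<xi> $ i \<and> \<xi> $ i < 1})"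
    by (auto simp: cell_def)
  also have "\<dots> \<in> sets borel" by measurable
  finally show ?thesis .
qed

lemma space_torus[simp]: "space torus = cell"
  by (simp add: torus_eq space_restrict_space)

lemma nn_integral_torus: "(\<integral>\<^sup>+\<xi>. f \<xi> \<partial>torus) = (\<integral>\<^sup>+\<xi>. f \<xi> * indicator cell \<xi> \<partial>lborel)"
  unfolding torus_eq by (rule nn_integral_restrict_space) auto

lemma integral_torus:
  "(\<integral>\<xi>. f \<xi> \<partial>torus) = (\<integral>\<xi>. indicator cell \<xi> *\<^sub>R (f \<xi> :: 'b::{banach, second_countable_topology}) \<partial>lborel)"
  unfolding torus_eq by (rule integral_restrict_space) auto

lemma measurable_torusI[measurable (raw)]:
  "f \<in> borel_measurable borel \<Longrightarrow> f \<in> borel_measurable torus"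
  unfolding torus_eq by (rule measurable_restrict_space1) auto

lemma vec_of_int_nth[simp]: "vec_of_int k $ i = real_of_int (k $ i)"
  by (simp add: vec_of_int_def)

lemma vec_of_int_add: "vec_of_int (k + l) = vec_of_int k + vec_of_int l"
  by (simp add: vec_eq_iff)

lemma vec_of_int_uminus: "vec_of_int (- k) = - vec_of_int k"
  by (simp add: vec_eq_iff)

lemma vec_of_int_zero[simp]: "vec_of_int 0 = 0"
  by (simp add: vec_eq_iff)

lemma inner_vec_of_int_Ints: "vec_of_int k \<bullet> vec_of_int l \<in> \<int>"
  unfolding inner_vec_def by (auto intro!: Ints_sum)

lemma unique_lattice_shift:
  "\<exists>!m. \<xi> - vec_of_int m \<in> cell"
proof
  show "\<xi> - vec_of_int (\<chi> i. \<lfloor>\<xi> $ i\<rfloor>) \<in> cell"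
    by (auto simp: cell_def) linarith
  fix m assume "\<xi> - vec_of_int m \<in> cell"
  then have "m $ i = \<lfloor>\<xi> $ i\<rfloor>" for i
    by (intro floor_unique[symmetric]) (auto simp: cell_def algebra_simps)
  then show "m = (\<chi> i. \<lfloor>\<xi> $ i\<rfloor>)"
    by (simp add: vec_eq_iff)
qed

lemma nn_integral_lborel_translation:
  fixes f :: "'a::euclidean_space \<Rightarrow> ennreal"
  assumes [measurable]: "f \<in> borel_measurable borel"
  shows "(\<integral>\<^sup>+x. f (x + a) \<partial>lborel) = (\<integral>\<^sup>+x. f x \<partial>lborel)"
proof -
  have "(\<integral>\<^sup>+x. f x \<partial>lborel) = (\<integral>\<^sup>+x. f x \<partial>distr lborel borel ((+) a))"
    by (simp add: lborel_distr_plus)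
  also have "\<dots> = (\<integral>\<^sup>+x. f (x + a) \<partial>lborel)"
    by (subst nn_integral_distr) (auto simp: add.commute)
  finally show ?thesis by simp
qed

text \<open>The translates of the cell by lattice vectors tile the space.\<close>

lemma nn_integral_periodization:
  fixes f :: "real^'n \<Rightarrow> ennreal"
  assumes [measurable]: "f \<in> borel_measurable borel"
  shows "(\<integral>\<^sup>+\<xi>. f \<xi> \<partial>lborel) = (\<integral>\<^sup>+\<xi>. (\<integral>\<^sup>+m. f (\<xi> + vec_of_int m) \<partial>count_space UNIV) \<partial>torus)"
proof -
  have single: "(\<integral>\<^sup>+m. f \<xi> * indicator cell (\<xi> - vec_of_int m) \<partial>count_space UNIV) = f \<xi>" for \<xi> :: "real^'n"
  proof -
    obtain m0 where m0: "\<And>m. \<xi> - vec_of_int m \<in> cell \<longleftrightarrow> m = m0"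
      using unique_lattice_shift[of \<xi>] by metis
    have "(\<lambda>m. f \<xi> * indicator cell (\<xi> - vec_of_int m)) = (\<lambda>m. f \<xi> * indicator {m0} m)"
      by (auto simp: m0 fun_eq_iff split: split_indicator)
    then show ?thesis
      by (simp add: nn_integral_cmult_indicator)
  qed
  have "(\<integral>\<^sup>+\<xi>. f \<xi> \<partial>lborel)
      = (\<integral>\<^sup>+\<xi>. (\<integral>\<^sup>+m. f \<xi> * indicator cell (\<xi> - vec_of_int m) \<partial>count_space UNIV) \<partial>lborel)"
    by (simp only: single)
  also have "\<dots> = (\<integral>\<^sup>+m. (\<integral>\<^sup>+\<xi>. f \<xi> * indicator cell (\<xi> - vec_of_int m) \<partial>lborel) \<partial>count_space UNIV)"
    by (rule nn_integral_count_space_commute) measurable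
  also have "\<dots> = (\<integral>\<^sup>+m. (\<integral>\<^sup>+\<xi>. f (\<xi> + vec_of_int m) * indicator cell \<xi> \<partial>lborel) \<partial>count_space UNIV)"
  proof (rule nn_integral_cong)
    fix m :: "int^'n"
    show "(\<integral>\<^sup>+\<xi>. f \<xi> * indicator cell (\<xi> - vec_of_int m) \<partial>lborel)
        = (\<integral>\<^sup>+\<xi>. f (\<xi> + vec_of_int m) * indicator cell \<xi> \<partial>lborel)"
      by (subst nn_integral_lborel_translation[of _ "vec_of_int m", symmetric]) auto
  qed
  also have "\<dots> = (\<integral>\<^sup>+\<xi>. (\<integral>\<^sup>+m. f (\<xi> + vec_of_int m) * indicator cell \<xi> \<partial>count_space UNIV) \<partial>lborel)"
    by (rule nn_integral_count_space_commute[symmetric]) measurable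
  also have "\<dots> = (\<integral>\<^sup>+\<xi>. (\<integral>\<^sup>+m. f (\<xi> + vec_of_int m) \<partial>count_space UNIV) \<partial>torus)"
    by (simp add: nn_integral_torus nn_integral_multc)
  finally show ?thesis .
qed

section \<open>Characters of the torus\<close>

definition character :: "int^'n \<Rightarrow> real^'n \<Rightarrow> complex" where
  "character k \<xi> = cis (2 * pi * (\<xi> \<bullet> vec_of_int k))"

lemma character_mult: "character k \<xi> * character l \<xi> = character (k + l) \<xi>"
  by (simp add: character_def cis_mult vec_of_int_add inner_add_right distrib_left)

lemma cnj_character: "cnj (character k \<xi>) = character (- k) \<xi>"
  by (simp add: character_def cis_cnj vec_of_int_uminus)

lemma norm_character[simp]: "norm (character k \<xi>) = 1"
  by (simp add: character_def)

lemma character_zero[simp]: "character 0 \<xi> = 1"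
  by (simp add: character_def)

lemma character_periodic: "character k (\<xi> + vec_of_int m) = character k \<xi>"
  using inner_vec_of_int_Ints[of m k]
  by (simp add: character_def inner_add_left distrib_left cis_mult[symmetric])

lemma character_measurable[measurable]: "character k \<in> borel_measurable borel"
  unfolding character_def cis_conv_exp by measurable

lemma cis_sum: "finite A \<Longrightarrow> cis (\<Sum>i\<in>A. f i) = (\<Prod>i\<in>A. cis (f i))"
  by (induction A rule: finite_induct) (auto simp: cis_mult[symmetric])

lemma character_eq_prod: "character k \<xi> = (\<Prod>i\<in>UNIV. cis (2 * pi * real_of_int (k $ i) * \<xi> $ i))"
  unfolding character_def inner_vec_def
  by (subst cis_sum[symmetric]) (auto simp: sum_distrib_left mult_ac)

text \<open>Fubini in coordinates: Lebesgue measure on \<open>real ^ 'n\<close> is the image of a product of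
  one-dimensional Lebesgue measures indexed by the standard basis.\<close>

lemma lborel_integral_prod:
  fixes f :: "'n::finite \<Rightarrow> real \<Rightarrow> complex"
  assumes f: "\<And>i. integrable lborel (f i)"
  shows "(\<integral>x. (\<Prod>i\<in>UNIV. f i (x $ i)) \<partial>lborel) = (\<Prod>i\<in>UNIV. \<integral>t. f i t \<partial>lborel)"
proof -
  interpret product_sigma_finite "\<lambda>_. lborel :: real measure" by standard
  have [measurable]: "f i \<in> borel_measurable borel" for i
    using borel_measurable_integrable[OF f[of i]] by simp
  have reindex: "(\<Prod>i\<in>UNIV. g i) = (\<Prod>b\<in>Basis. g (axis_index (b :: real^'n)))" for g :: "'n \<Rightarrow> complex"
  proof -
    have basis: "(Basis :: (real^'n) set) = range (\<lambda>i. axis i 1)"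
      by (auto simp: Basis_vec_def)
    have inj: "inj (\<lambda>i. axis i 1 :: real^'n)"
      by (auto simp: inj_on_def axis_eq_axis)
    have "axis_index (axis i 1 :: real^'n) = i" for i
      unfolding axis_index_def by (rule some_equality) (auto simp: axis_eq_axis)
    then show ?thesis
      unfolding basis by (subst prod.reindex[OF inj]) simp
  qed
  have coord: "(\<Sum>b\<in>Basis. y b *\<^sub>R b) $ axis_index b' = y b'" if "b' \<in> Basis" for y and b' :: "real^'n"
  proof -
    have "(\<Sum>b\<in>Basis. y b *\<^sub>R b) \<bullet> b' = y b'"
      using that by simp
    moreover have "v $ axis_index b' = v \<bullet> b'" for v :: "real^'n"
      using axis_index[OF that] inner_axis[of v "axis_index b'" "1::real"] by simp
    ultimately show ?thesis by simp
  qed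
  have "(\<integral>x. (\<Prod>i\<in>UNIV. f i (x $ i)) \<partial>lborel)
      = (\<integral>y. (\<Prod>i\<in>UNIV. f i ((\<Sum>b\<in>Basis. y b *\<^sub>R (b :: real^'n)) $ i)) \<partial>(\<Pi>\<^sub>M b\<in>(Basis :: (real^'n) set). lborel))"
    unfolding lborel_eq[where 'a="real^'n"] by (subst integral_distr) auto
  also have "\<dots> = (\<integral>y. (\<Prod>b\<in>(Basis :: (real^'n) set). f (axis_index b) (y b)) \<partial>(\<Pi>\<^sub>M b\<in>(Basis :: (real^'n) set). lborel))"
    unfolding reindex by (intro Bochner_Integration.integral_cong prod.cong refl) (simp only: coord)
  also have "\<dots> = (\<Prod>b\<in>(Basis :: (real^'n) set). \<integral>t. f (axis_index b) t \<partial>lborel)"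
    by (intro product_integral_prod f) auto
  finally show ?thesis
    by (simp add: reindex)
qed

lemma has_bochner_integral_cis_unit_interval:
  "has_bochner_integral lborel (\<lambda>t. indicator {0..<1} t *\<^sub>R cis (2 * pi * real_of_int m * t)) (of_bool (m = 0))"
proof -
  have Icc: "has_bochner_integral lborel (\<lambda>t. indicator {0..1} t *\<^sub>R cis (2 * pi * real_of_int m * t)) (of_bool (m = 0))"
  proof (cases "m = 0")
    case True
    have "has_bochner_integral lborel (\<lambda>t. indicator {0..1::real} t *\<^sub>R (1::complex)) (of_real 1 - of_real 0)"
      by (rule has_bochner_integral_FTC_Icc) (auto intro!: derivative_eq_intros has_vector_derivative_real_field)
    then show ?thesis using True by simp
  next
    case False
    define c where "c = 2 * of_real pi * of_int m * \<i>"
    have c: "c \<noteq> 0" using False by (simp add: c_def)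
    have cis_eq: "cis (2 * pi * real_of_int m * t) = exp (c * of_real t)" for t
      by (simp add: cis_conv_exp c_def mult_ac)
    have "has_bochner_integral lborel (\<lambda>t. indicator {0..1} t *\<^sub>R exp (c * of_real t))
        (exp (c * of_real 1) / c - exp (c * of_real 0) / c)"
    proof (rule has_bochner_integral_FTC_Icc)
      fix t :: real
      show "((\<lambda>t. exp (c * of_real t) / c) has_vector_derivative exp (c * of_real t)) (at t within {0..1})"
        by (rule has_vector_derivative_real_field) (use c in \<open>auto intro!: derivative_eq_intros\<close>)
    qed (auto intro!: continuous_intros)
    moreover have "exp (c * of_real 1) = 1"
      using cis_eq[of 1, symmetric] by simp
    ultimately show ?thesis
      using False by (simp add: cis_eq)
  qed
  show ?thesis
  proof (rule has_bochner_integral_cong_AE[THEN iffD1, OF _ _ _ Icc])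
    show "AE t in lborel. indicator {0..1} t *\<^sub>R cis (2 * pi * real_of_int m * t)
        = indicator {0..<1} t *\<^sub>R cis (2 * pi * real_of_int m * t)"
      by (rule eventually_mono[OF AE_lborel_singleton[of 1]]) (auto split: split_indicator)
  qed (auto simp: cis_conv_exp)
qed

lemma integral_character: "(\<integral>\<xi>. character k \<xi> \<partial>torus) = of_bool (k = 0)"
proof -
  have "indicator cell \<xi> *\<^sub>R character k \<xi>
      = (\<Prod>i\<in>UNIV. indicator {0..<1} (\<xi> $ i) *\<^sub>R cis (2 * pi * real_of_int (k $ i) * \<xi> $ i))" for \<xi>
  proof (cases "\<xi> \<in> cell")
    case True
    then show ?thesis by (simp add: cell_def character_eq_prod)
  next
    case False
    then obtain i where "\<xi> $ i \<notin> {0..<1}" by (auto simp: cell_def)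
    then have "(\<Prod>i\<in>UNIV. indicator {0..<1} (\<xi> $ i) *\<^sub>R cis (2 * pi * real_of_int (k $ i) * \<xi> $ i)) = 0"
      by (intro prod_zero) (auto intro!: exI[of _ i])
    then show ?thesis using False by simp
  qed
  then have "(\<integral>\<xi>. character k \<xi> \<partial>torus) = (\<Prod>i\<in>UNIV. of_bool (k $ i = 0))"
    unfolding integral_torus
    by (simp only: lborel_integral_prod[OF has_bochner_integral_cis_unit_interval[THEN integrable.intros]]
        has_bochner_integral_cis_unit_interval[THEN has_bochner_integral_integral_eq])
  also have "\<dots> = of_bool (k = 0)"
    by (auto simp: vec_eq_iff prod_zero_iff)
  finally show ?thesis .
qed

lemma finite_measure_torus: "finite_measure (torus :: (real^'n) measure)"
proof
  have "emeasure torus (space torus :: (real^'n) set) = emeasure lborel (cell :: (real^'n) set)"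
    by (simp add: torus_eq emeasure_restrict_space)
  also have "\<dots> \<le> emeasure lborel (cbox (0 :: real^'n) 1)"
    by (rule emeasure_mono) (auto simp: cell_def mem_box_cart less_imp_le)
  also have "\<dots> < \<infinity>" by (rule emeasure_bounded_finite) simp
  finally show "emeasure torus (space torus :: (real^'n) set) \<noteq> \<infinity>" by simp
qed

lemma character_L2[simp]: "character k \<in> L2 torus"
proof -
  interpret finite_measure "torus :: (real^'n) measure" by (rule finite_measure_torus)
  show ?thesis by (simp add: L2_def)
qed

lemma L2_inner_characters: "L2_inner torus (character k) (character l) = of_bool (k = l)"
  unfolding L2_inner_def cnj_character character_mult by (simp add: integral_character)

definition trig_sum :: "(int^'n \<Rightarrow> complex) \<Rightarrow> (int^'n) set \<Rightarrow> real^'n \<Rightarrow> complex" where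
  "trig_sum c A \<xi> = (\<Sum>k\<in>A. c k * character k \<xi>)"

lemma trig_sum_L2[simp]: "trig_sum c A \<in> L2 torus"
  unfolding trig_sum_def by (intro L2_sum L2_cmult character_L2)

lemma trig_sum_measurable[measurable]: "trig_sum c A \<in> borel_measurable borel"
  unfolding trig_sum_def by measurable

lemma L2_inner_trig_sum_character:
  assumes "finite A"
  shows "L2_inner torus (character l) (trig_sum c A) = (if l \<in> A then cnj (c l) else 0)"
  unfolding trig_sum_def
  using assms by (subst L2_inner_sum_right) (auto simp: L2_inner_characters if_distrib of_bool_def cong: if_cong)

lemma L2_inner_commute: "L2_inner M f g = cnj (L2_inner M g f)"
  unfolding L2_inner_def Bochner_Integration.integral_cnj[symmetric] by (simp add: mult.commute)

lemma L2_norm_trig_sum: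
  assumes "finite A"
  shows "(L2_norm torus (trig_sum c A))\<^sup>2 = (\<Sum>k\<in>A. (cmod (c k))\<^sup>2)"
proof -
  have "complex_of_real ((L2_norm torus (trig_sum c A))\<^sup>2) = L2_inner torus (trig_sum c A) (trig_sum c A)"
    by (rule L2_norm_power2_inner) simp
  also have "\<dots> = (\<Sum>k\<in>A. cnj (c k) * L2_inner torus (trig_sum c A) (character k))"
    unfolding trig_sum_def by (rule L2_inner_sum_right) (auto simp flip: trig_sum_def)
  also have "\<dots> = (\<Sum>k\<in>A. cnj (c k) * c k)"
    using assms by (intro sum.cong) (auto simp: L2_inner_commute[of torus "trig_sum c A"] L2_inner_trig_sum_character)
  also have "\<dots> = complex_of_real (\<Sum>k\<in>A. (cmod (c k))\<^sup>2)"
    unfolding of_real_sum complex_norm_square by (simp add: mult.commute)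
  finally show ?thesis by (simp only: of_real_eq_iff)
qed

section \<open>Density of trigonometric polynomials\<close>

definition trig_polys :: "(real^'n \<Rightarrow> complex) set" where
  "trig_polys = {p. \<exists>A c. finite A \<and> p = trig_sum c A}"

lemma trig_polysI: "finite A \<Longrightarrow> trig_sum c A \<in> trig_polys"
  by (auto simp: trig_polys_def)

lemma trig_polys_character: "(\<lambda>\<xi>. c * character k \<xi>) \<in> trig_polys"
  using trig_polysI[of "{k}" "\<lambda>_. c"] by (simp add: trig_sum_def[abs_def])

lemma trig_polys_const: "(\<lambda>\<xi>. c) \<in> trig_polys"
  using trig_polys_character[of c 0] by simp

lemma trig_polys_add:
  assumes "p \<in> trig_polys" "q \<in> trig_polys"
  shows "(\<lambda>\<xi>. p \<xi> + q \<xi>) \<in> trig_polys"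
proof -
  obtain A c B d where A: "finite A" "p = trig_sum c A" and B: "finite B" "q = trig_sum d B"
    using assms by (auto simp: trig_polys_def)
  have "p \<xi> + q \<xi> = trig_sum (\<lambda>k. (if k \<in> A then c k else 0) + (if k \<in> B then d k else 0)) (A \<union> B) \<xi>" for \<xi>
  proof -
    have "p \<xi> = (\<Sum>k\<in>A \<union> B. (if k \<in> A then c k else 0) * character k \<xi>)"
      unfolding A(2) trig_sum_def using A(1) B(1) by (intro sum.mono_neutral_cong_left) auto
    moreover have "q \<xi> = (\<Sum>k\<in>A \<union> B. (if k \<in> B then d k else 0) * character k \<xi>)"
      unfolding B(2) trig_sum_def using A(1) B(1) by (intro sum.mono_neutral_cong_left) auto
    ultimately show ?thesis
      by (simp add: trig_sum_def distrib_right sum.distrib)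
  qed
  then show ?thesis
    using A B by (auto simp: trig_polys_def)
qed

lemma trig_polys_sum:
  "(\<And>i. i \<in> I \<Longrightarrow> p i \<in> trig_polys) \<Longrightarrow> (\<lambda>\<xi>. \<Sum>i\<in>I. p i \<xi>) \<in> trig_polys"
  by (induction I rule: infinite_finite_induct) (auto intro: trig_polys_add trig_polys_const)

lemma trig_polys_mult:
  assumes "p \<in> trig_polys" "q \<in> trig_polys"
  shows "(\<lambda>\<xi>. p \<xi> * q \<xi>) \<in> trig_polys"
proof -
  obtain A c B d where p: "p = trig_sum c A" and q: "q = trig_sum d B"
    using assms by (auto simp: trig_polys_def)
  have "p \<xi> * q \<xi> = (\<Sum>k\<in>A. \<Sum>l\<in>B. (c k * d l) * character (k + l) \<xi>)" for \<xi>
    unfolding p q trig_sum_def sum_product character_mult[symmetric]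
    by (intro sum.cong) (auto simp: mult_ac)
  then show ?thesis
    by (simp only:) (intro trig_polys_sum trig_polys_character)
qed

lemma trig_polys_cnj:
  assumes "p \<in> trig_polys"
  shows "(\<lambda>\<xi>. cnj (p \<xi>)) \<in> trig_polys"
proof -
  obtain A c where p: "p = trig_sum c A"
    using assms by (auto simp: trig_polys_def)
  have "cnj (p \<xi>) = (\<Sum>k\<in>A. cnj (c k) * character (- k) \<xi>)" for \<xi>
    unfolding p trig_sum_def by (simp add: cnj_character)
  then show ?thesis
    by (simp only:) (intro trig_polys_sum trig_polys_character)
qed

text \<open>The coordinates are wound around unit circles. Periodicity becomes automatic, and Stone-Weierstrass
  applies on a compact set whose real coordinate functions pull back to trigonometric polynomials.\<close>

definition torus_embedding :: "real^'n \<Rightarrow> complex^'n" where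
  "torus_embedding \<xi> = (\<chi> i. cis (2 * pi * \<xi> $ i))"

definition unit_torus :: "(complex^'n) set" where
  "unit_torus = {z. \<forall>i. cmod (z $ i) = 1}"

lemma torus_embedding_in[simp]: "torus_embedding \<xi> \<in> unit_torus"
  by (simp add: torus_embedding_def unit_torus_def)

lemma compact_unit_torus: "compact (unit_torus :: (complex^'n) set)"
proof -
  have "bounded (unit_torus :: (complex^'n) set)"
  proof (rule boundedI)
    fix z :: "complex^'n" assume "z \<in> unit_torus"
    then show "norm z \<le> real CARD('n)"
      unfolding norm_vec_def by (intro order_trans[OF L2_set_le_sum]) (auto simp: unit_torus_def)
  qed
  moreover have "closed (unit_torus :: (complex^'n) set)"
    unfolding unit_torus_def Collect_all_eq
    by (intro closed_INT ballI closed_Collect_eq continuous_intros)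
  ultimately show ?thesis
    by (simp add: compact_eq_bounded_closed)
qed

lemma continuous_torus_embedding: "continuous_on S torus_embedding"
  unfolding torus_embedding_def by (intro continuous_on_vec_lambda continuous_intros)

lemma torus_embedding_measurable[measurable]: "torus_embedding \<in> borel_measurable borel"
  by (rule borel_measurable_continuous_onI[OF continuous_torus_embedding])

lemma inj_on_torus_embedding: "inj_on torus_embedding cell"
proof (rule inj_onI)
  fix \<xi> \<eta> :: "real^'n" assume cell: "\<xi> \<in> cell" "\<eta> \<in> cell" and eq: "torus_embedding \<xi> = torus_embedding \<eta>"
  show "\<xi> = \<eta>"
  proof (subst vec_eq_iff, rule allI)
    fix i
    have "cis (2 * pi * \<xi> $ i) = cis (2 * pi * \<eta> $ i)"
      using eq by (simp add: torus_embedding_def vec_eq_iff)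
    then have "cos (2 * pi * \<xi> $ i) = cos (2 * pi * \<eta> $ i) \<and> sin (2 * pi * \<xi> $ i) = sin (2 * pi * \<eta> $ i)"
      by (simp add: complex_eq_iff)
    then obtain m :: int where "2 * pi * \<xi> $ i = 2 * pi * \<eta> $ i + 2 * pi * m"
      using sin_cos_eq_iff[of "2 * pi * \<xi> $ i" "2 * pi * \<eta> $ i"] by (auto elim: Ints_cases)
    then have "\<xi> $ i = \<eta> $ i + m"
      by (simp flip: distrib_left)
    moreover have "0 \<le> \<xi> $ i" "\<xi> $ i < 1" "0 \<le> \<eta> $ i" "\<eta> $ i < 1"
      using cell by (auto simp: cell_def)
    ultimately have "m = 0" by linarith
    then show "\<xi> $ i = \<eta> $ i" using \<open>\<xi> $ i = \<eta> $ i + m\<close> by simp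
  qed
qed

lemma torus_embedding_eq_character: "torus_embedding \<xi> $ i = character (axis i 1) \<xi>"
proof -
  have "vec_of_int (axis i 1) = axis i 1"
    by (simp add: vec_eq_iff axis_def)
  then show ?thesis
    by (simp add: torus_embedding_def character_def inner_axis)
qed

text \<open>Stone-Weierstrass for the algebra of those functions on the unit torus whose pullback is a
  trigonometric polynomial; the real and imaginary parts of the coordinates separate points.\<close>

lemma trig_polys_dense:
  fixes G :: "complex^'n \<Rightarrow> real"
  assumes G: "continuous_on unit_torus G" and "\<epsilon> > 0"
  shows "\<exists>q\<in>trig_polys. \<forall>\<xi>. q \<xi> \<in> \<real> \<and> cmod (of_real (G (torus_embedding \<xi>)) - q \<xi>) < \<epsilon>"
proof -
  define P where "P = (\<lambda>f :: complex^'n \<Rightarrow> real. continuous_on unit_torus f \<and>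
      (\<lambda>\<xi>. of_real (f (torus_embedding \<xi>))) \<in> trig_polys)"
  have coord: "(\<lambda>\<xi>. torus_embedding \<xi> $ i) \<in> trig_polys" for i :: 'n
    using trig_polys_character[of 1 "axis i 1"] by (simp add: torus_embedding_eq_character)
  have coord': "(\<lambda>\<xi>. cnj (torus_embedding \<xi> $ i)) \<in> trig_polys" for i :: 'n
    using coord by (rule trig_polys_cnj)
  have Re: "P (\<lambda>z. Re (z $ i))" for i
  proof -
    have "(\<lambda>\<xi>. (1/2) * (torus_embedding \<xi> $ i + cnj (torus_embedding \<xi> $ i))) \<in> trig_polys"
      by (intro trig_polys_mult trig_polys_const trig_polys_add coord coord')
    then show ?thesis
      unfolding P_def by (auto intro!: continuous_intros simp: complex_add_cnj)
  qed
  have Im: "P (\<lambda>z. Im (z $ i))" for i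
  proof -
    have "(\<lambda>\<xi>. (-\<i>/2) * (torus_embedding \<xi> $ i + (-1) * cnj (torus_embedding \<xi> $ i))) \<in> trig_polys"
      by (intro trig_polys_mult trig_polys_const trig_polys_add coord coord')
    also have "(\<lambda>\<xi>. (-\<i>/2) * (torus_embedding \<xi> $ i + (-1) * cnj (torus_embedding \<xi> $ i)))
        = (\<lambda>\<xi>. of_real (Im (torus_embedding \<xi> $ i)))"
      by (auto simp: fun_eq_iff complex_eq_iff)
    finally show ?thesis
      unfolding P_def by (auto intro!: continuous_intros)
  qed
  have "\<exists>g. P g \<and> (\<forall>z\<in>unit_torus. \<bar>G z - g z\<bar> < \<epsilon>)"
  proof (rule Stone_Weierstrass_HOL)
    show "compact (unit_torus :: (complex^'n) set)" by (rule compact_unit_torus)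
    show "P (\<lambda>z. c)" for c unfolding P_def using trig_polys_const by auto
    show "continuous_on unit_torus f" if "P f" for f using that by (simp add: P_def)
    show "P (\<lambda>z. f z + g z)" if "P f \<and> P g" for f g
      using that unfolding P_def by (auto intro!: continuous_intros trig_polys_add)
    show "P (\<lambda>z. f z * g z)" if "P f \<and> P g" for f g
      using that unfolding P_def by (auto intro!: continuous_intros trig_polys_mult)
    show "\<exists>f. P f \<and> f z \<noteq> f z'" if neq: "z \<in> unit_torus \<and> z' \<in> unit_torus \<and> z \<noteq> z'" for z z'
    proof -
      obtain i where "z $ i \<noteq> z' $ i" using neq by (metis vec_eq_iff)
      then have "Re (z $ i) \<noteq> Re (z' $ i) \<or> Im (z $ i) \<noteq> Im (z' $ i)"
        by (simp add: complex_eq_iff)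
      then show ?thesis using Re[of i] Im[of i] by blast
    qed
  qed (use assms in auto)
  then obtain g where "P g" and g: "\<forall>z\<in>unit_torus. \<bar>G z - g z\<bar> < \<epsilon>" by blast
  moreover have "cmod (of_real (G (torus_embedding \<xi>)) - of_real (g (torus_embedding \<xi>))) < \<epsilon>" for \<xi>
    using g[rule_format, OF torus_embedding_in[of \<xi>]] by (simp flip: of_real_diff)
  ultimately show ?thesis
    unfolding P_def by (intro bexI[of _ "\<lambda>\<xi>. of_real (g (torus_embedding \<xi>))"]) auto
qed

section \<open>Comparison of densities on the torus\<close>

text \<open>The square root of \<open>G\<close> is approximated uniformly by a real trigonometric polynomial \<open>q\<close>, so that
  \<open>G\<close> is close to \<open>q\<^sup>2\<close>, to which the hypothesis applies.\<close>

lemma continuous_integrals_le_if_trig_poly_integrals_le: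
  fixes u v :: "real^'n \<Rightarrow> ennreal"
  assumes [measurable]: "u \<in> borel_measurable torus" "v \<in> borel_measurable torus"
    and fin: "(\<integral>\<^sup>+\<xi>. u \<xi> \<partial>torus) < \<infinity>" "(\<integral>\<^sup>+\<xi>. v \<xi> \<partial>torus) < \<infinity>"
    and cmp: "\<And>p. p \<in> trig_polys \<Longrightarrow> (\<integral>\<^sup>+\<xi>. ennreal ((cmod (p \<xi>))\<^sup>2) * u \<xi> \<partial>torus)
      \<le> (\<integral>\<^sup>+\<xi>. ennreal ((cmod (p \<xi>))\<^sup>2) * v \<xi> \<partial>torus)"
    and G: "continuous_on UNIV (G :: complex^'n \<Rightarrow> real)" "\<And>z. 0 \<le> G z" "\<And>z. G z \<le> 1"
  shows "(\<integral>\<^sup>+\<xi>. ennreal (G (torus_embedding \<xi>)) * u \<xi> \<partial>torus)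
    \<le> (\<integral>\<^sup>+\<xi>. ennreal (G (torus_embedding \<xi>)) * v \<xi> \<partial>torus)"
proof (rule ennreal_le_epsilon)
  have Gm[measurable]: "G \<in> borel_measurable borel"
    by (rule borel_measurable_continuous_onI[OF G(1)])
  obtain U where U: "(\<integral>\<^sup>+\<xi>. u \<xi> \<partial>torus) = ennreal U" "U \<ge> 0"
    using fin(1) by (cases "\<integral>\<^sup>+\<xi>. u \<xi> \<partial>torus") auto
  obtain V where V: "(\<integral>\<^sup>+\<xi>. v \<xi> \<partial>torus) = ennreal V" "V \<ge> 0"
    using fin(2) by (cases "\<integral>\<^sup>+\<xi>. v \<xi> \<partial>torus") auto
  fix e :: real assume "e > 0"
  \<comment> \<open>If \<open>s\<close> and \<open>q\<close> differ by at most \<open>\<delta> \<le> 1\<close> and \<open>0 \<le> s \<le> 1\<close>, their squares differ by at most \<open>3 * \<delta>\<close>.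
    This error is integrated against both densities.\<close>
  define \<delta> where "\<delta> = min 1 (e / (3 * (U + V + 1)))"
  have \<delta>: "0 < \<delta>" "\<delta> \<le> 1" "3 * \<delta> * (U + V) \<le> e"
  proof -
    show "0 < \<delta>" "\<delta> \<le> 1" using \<open>e > 0\<close> U V by (auto simp: \<delta>_def)
    have "3 * \<delta> * (U + V) \<le> 3 * (e / (3 * (U + V + 1))) * (U + V + 1)"
      using U V \<open>e > 0\<close> by (intro mult_mono) (auto simp: \<delta>_def)
    also have "\<dots> = e" using U V by (simp add: field_simps)
    finally show "3 * \<delta> * (U + V) \<le> e" .
  qed
  have "continuous_on unit_torus (\<lambda>z. sqrt (G z))"
    by (intro continuous_intros continuous_on_subset[OF G(1)]) auto
  from trig_polys_dense[OF this \<delta>(1)] obtain q where q: "q \<in> trig_polys"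
      and real: "\<And>\<xi>. q \<xi> \<in> \<real>"
      and close: "\<And>\<xi>. cmod (of_real (sqrt (G (torus_embedding \<xi>))) - q \<xi>) < \<delta>"
    by auto
  have sq: "\<bar>G (torus_embedding \<xi>) - (cmod (q \<xi>))\<^sup>2\<bar> \<le> 3 * \<delta>" for \<xi>
  proof -
    define s where "s = sqrt (G (torus_embedding \<xi>))"
    obtain r where r: "q \<xi> = of_real r" using real[of \<xi>] by (auto elim: Reals_cases)
    have s: "0 \<le> s" "s \<le> 1" "s\<^sup>2 = G (torus_embedding \<xi>)" using G by (auto simp: s_def)
    have sr: "\<bar>s - r\<bar> < \<delta>" using close[of \<xi>] by (simp add: r s_def flip: of_real_diff)
    then have "\<bar>s + r\<bar> \<le> 3" using s \<delta>(2) by linarith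
    then have "\<bar>s - r\<bar> * \<bar>s + r\<bar> \<le> \<delta> * 3"
      using sr by (intro mult_mono) auto
    moreover have "G (torus_embedding \<xi>) - (cmod (q \<xi>))\<^sup>2 = (s - r) * (s + r)"
      using s(3) by (simp add: r power2_eq_square algebra_simps)
    ultimately show ?thesis by (simp add: abs_mult mult.commute)
  qed
  have qm[measurable]: "q \<in> borel_measurable borel"
    using q by (auto simp: trig_polys_def)
  have "(\<integral>\<^sup>+\<xi>. ennreal (G (torus_embedding \<xi>)) * u \<xi> \<partial>torus)
      \<le> (\<integral>\<^sup>+\<xi>. ennreal ((cmod (q \<xi>))\<^sup>2) * u \<xi> + ennreal (3 * \<delta>) * u \<xi> \<partial>torus)"
    unfolding distrib_right[symmetric]
    by (intro nn_integral_mono mult_right_mono)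
       (use sq \<delta>(1) in \<open>auto simp: abs_le_iff algebra_simps simp flip: ennreal_plus intro!: ennreal_leI\<close>)
  also have "\<dots> = (\<integral>\<^sup>+\<xi>. ennreal ((cmod (q \<xi>))\<^sup>2) * u \<xi> \<partial>torus) + ennreal (3 * \<delta>) * U"
    by (simp add: nn_integral_add nn_integral_cmult U)
  also have "\<dots> \<le> (\<integral>\<^sup>+\<xi>. ennreal ((cmod (q \<xi>))\<^sup>2) * v \<xi> \<partial>torus) + ennreal (3 * \<delta>) * U"
    by (intro add_right_mono cmp q)
  also have "(\<integral>\<^sup>+\<xi>. ennreal ((cmod (q \<xi>))\<^sup>2) * v \<xi> \<partial>torus)
      \<le> (\<integral>\<^sup>+\<xi>. ennreal (G (torus_embedding \<xi>)) * v \<xi> + ennreal (3 * \<delta>) * v \<xi> \<partial>torus)"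
    unfolding distrib_right[symmetric]
    by (intro nn_integral_mono mult_right_mono)
       (use sq \<delta>(1) G in \<open>auto simp: abs_le_iff algebra_simps simp flip: ennreal_plus intro!: ennreal_leI\<close>)
  also have "\<dots> = (\<integral>\<^sup>+\<xi>. ennreal (G (torus_embedding \<xi>)) * v \<xi> \<partial>torus) + ennreal (3 * \<delta>) * V"
    by (simp add: nn_integral_add nn_integral_cmult V)
  also have "(\<integral>\<^sup>+\<xi>. ennreal (G (torus_embedding \<xi>)) * v \<xi> \<partial>torus) + ennreal (3 * \<delta>) * V + ennreal (3 * \<delta>) * U
      = (\<integral>\<^sup>+\<xi>. ennreal (G (torus_embedding \<xi>)) * v \<xi> \<partial>torus) + ennreal (3 * \<delta> * (U + V))"
    using U V \<delta> by (simp add: add.assoc ennreal_mult[symmetric] distrib_left add.commute flip: ennreal_plus)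
  also have "\<dots> \<le> (\<integral>\<^sup>+\<xi>. ennreal (G (torus_embedding \<xi>)) * v \<xi> \<partial>torus) + ennreal e"
    using \<delta>(3) by (intro add_left_mono ennreal_leI)
  finally show "(\<integral>\<^sup>+\<xi>. ennreal (G (torus_embedding \<xi>)) * u \<xi> \<partial>torus)
      \<le> (\<integral>\<^sup>+\<xi>. ennreal (G (torus_embedding \<xi>)) * v \<xi> \<partial>torus) + ennreal e"
    by (simp add: add_right_mono)
qed

text \<open>The indicator of \<open>K\<close> is a decreasing limit of continuous cut-off functions. They are built on the
  unit torus from the distance to the image of \<open>K\<close>; as the embedding is injective on the cell,
  their limit vanishes on the rest of the cell.\<close>

lemma compact_masses_le_if_trig_poly_integrals_le:
  fixes u v :: "real^'n \<Rightarrow> ennreal"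
  assumes [measurable]: "u \<in> borel_measurable torus" "v \<in> borel_measurable torus"
    and fin: "(\<integral>\<^sup>+\<xi>. u \<xi> \<partial>torus) < \<infinity>" "(\<integral>\<^sup>+\<xi>. v \<xi> \<partial>torus) < \<infinity>"
    and cmp: "\<And>p. p \<in> trig_polys \<Longrightarrow> (\<integral>\<^sup>+\<xi>. ennreal ((cmod (p \<xi>))\<^sup>2) * u \<xi> \<partial>torus)
      \<le> (\<integral>\<^sup>+\<xi>. ennreal ((cmod (p \<xi>))\<^sup>2) * v \<xi> \<partial>torus)"
    and K: "compact K" "K \<subseteq> cell" "K \<noteq> {}"
  shows "(\<integral>\<^sup>+\<xi>. indicator K \<xi> * u \<xi> \<partial>torus) \<le> (\<integral>\<^sup>+\<xi>. indicator K \<xi> * v \<xi> \<partial>torus)"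
proof -
  define C where "C = torus_embedding ` K"
  have C: "closed C" "C \<noteq> {}"
    using K by (auto simp: C_def intro!: compact_imp_closed compact_continuous_image continuous_torus_embedding)
  define G where "G = (\<lambda>j::nat. \<lambda>z. max 0 (1 - real j * infdist z C))"
  have G_props: "continuous_on UNIV (G j)" "0 \<le> G j z" "G j z \<le> 1" for j z
    unfolding G_def by (auto intro!: continuous_intros simp: infdist_nonneg)
  have Gm[measurable]: "G j \<in> borel_measurable borel" for j
    by (rule borel_measurable_continuous_onI[OF G_props(1)])
  have G_dec: "G (Suc j) z \<le> G j z" for j z
    unfolding G_def by (intro max.mono diff_left_mono mult_right_mono) (auto simp: infdist_nonneg)
  have G_K: "G j (torus_embedding \<xi>) = 1" if "\<xi> \<in> K" for j \<xi>
    using that C by (auto simp: G_def C_def)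
  have G_lim: "(INF j. ennreal (G j (torus_embedding \<xi>)) * v \<xi>) = indicator K \<xi> * v \<xi>" if "\<xi> \<in> cell" for \<xi>
  proof (cases "\<xi> \<in> K")
    case False
    then have "torus_embedding \<xi> \<notin> C"
      using inj_onD[OF inj_on_torus_embedding _ that] K by (auto simp: C_def)
    then have "infdist (torus_embedding \<xi>) C > 0"
      using in_closed_iff_infdist_zero[OF C] infdist_nonneg[of "torus_embedding \<xi>" C] by (metis less_le)
    then obtain j :: nat where "1 < real j * infdist (torus_embedding \<xi>) C"
      using reals_Archimedean3 by blast
    then have "G j (torus_embedding \<xi>) = 0" by (simp add: G_def)
    then have "(INF j. ennreal (G j (torus_embedding \<xi>)) * v \<xi>) \<le> 0"
      by (intro INF_lower2[of j]) auto
    then show ?thesis using False by simp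
  qed (simp add: G_K)
  have "(\<integral>\<^sup>+\<xi>. indicator K \<xi> * u \<xi> \<partial>torus) \<le> (INF j. \<integral>\<^sup>+\<xi>. ennreal (G j (torus_embedding \<xi>)) * v \<xi> \<partial>torus)"
  proof (rule INF_greatest)
    fix j
    have "(\<integral>\<^sup>+\<xi>. indicator K \<xi> * u \<xi> \<partial>torus) \<le> (\<integral>\<^sup>+\<xi>. ennreal (G j (torus_embedding \<xi>)) * u \<xi> \<partial>torus)"
      by (intro nn_integral_mono mult_right_mono) (auto simp: G_K split: split_indicator)
    also have "\<dots> \<le> (\<integral>\<^sup>+\<xi>. ennreal (G j (torus_embedding \<xi>)) * v \<xi> \<partial>torus)"
      by (rule continuous_integrals_le_if_trig_poly_integrals_le) (use fin cmp G_props in auto)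
    finally show "(\<integral>\<^sup>+\<xi>. indicator K \<xi> * u \<xi> \<partial>torus) \<le> (\<integral>\<^sup>+\<xi>. ennreal (G j (torus_embedding \<xi>)) * v \<xi> \<partial>torus)" .
  qed
  also have "\<dots> = (\<integral>\<^sup>+\<xi>. (INF j. ennreal (G j (torus_embedding \<xi>)) * v \<xi>) \<partial>torus)"
  proof (rule nn_integral_monotone_convergence_INF_decseq[symmetric])
    show "decseq (\<lambda>j \<xi>. ennreal (G j (torus_embedding \<xi>)) * v \<xi>)"
      by (intro decseq_SucI le_funI mult_right_mono ennreal_leI G_dec) auto
    show "(\<integral>\<^sup>+\<xi>. ennreal (G 0 (torus_embedding \<xi>)) * v \<xi> \<partial>torus) < \<infinity>"
      using fin(2) by (simp add: G_def)
  qed measurable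
  also have "\<dots> = (\<integral>\<^sup>+\<xi>. indicator K \<xi> * v \<xi> \<partial>torus)"
    by (intro nn_integral_cong) (simp add: G_lim)
  finally show ?thesis .
qed

text \<open>The comparison passes to compact sets and by inner regularity to the Borel set where \<open>v < u\<close>, which
  must therefore be null. The lemma is used twice: for the
  completeness of the characters, and to bound the weight by a synthesis bound.\<close>

lemma AE_le_if_trig_poly_integrals_le:
  fixes u v :: "real^'n \<Rightarrow> ennreal"
  assumes um[measurable]: "u \<in> borel_measurable torus" and vm[measurable]: "v \<in> borel_measurable torus"
    and fin: "(\<integral>\<^sup>+\<xi>. u \<xi> \<partial>torus) < \<infinity>" "(\<integral>\<^sup>+\<xi>. v \<xi> \<partial>torus) < \<infinity>"
    and cmp: "\<And>p. p \<in> trig_polys \<Longrightarrow> (\<integral>\<^sup>+\<xi>. ennreal ((cmod (p \<xi>))\<^sup>2) * u \<xi> \<partial>torus)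
      \<le> (\<integral>\<^sup>+\<xi>. ennreal ((cmod (p \<xi>))\<^sup>2) * v \<xi> \<partial>torus)"
  shows "AE \<xi> in torus. u \<xi> \<le> v \<xi>"
proof -
  define u' where "u' = (\<lambda>\<xi>. u \<xi> * indicator cell \<xi>)"
  have [measurable]: "u' \<in> borel_measurable borel"
    using um unfolding u'_def torus_eq by (subst (asm) borel_measurable_restrict_space_iff_ennreal) auto
  define B where "B = {\<xi> \<in> space torus. v \<xi> < u \<xi>}"
  have Bt[measurable]: "B \<in> sets torus" unfolding B_def by measurable
  then have B: "B \<in> sets borel" "B \<subseteq> cell"
    unfolding torus_eq by (auto simp: sets_restrict_space_iff B_def)
  define \<mu> where "\<mu> = density lborel u'"
  have \<mu>: "emeasure \<mu> A = (\<integral>\<^sup>+\<xi>. indicator A \<xi> * u \<xi> \<partial>torus)" if "A \<in> sets borel" for A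
    unfolding \<mu>_def nn_integral_torus using that
    by (subst emeasure_density, simp, simp, simp) (simp add: u'_def mult_ac)
  have "emeasure \<mu> (space \<mu>) \<noteq> \<infinity>"
    using fin(1) \<mu>[of UNIV] by (simp add: \<mu>_def)
  then have "emeasure \<mu> B = (SUP K\<in>{K. K \<subseteq> B \<and> compact K}. emeasure \<mu> K)"
    by (intro inner_regular B) (auto simp: \<mu>_def)
  also have "\<dots> \<le> (\<integral>\<^sup>+\<xi>. indicator B \<xi> * v \<xi> \<partial>torus)"
  proof (rule SUP_least)
    fix K assume "K \<in> {K. K \<subseteq> B \<and> compact K}"
    then have K: "K \<subseteq> B" "compact K" by auto
    show "emeasure \<mu> K \<le> (\<integral>\<^sup>+\<xi>. indicator B \<xi> * v \<xi> \<partial>torus)"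
    proof (cases "K = {}")
      case False
      have "emeasure \<mu> K = (\<integral>\<^sup>+\<xi>. indicator K \<xi> * u \<xi> \<partial>torus)"
        by (intro \<mu> borel_compact K)
      also have "\<dots> \<le> (\<integral>\<^sup>+\<xi>. indicator K \<xi> * v \<xi> \<partial>torus)"
        by (rule compact_masses_le_if_trig_poly_integrals_le) (use fin cmp K B False in auto)
      also have "\<dots> \<le> (\<integral>\<^sup>+\<xi>. indicator B \<xi> * v \<xi> \<partial>torus)"
        using K by (intro nn_integral_mono mult_right_mono) (auto split: split_indicator)
      finally show ?thesis .
    qed simp
  qed
  finally have le: "(\<integral>\<^sup>+\<xi>. indicator B \<xi> * u \<xi> \<partial>torus) \<le> (\<integral>\<^sup>+\<xi>. indicator B \<xi> * v \<xi> \<partial>torus)"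
    by (simp add: \<mu> B)
  have finB: "(\<integral>\<^sup>+\<xi>. indicator B \<xi> * v \<xi> \<partial>torus) \<noteq> \<infinity>"
  proof -
    have "(\<integral>\<^sup>+\<xi>. indicator B \<xi> * v \<xi> \<partial>torus) \<le> (\<integral>\<^sup>+\<xi>. v \<xi> \<partial>torus)"
      by (intro nn_integral_mono) (auto split: split_indicator)
    then show ?thesis using fin(2) by (auto simp: top_unique)
  qed
  have "(\<integral>\<^sup>+\<xi>. indicator B \<xi> * u \<xi> - indicator B \<xi> * v \<xi> \<partial>torus)
      = (\<integral>\<^sup>+\<xi>. indicator B \<xi> * u \<xi> \<partial>torus) - (\<integral>\<^sup>+\<xi>. indicator B \<xi> * v \<xi> \<partial>torus)"
    by (rule nn_integral_diff) (use finB in \<open>auto simp: B_def split: split_indicator intro!: AE_I2\<close>)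
  also have "\<dots> = 0"
    using le finB by (subst diff_eq_0_iff_ennreal) (auto simp: less_top intro: order.strict_trans1)
  finally have "AE \<xi> in torus. indicator B \<xi> * u \<xi> - indicator B \<xi> * v \<xi> = 0"
    by (subst (asm) nn_integral_0_iff_AE) auto
  then show ?thesis
  proof (rule AE_mp, intro AE_I2 impI)
    fix \<xi> assume "\<xi> \<in> space torus" "indicator B \<xi> * u \<xi> - indicator B \<xi> * v \<xi> = 0"
    then show "u \<xi> \<le> v \<xi>"
      by (cases "\<xi> \<in> B") (auto simp: B_def diff_eq_0_iff_ennreal not_less top_unique)
  qed
qed

section \<open>Parseval's identity on the torus\<close>

lemma integrable_mult_trig_poly:
  fixes h :: "real^'n \<Rightarrow> complex"
  assumes h: "integrable torus h" and p: "p \<in> trig_polys"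
  shows "integrable torus (\<lambda>\<xi>. h \<xi> * p \<xi>)"
proof -
  obtain A c where p: "p = trig_sum c A" using p by (auto simp: trig_polys_def)
  have [measurable]: "h \<in> borel_measurable torus" using h by auto
  have "integrable torus (\<lambda>\<xi>. h \<xi> * character k \<xi>)" for k
    by (rule Bochner_Integration.integrable_bound[OF h]) (auto simp: norm_mult)
  then have "integrable torus (\<lambda>\<xi>. \<Sum>k\<in>A. c k * (h \<xi> * character k \<xi>))"
    by (intro Bochner_Integration.integrable_sum integrable_mult_right)
  then show ?thesis
    by (simp add: p trig_sum_def sum_distrib_left mult_ac)
qed

lemma integral_mult_trig_poly_eq_0:
  fixes h :: "real^'n \<Rightarrow> complex"
  assumes h: "integrable torus h" and orth: "\<And>k. (\<integral>\<xi>. h \<xi> * character k \<xi> \<partial>torus) = 0"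
    and p: "p \<in> trig_polys"
  shows "(\<integral>\<xi>. h \<xi> * p \<xi> \<partial>torus) = 0"
proof -
  obtain A c where p: "p = trig_sum c A" using p by (auto simp: trig_polys_def)
  have "integrable torus (\<lambda>\<xi>. h \<xi> * character k \<xi>)" for k
    using integrable_mult_trig_poly[OF h trig_polys_character[of 1 k]] by simp
  then have "(\<integral>\<xi>. (\<Sum>k\<in>A. c k * (h \<xi> * character k \<xi>)) \<partial>torus) = 0"
    by (simp add: Bochner_Integration.integral_sum integrable_mult_right orth)
  then show ?thesis
    by (simp add: p trig_sum_def sum_distrib_left mult_ac)
qed

text \<open>Orthogonality says that the positive and the negative part of \<open>u\<close> have the same integral against
  each squared trigonometric polynomial, so the comparison of densities identifies them.\<close>

lemma AE_zero_if_real_orthogonal: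
  fixes u :: "real^'n \<Rightarrow> real"
  assumes u: "integrable torus u"
    and orth: "\<And>k. (\<integral>\<xi>. of_real (u \<xi>) * character k \<xi> \<partial>torus) = 0"
  shows "AE \<xi> in torus. u \<xi> = 0"
proof -
  have [measurable]: "u \<in> borel_measurable torus" using u by auto
  have fin: "(\<integral>\<^sup>+\<xi>. ennreal (u \<xi>) \<partial>torus) < \<infinity>" "(\<integral>\<^sup>+\<xi>. ennreal (- u \<xi>) \<partial>torus) < \<infinity>"
    using real_integrable_def[of torus u] u by (auto simp: less_top)
  have eq: "(\<integral>\<^sup>+\<xi>. ennreal ((cmod (p \<xi>))\<^sup>2) * ennreal (u \<xi>) \<partial>torus)
      = (\<integral>\<^sup>+\<xi>. ennreal ((cmod (p \<xi>))\<^sup>2) * ennreal (- u \<xi>) \<partial>torus)" if p: "p \<in> trig_polys" for p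
  proof -
    have q: "(\<lambda>\<xi>. p \<xi> * cnj (p \<xi>)) \<in> trig_polys"
      by (intro trig_polys_mult trig_polys_cnj p)
    have eqc: "of_real (u \<xi>) * (p \<xi> * cnj (p \<xi>)) = complex_of_real ((cmod (p \<xi>))\<^sup>2 * u \<xi>)" for \<xi>
      unfolding of_real_mult complex_norm_square by (rule mult.commute)
    have ui: "integrable torus (\<lambda>\<xi>. complex_of_real (u \<xi>))"
      using u by simp
    have i: "integrable torus (\<lambda>\<xi>. (cmod (p \<xi>))\<^sup>2 * u \<xi>)"
      using integrable_mult_trig_poly[OF ui q] unfolding eqc by (simp only: complex_of_real_integrable_eq)
    have "complex_of_real (\<integral>\<xi>. (cmod (p \<xi>))\<^sup>2 * u \<xi> \<partial>torus) = 0"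
      using integral_mult_trig_poly_eq_0[OF ui orth q] unfolding eqc by (simp only: integral_complex_of_real)
    then have "(\<integral>\<xi>. (cmod (p \<xi>))\<^sup>2 * u \<xi> \<partial>torus) = 0" by simp
    then have "enn2real (\<integral>\<^sup>+\<xi>. ennreal ((cmod (p \<xi>))\<^sup>2 * u \<xi>) \<partial>torus)
        = enn2real (\<integral>\<^sup>+\<xi>. ennreal (- ((cmod (p \<xi>))\<^sup>2 * u \<xi>)) \<partial>torus)"
      unfolding real_lebesgue_integral_def[OF i] by simp
    moreover have "(\<integral>\<^sup>+\<xi>. ennreal ((cmod (p \<xi>))\<^sup>2 * u \<xi>) \<partial>torus) < top"
        "(\<integral>\<^sup>+\<xi>. ennreal (- ((cmod (p \<xi>))\<^sup>2 * u \<xi>)) \<partial>torus) < top"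
      using i unfolding real_integrable_def by (auto simp: less_top)
    ultimately have "(\<integral>\<^sup>+\<xi>. ennreal ((cmod (p \<xi>))\<^sup>2 * u \<xi>) \<partial>torus)
        = (\<integral>\<^sup>+\<xi>. ennreal (- ((cmod (p \<xi>))\<^sup>2 * u \<xi>)) \<partial>torus)"
      using ennreal_enn2real by metis
    then show ?thesis
      by (simp only: mult_minus_right[symmetric] ennreal_mult'[OF zero_le_power2])
  qed
  have "AE \<xi> in torus. ennreal (u \<xi>) \<le> ennreal (- u \<xi>)"
    by (rule AE_le_if_trig_poly_integrals_le) (use fin eq in auto)
  moreover have "AE \<xi> in torus. ennreal (- u \<xi>) \<le> ennreal (u \<xi>)"
    by (rule AE_le_if_trig_poly_integrals_le) (use fin eq in auto)
  ultimately show ?thesis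
  proof eventually_elim
    case (elim \<xi>)
    then show ?case
      by (cases "0 \<le> u \<xi>") (auto simp: ennreal_neg ennreal_le_iff2)
  qed
qed

lemma L2_torus_integrable:
  "h \<in> L2 torus \<Longrightarrow> integrable torus h"
  using L2_mult_integrable[of h torus "character 0"] by simp

text \<open>As the characters are closed under conjugation, the conjugate of \<open>h\<close> is orthogonal to them as well,
  and the real and the imaginary part of \<open>h\<close> can be treated separately.\<close>

lemma AE_zero_if_orthogonal_to_characters:
  fixes h :: "real^'n \<Rightarrow> complex"
  assumes h: "h \<in> L2 torus" and orth: "\<And>k. L2_inner torus h (character k) = 0"
  shows "AE \<xi> in torus. h \<xi> = 0"
proof -
  have hi: "integrable torus h" by (rule L2_torus_integrable[OF h])
  have 1: "(\<integral>\<xi>. h \<xi> * character k \<xi> \<partial>torus) = 0" for k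
    using orth[of "- k"] by (simp add: L2_inner_def cnj_character)
  have 2: "(\<integral>\<xi>. cnj (h \<xi>) * character k \<xi> \<partial>torus) = 0" for k
  proof -
    have "(\<integral>\<xi>. cnj (h \<xi>) * character k \<xi> \<partial>torus) = (\<integral>\<xi>. cnj (h \<xi> * character (- k) \<xi>) \<partial>torus)"
      by (simp add: cnj_character)
    also have "\<dots> = 0"
      unfolding Bochner_Integration.integral_cnj by (simp add: 1)
    finally show ?thesis .
  qed
  have i: "integrable torus (\<lambda>\<xi>. h \<xi> * character k \<xi>)" "integrable torus (\<lambda>\<xi>. cnj (h \<xi>) * character k \<xi>)" for k
    using integrable_mult_trig_poly[OF hi trig_polys_character[of 1 k]]
      integrable_mult_trig_poly[OF _ trig_polys_character[of 1 k], of "\<lambda>\<xi>. cnj (h \<xi>)"] hi by auto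
  have "AE \<xi> in torus. Re (h \<xi>) = 0"
  proof (rule AE_zero_if_real_orthogonal)
    fix k
    have eq: "complex_of_real (Re (h \<xi>)) * character k \<xi>
        = (1/2) * (h \<xi> * character k \<xi> + cnj (h \<xi>) * character k \<xi>)" for \<xi>
      by (simp add: complex_add_cnj flip: distrib_right)
    then show "(\<integral>\<xi>. of_real (Re (h \<xi>)) * character k \<xi> \<partial>torus) = 0"
      unfolding eq using i by (simp add: 1 2)
  qed (use hi in simp)
  moreover have "AE \<xi> in torus. Im (h \<xi>) = 0"
  proof (rule AE_zero_if_real_orthogonal)
    fix k
    have eq: "complex_of_real (Im (h \<xi>)) * character k \<xi>
        = (-\<i>/2) * (h \<xi> * character k \<xi> - cnj (h \<xi>) * character k \<xi>)" for \<xi>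
      unfolding left_diff_distrib[symmetric] complex_diff_cnj by (simp add: complex_eq_iff)
    then show "(\<integral>\<xi>. of_real (Im (h \<xi>)) * character k \<xi> \<partial>torus) = 0"
      unfolding eq using i by (simp add: 1 2)
  qed (use hi in simp)
  ultimately show ?thesis
    by eventually_elim (simp add: complex_eq_iff)
qed

lemma synthesis_bound_characters: "synthesis_bound torus character 1"
  unfolding synthesis_bound_def
  by (simp add: L2_norm_trig_sum[unfolded trig_sum_def[abs_def]])

lemma L2_inner_converges:
  assumes conv: "L2_converges M u g" and f: "f \<in> L2 M"
  shows "(\<lambda>N. L2_inner M (u N) f) \<longlonglongrightarrow> L2_inner M g f"
proof (rule LIM_zero_cancel, rule Lim_null_comparison)
  have u: "\<And>N. u N \<in> L2 M" and g: "g \<in> L2 M"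
    and lim: "(\<lambda>N. L2_norm M (\<lambda>x. u N x - g x)) \<longlonglongrightarrow> 0"
    using conv by (auto simp: L2_converges_def)
  have diff: "L2_inner M (u N) f - L2_inner M g f = L2_inner M (\<lambda>x. u N x - g x) f" for N
    unfolding L2_inner_def left_diff_distrib
    by (rule Bochner_Integration.integral_diff[symmetric]) (intro L2_mult_integrable u g f)+
  show "\<forall>\<^sub>F N in sequentially. norm (L2_inner M (u N) f - L2_inner M g f)
      \<le> L2_norm M (\<lambda>x. u N x - g x) * L2_norm M f"
    unfolding diff by (intro always_eventually allI L2_inner_le L2_diff u g f)
  show "(\<lambda>N. L2_norm M (\<lambda>x. u N x - g x) * L2_norm M f) \<longlonglongrightarrow> 0"
    using tendsto_mult_left_zero[OF lim] .
qed

text \<open>The Fourier series of \<open>h\<close> converges to some \<open>g\<close> with the same coefficients; by completeness of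
  the characters \<open>g\<close> is \<open>h\<close>, and the norms of the partial sums converge to that of \<open>h\<close>.\<close>

theorem parseval_torus:
  fixes h :: "real^'n \<Rightarrow> complex"
  assumes h: "h \<in> L2 torus"
  shows "(\<integral>\<^sup>+k. ennreal ((cmod (L2_inner torus h (character k)))\<^sup>2) \<partial>count_space UNIV) = energy torus h"
proof -
  define a where "a = (\<lambda>k. L2_inner torus h (character k))"
  have "(\<lambda>k. (cmod (a k))\<^sup>2) summable_on UNIV"
  proof (rule nonneg_bdd_above_summable_on)
    show "bdd_above (sum (\<lambda>k. (cmod (a k))\<^sup>2) ` {F. F \<subseteq> UNIV \<and> finite F})"
      using synthesis_bound_imp_coefficient_bound[OF character_L2 synthesis_bound_characters _ h]
      unfolding a_def by (intro bdd_aboveI2[of _ _ "(L2_norm torus h)\<^sup>2"]) simp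
  qed auto
  then obtain g where "L2_converges torus (\<lambda>N \<xi>. \<Sum>k\<in>initial_indices N. a k * character k \<xi>) g"
    using synthesis_bound_imp_converges[OF character_L2 synthesis_bound_characters
        incseq_initial_indices finite_initial_indices] by blast
  then have g: "L2_converges torus (\<lambda>N. trig_sum a (initial_indices N)) g"
    by (simp add: trig_sum_def[abs_def])
  then have gL2: "g \<in> L2 torus" by (simp add: L2_converges_def)
  have coeff: "L2_inner torus g (character k) = a k" for k
  proof (rule LIMSEQ_unique)
    show "(\<lambda>N. L2_inner torus (trig_sum a (initial_indices N)) (character k)) \<longlonglongrightarrow> L2_inner torus g (character k)"
      by (rule L2_inner_converges[OF g]) simp
    obtain N0 where N0: "k \<in> initial_indices N0"
      using finite_subset_initial_indices[of "{k}"] by auto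
    have "L2_inner torus (trig_sum a (initial_indices N)) (character k) = a k" if "N \<ge> N0" for N
      using N0 incseqD[OF incseq_initial_indices that]
      by (subst L2_inner_commute) (auto simp: L2_inner_trig_sum_character)
    then show "(\<lambda>N. L2_inner torus (trig_sum a (initial_indices N)) (character k)) \<longlonglongrightarrow> a k"
      by (intro tendsto_eventually eventually_sequentiallyI)
  qed
  have "AE \<xi> in torus. h \<xi> - g \<xi> = 0"
  proof (rule AE_zero_if_orthogonal_to_characters)
    fix k
    have "L2_inner torus (\<lambda>\<xi>. h \<xi> - g \<xi>) (character k) = L2_inner torus h (character k) - L2_inner torus g (character k)"
      unfolding L2_inner_def left_diff_distrib
      by (rule Bochner_Integration.integral_diff) (intro L2_mult_integrable h gL2 character_L2)+
    then show "L2_inner torus (\<lambda>\<xi>. h \<xi> - g \<xi>) (character k) = 0"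
      by (simp add: coeff a_def)
  qed (intro L2_diff h gL2)
  then have "energy torus h = energy torus g"
    by (intro energy_cong_AE) auto
  also have "\<dots> = (SUP N. \<Sum>k\<in>initial_indices N. ennreal ((cmod (a k))\<^sup>2))"
  proof (rule LIMSEQ_unique)
    have "(\<lambda>N. (L2_norm torus (trig_sum a (initial_indices N)))\<^sup>2) \<longlonglongrightarrow> (L2_norm torus g)\<^sup>2"
      by (intro tendsto_power L2_converges_norm g)
    then show "(\<lambda>N. \<Sum>k\<in>initial_indices N. ennreal ((cmod (a k))\<^sup>2)) \<longlonglongrightarrow> energy torus g"
      unfolding energy_eq_L2_norm[OF gL2]
      by (simp add: L2_norm_trig_sum sum_ennreal)
    show "(\<lambda>N. \<Sum>k\<in>initial_indices N. ennreal ((cmod (a k))\<^sup>2))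
        \<longlonglongrightarrow> (SUP N. \<Sum>k\<in>initial_indices N. ennreal ((cmod (a k))\<^sup>2))"
      using incseqD[OF incseq_initial_indices]
      by (intro LIMSEQ_SUP) (auto simp: incseq_def simp del: sum_ennreal intro!: sum_mono2)
  qed
  finally show ?thesis
    by (simp add: nn_integral_count_space_SUP a_def)
qed

section \<open>Plancherel's identity for boundedly supported functions\<close>

definition fourier :: "(real^'n \<Rightarrow> complex) \<Rightarrow> real^'n \<Rightarrow> complex" where
  "fourier h t = (\<integral>x. h x * cis (2 * pi * (x \<bullet> t)) \<partial>lborel)"

lemma cis_measurable[measurable (raw)]:
  "f \<in> borel_measurable M \<Longrightarrow> (\<lambda>x. cis (f x)) \<in> borel_measurable M"
  by (rule borel_measurable_continuous_on[of cis]) (auto intro!: continuous_intros)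

lemma lborel_measurable_integral_snd:
  fixes f :: "'a::euclidean_space \<times> 'b::euclidean_space \<Rightarrow> complex"
  assumes "f \<in> borel_measurable borel"
  shows "(\<lambda>z. \<integral>x. f (x, z) \<partial>lborel) \<in> borel_measurable borel"
proof -
  have "(\<lambda>(z, x). f (x, z)) \<in> borel_measurable (borel \<Otimes>\<^sub>M lborel)"
    using assms by (simp add: borel_prod split_beta')
  then show ?thesis
    by (rule lborel.borel_measurable_lebesgue_integral)
qed

lemma fourier_measurable[measurable]:
  assumes [measurable]: "h \<in> borel_measurable borel"
  shows "fourier h \<in> borel_measurable borel"
  unfolding fourier_def
  using lborel_measurable_integral_snd[of "\<lambda>(x, t). h x * cis (2 * pi * (x \<bullet> t))"]
  by (simp add: borel_prod[symmetric] split_beta')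

lemma nn_integral_lborel_affine:
  fixes f :: "'a::euclidean_space \<Rightarrow> ennreal"
  assumes [measurable]: "f \<in> borel_measurable borel" and "c > 0"
  shows "(\<integral>\<^sup>+x. f x \<partial>lborel) = ennreal (c ^ DIM('a)) * (\<integral>\<^sup>+x. f (t + c *\<^sub>R x) \<partial>lborel)"
  using \<open>c > 0\<close>
  by (subst lborel_affine[of c t])
     (simp_all add: nn_integral_density nn_integral_distr nn_integral_cmult)

lemma lborel_integral_affine:
  fixes f :: "'a::euclidean_space \<Rightarrow> complex"
  assumes [measurable]: "f \<in> borel_measurable borel" and "c > 0"
  shows "(\<integral>x. f x \<partial>lborel) = of_real (c ^ DIM('a)) * (\<integral>x. f (t + c *\<^sub>R x) \<partial>lborel)"
  using \<open>c > 0\<close>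
  by (subst lborel_affine[of c t])
     (simp_all add: integral_density integral_distr scaleR_conv_of_real)

lemma emeasure_torus: "emeasure torus (cell :: (real^'n) set) = 1"
proof -
  interpret finite_measure "torus :: (real^'n) measure" by (rule finite_measure_torus)
  have "complex_of_real (measure torus (cell :: (real^'n) set)) = 1"
    using integral_character[of "0 :: int^'n"] by (simp add: scaleR_conv_of_real)
  then show ?thesis
    by (simp add: emeasure_eq_measure)
qed

lemma energy_torus_eq_lborel:
  assumes "\<And>x. x \<notin> cell \<Longrightarrow> h x = 0"
  shows "energy torus h = energy lborel h"
  unfolding energy_def nn_integral_torus
  by (intro nn_integral_cong) (use assms in \<open>auto split: split_indicator\<close>)

text \<open>For \<open>h\<close> supported in the cell, the numbers \<open>fourier h (t + m)\<close> with \<open>m\<close> in the lattice are Fourier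
  coefficients of the modulation of \<open>h\<close> by \<open>t\<close>, up to conjugation. Parseval's identity sums
  their squares to the energy of \<open>h\<close> for each \<open>t\<close>, and integrating \<open>t\<close> over the torus collects
  the whole space.\<close>

lemma plancherel_cell:
  fixes h :: "real^'n \<Rightarrow> complex"
  assumes hm[measurable]: "h \<in> borel_measurable borel" and fin: "energy lborel h < \<infinity>"
    and supp: "\<And>x. x \<notin> cell \<Longrightarrow> h x = 0"
  shows "energy lborel (fourier h) = energy lborel h"
proof -
  have parseval: "(\<integral>\<^sup>+m. ennreal ((cmod (fourier h (t + vec_of_int m)))\<^sup>2) \<partial>count_space UNIV)
      = energy lborel h" for t
  proof -
    \<comment> \<open>The conjugate makes the coefficient at \<open>m\<close>, rather than at \<open>- m\<close>, correspond to \<open>t + m\<close>.\<close>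
    define H where "H = (\<lambda>x. cnj (h x * cis (2 * pi * (x \<bullet> t))))"
    have "energy torus H = energy lborel H"
      by (rule energy_torus_eq_lborel) (simp add: H_def supp)
    also have "\<dots> = energy lborel h"
      by (simp add: energy_def H_def norm_mult)
    finally have H: "energy torus H = energy lborel h" .
    have "H \<in> L2 torus"
      unfolding L2_iff_energy H using fin by (auto simp: H_def)
    moreover have "cmod (fourier h (t + vec_of_int m)) = cmod (L2_inner torus H (character m))" for m
    proof -
      have "L2_inner torus H (character m) = (\<integral>x. cnj (h x * cis (2 * pi * (x \<bullet> (t + vec_of_int m)))) \<partial>lborel)"
        unfolding L2_inner_def integral_torus
      proof (rule Bochner_Integration.integral_cong)
        fix x :: "real^'n"
        show "indicator cell x *\<^sub>R (H x * cnj (character m x))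
            = cnj (h x * cis (2 * pi * (x \<bullet> (t + vec_of_int m))))"
          by (cases "x \<in> cell")
             (auto simp: H_def supp character_def inner_add_right distrib_left cis_mult[symmetric])
      qed simp
      also have "\<dots> = cnj (fourier h (t + vec_of_int m))"
        unfolding fourier_def by (rule Bochner_Integration.integral_cnj)
      finally show ?thesis by simp
    qed
    ultimately show ?thesis
      using parseval_torus[of H] H by simp
  qed
  have "energy lborel (fourier h) = (\<integral>\<^sup>+t. energy lborel h \<partial>(torus :: (real^'n) measure))"
    unfolding energy_def[of lborel "fourier h"]
    by (subst nn_integral_periodization) (auto simp: parseval)
  then show ?thesis
    by (simp add: emeasure_torus)
qed

text \<open>An affine change of variables moves a bounded support into the cell. The scaling factors of the two
  sides agree.\<close>

theorem plancherel_bounded_support: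
  fixes h :: "real^'n \<Rightarrow> complex"
  assumes hm[measurable]: "h \<in> borel_measurable borel" and fin: "energy lborel h < \<infinity>"
    and supp: "\<And>x. x \<notin> cball 0 R \<Longrightarrow> h x = 0" and "R \<ge> 0"
  shows "energy lborel (fourier h) = energy lborel h"
proof -
  \<comment> \<open>The strict inequality \<open>c > 2 * R\<close> puts the rescaled ball into the half-open cell.\<close>
  define c where "c = 2 * R + 1"
  define a where "a = (\<chi> i. - R :: real^'n)"
  define g where "g = (\<lambda>y. h (a + c *\<^sub>R y))"
  have c_gt: "c > 2 * R" by (simp add: c_def)
  have c: "c > 0" using \<open>R \<ge> 0\<close> by (simp add: c_def)
  have gm[measurable]: "g \<in> borel_measurable borel" unfolding g_def by measurable
  have energy_g: "energy lborel h = ennreal (c ^ CARD('n)) * energy lborel g"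
    unfolding energy_def g_def by (subst nn_integral_lborel_affine[OF _ c, of _ a]) auto
  have "energy lborel g < \<infinity>"
    using fin c unfolding energy_g by (auto simp: ennreal_mult_less_top)
  moreover have "g y = 0" if "y \<notin> cell" for y
  proof -
    have "a + c *\<^sub>R y \<notin> cball 0 R"
    proof
      assume "a + c *\<^sub>R y \<in> cball 0 R"
      then have bound: "\<bar>- R + c * y $ i\<bar> \<le> R" for i
        using component_le_norm_cart[of "a + c *\<^sub>R y" i] by (simp add: a_def)
      have "0 \<le> c * y $ i \<and> c * y $ i < c" for i
        using abs_le_D1[OF bound[of i]] abs_le_D2[OF bound[of i]] c_gt by linarith
      then have "0 \<le> y $ i \<and> y $ i < 1" for i
        using c by (metis mult_less_cancel_left_pos mult.right_neutral zero_le_mult_iff not_less)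
      then have "y \<in> cell"
        by (simp add: cell_def)
      then show False using that by simp
    qed
    then show ?thesis by (simp add: g_def supp)
  qed
  ultimately have plancherel_g: "energy lborel (fourier g) = energy lborel g"
    by (intro plancherel_cell) auto
  have "cmod (fourier h t) = c ^ CARD('n) * cmod (fourier g (c *\<^sub>R t))" for t
  proof -
    have "fourier h t = of_real (c ^ CARD('n)) * (\<integral>y. g y * cis (2 * pi * ((a + c *\<^sub>R y) \<bullet> t)) \<partial>lborel)"
      unfolding fourier_def g_def by (subst lborel_integral_affine[OF _ c, of _ a]) auto
    also have "(\<integral>y. g y * cis (2 * pi * ((a + c *\<^sub>R y) \<bullet> t)) \<partial>lborel)
        = cis (2 * pi * (a \<bullet> t)) * fourier g (c *\<^sub>R t)"
      unfolding fourier_def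
      by (subst integral_mult_right_zero[symmetric])
         (simp add: inner_add_left distrib_left cis_mult[symmetric] mult_ac)
    finally show ?thesis using c by (simp add: norm_mult norm_power)
  qed
  then have "energy lborel (fourier h)
      = (\<integral>\<^sup>+t. ennreal (c ^ CARD('n)) * ennreal (c ^ CARD('n)) * ennreal ((cmod (fourier g (c *\<^sub>R t)))\<^sup>2) \<partial>lborel)"
    unfolding energy_def using c
    by (intro nn_integral_cong) (simp add: power_mult_distrib power2_eq_square flip: ennreal_mult)
  also have "\<dots> = ennreal (c ^ CARD('n)) *
      (ennreal (c ^ CARD('n)) * (\<integral>\<^sup>+t. ennreal ((cmod (fourier g (0 + c *\<^sub>R t)))\<^sup>2) \<partial>lborel))"
    by (simp add: nn_integral_cmult mult.assoc)
  also have "ennreal (c ^ CARD('n)) * (\<integral>\<^sup>+t. ennreal ((cmod (fourier g (0 + c *\<^sub>R t)))\<^sup>2) \<partial>lborel)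
      = energy lborel (fourier g)"
    unfolding energy_def by (subst (2) nn_integral_lborel_affine[OF _ c, of _ 0]) auto
  finally show ?thesis
    by (simp add: plancherel_g energy_g)
qed

section \<open>The Weyl transform\<close>

text \<open>The kernel of the Weyl transform for functions with bounded support in the first variable, where the
  defining integral converges absolutely at almost every point if the function is square-integrable.
  General square-integrable functions are limits of such functions.\<close>

definition weyl_integral ::
  "((real^'n) \<times> (real^'n) \<Rightarrow> complex) \<Rightarrow> (real^'n) \<times> (real^'n) \<Rightarrow> complex" where
  "weyl_integral h = (\<lambda>(\<xi>, \<eta>). \<integral>x. h (x, \<eta> - \<xi>) * cis (pi * (x \<bullet> (\<xi> + \<eta>))) \<partial>lborel)"

definition bounded_first :: "('a::real_normed_vector \<times> 'b \<Rightarrow> complex) \<Rightarrow> bool" where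
  "bounded_first h \<longleftrightarrow> (\<exists>R\<ge>0. \<forall>x y. x \<notin> cball 0 R \<longrightarrow> h (x, y) = 0)"

lemma weyl_integral_measurable[measurable]:
  assumes [measurable]: "h \<in> borel_measurable borel"
  shows "weyl_integral h \<in> borel_measurable borel"
proof -
  have "(\<lambda>(x, z). h (x, snd z - fst z) * cis (pi * (x \<bullet> (fst z + snd z)))) \<in> borel_measurable borel"
    unfolding borel_prod[symmetric] by measurable
  from lborel_measurable_integral_snd[OF this] show ?thesis
    by (simp add: weyl_integral_def split_beta')
qed

lemma energy_prod:
  fixes f :: "'a::euclidean_space \<times> 'b::euclidean_space \<Rightarrow> complex"
  assumes [measurable]: "f \<in> borel_measurable borel"
  shows "energy lborel f = (\<integral>\<^sup>+x. energy lborel (\<lambda>y. f (x, y)) \<partial>lborel)"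
    and "energy lborel f = (\<integral>\<^sup>+y. energy lborel (\<lambda>x. f (x, y)) \<partial>lborel)"
proof -
  have m: "(\<lambda>z. ennreal ((cmod (f z))\<^sup>2)) \<in> borel_measurable (lborel \<Otimes>\<^sub>M lborel)"
    by (simp add: borel_prod lborel_prod)
  show "energy lborel f = (\<integral>\<^sup>+x. energy lborel (\<lambda>y. f (x, y)) \<partial>lborel)"
    unfolding energy_def using lborel.nn_integral_fst[OF m] by (simp add: lborel_prod)
  show "energy lborel f = (\<integral>\<^sup>+y. energy lborel (\<lambda>x. f (x, y)) \<partial>lborel)"
    unfolding energy_def using lborel_pair.nn_integral_snd[OF m] by (simp add: lborel_prod)
qed

lemma section_measurable:
  fixes f :: "'a::euclidean_space \<times> 'b::euclidean_space \<Rightarrow> complex"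
  assumes "f \<in> borel_measurable borel"
  shows "(\<lambda>y. f (x, y)) \<in> borel_measurable borel" "(\<lambda>x. f (x, y)) \<in> borel_measurable borel"
  using assms unfolding borel_prod[symmetric] by measurable

lemma L2_sections:
  fixes f :: "'a::euclidean_space \<times> 'b::euclidean_space \<Rightarrow> complex"
  assumes f: "f \<in> L2 lborel"
  shows "AE x in lborel. (\<lambda>y. f (x, y)) \<in> L2 lborel"
    and "AE y in lborel. (\<lambda>x. f (x, y)) \<in> L2 lborel"
proof -
  have fm[measurable]: "f \<in> borel_measurable borel" and fin: "energy lborel f < \<infinity>"
    using f by (auto simp: L2_iff_energy)
  have m: "(\<lambda>z. ennreal ((cmod (f z))\<^sup>2)) \<in> borel_measurable (lborel \<Otimes>\<^sub>M lborel)"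
    by (simp add: borel_prod lborel_prod)
  have "(\<integral>\<^sup>+x. energy lborel (\<lambda>y. f (x, y)) \<partial>lborel) \<noteq> \<infinity>"
    using fin unfolding energy_prod(1)[OF fm] by simp
  then have "AE x in lborel. energy lborel (\<lambda>y. f (x, y)) \<noteq> \<infinity>"
    unfolding energy_def
    by (rule nn_integral_PInf_AE[rotated]) (rule lborel.borel_measurable_nn_integral_fst[OF m])
  then show "AE x in lborel. (\<lambda>y. f (x, y)) \<in> L2 lborel"
    by eventually_elim (auto simp: L2_iff_energy section_measurable[OF fm] less_top)
  have "(\<lambda>y. \<integral>\<^sup>+x. ennreal ((cmod (f (x, y)))\<^sup>2) \<partial>lborel) \<in> borel_measurable lborel"
    using m by measurable
  moreover have "(\<integral>\<^sup>+y. energy lborel (\<lambda>x. f (x, y)) \<partial>lborel) \<noteq> \<infinity>"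
    using fin unfolding energy_prod(2)[OF fm] by simp
  ultimately have "AE y in lborel. energy lborel (\<lambda>x. f (x, y)) \<noteq> \<infinity>"
    unfolding energy_def by (rule nn_integral_PInf_AE)
  then show "AE y in lborel. (\<lambda>x. f (x, y)) \<in> L2 lborel"
    by eventually_elim (auto simp: L2_iff_energy section_measurable[OF fm] less_top)
qed

text \<open>In the sheared coordinates \<open>y = \<eta> - \<xi>\<close> the kernel is, for fixed \<open>y\<close>, the Fourier transform of the
  section \<open>h (\<cdot>, y)\<close> times a unimodular factor. The shear preserves Lebesgue measure, and
  Plancherel applies to each section.\<close>

theorem weyl_integral_isometry:
  fixes h :: "(real^'n) \<times> (real^'n) \<Rightarrow> complex"
  assumes h: "h \<in> L2 lborel" and supp: "bounded_first h"
  shows "energy lborel (weyl_integral h) = energy lborel h"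
proof -
  have hm[measurable]: "h \<in> borel_measurable borel" using h by (auto simp: L2_iff_energy)
  obtain R where R: "R \<ge> 0" "\<And>x y. x \<notin> cball 0 R \<Longrightarrow> h (x, y) = 0"
    using supp unfolding bounded_first_def by blast
  define g where "g = (\<lambda>y x. h (x, y) * cis (pi * (x \<bullet> y)))"
  have shear: "weyl_integral h (\<xi>, y + \<xi>) = fourier (g y) \<xi>" for \<xi> y
    unfolding weyl_integral_def fourier_def g_def prod.case
  proof (rule Bochner_Integration.integral_cong)
    fix x
    have "pi * (x \<bullet> (\<xi> + (y + \<xi>))) = pi * (x \<bullet> y) + 2 * pi * (x \<bullet> \<xi>)"
      by (simp only: inner_add_right distrib_left)
    then show "h (x, y + \<xi> - \<xi>) * cis (pi * (x \<bullet> (\<xi> + (y + \<xi>))))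
        = h (x, y) * cis (pi * (x \<bullet> y)) * cis (2 * pi * (x \<bullet> \<xi>))"
      by (simp add: cis_mult)
  qed simp
  have m: "(\<lambda>z. ennreal ((cmod (weyl_integral h (fst z, snd z + fst z)))\<^sup>2)) \<in> borel_measurable (lborel \<Otimes>\<^sub>M lborel)"
    using weyl_integral_measurable[OF hm] unfolding borel_prod[symmetric] by measurable
  have "energy lborel (weyl_integral h) = (\<integral>\<^sup>+\<xi>. (\<integral>\<^sup>+\<eta>. ennreal ((cmod (weyl_integral h (\<xi>, \<eta>)))\<^sup>2) \<partial>lborel) \<partial>lborel)"
    by (subst energy_prod) (auto simp: energy_def)
  also have "\<dots> = (\<integral>\<^sup>+\<xi>. (\<integral>\<^sup>+y. ennreal ((cmod (weyl_integral h (\<xi>, y + \<xi>)))\<^sup>2) \<partial>lborel) \<partial>lborel)"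
  proof (rule nn_integral_cong)
    fix \<xi> :: "real^'n"
    have [measurable]: "(\<lambda>\<eta>. weyl_integral h (\<xi>, \<eta>)) \<in> borel_measurable borel"
      by (rule section_measurable) simp
    show "(\<integral>\<^sup>+\<eta>. ennreal ((cmod (weyl_integral h (\<xi>, \<eta>)))\<^sup>2) \<partial>lborel)
        = (\<integral>\<^sup>+y. ennreal ((cmod (weyl_integral h (\<xi>, y + \<xi>)))\<^sup>2) \<partial>lborel)"
      by (rule nn_integral_lborel_translation[symmetric]) measurable
  qed
  also have "\<dots> = (\<integral>\<^sup>+y. (\<integral>\<^sup>+\<xi>. ennreal ((cmod (weyl_integral h (\<xi>, y + \<xi>)))\<^sup>2) \<partial>lborel) \<partial>lborel)"
    using lborel_pair.Fubini[OF m] by simp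
  also have "\<dots> = (\<integral>\<^sup>+y. energy lborel (fourier (g y)) \<partial>lborel)"
    by (simp add: shear energy_def)
  also have "\<dots> = (\<integral>\<^sup>+y. energy lborel (\<lambda>x. h (x, y)) \<partial>lborel)"
  proof (rule nn_integral_cong_AE, rule eventually_mono[OF L2_sections(2)[OF h]])
    fix y assume y: "(\<lambda>x. h (x, y)) \<in> L2 lborel"
    have [measurable]: "(\<lambda>x. h (x, y)) \<in> borel_measurable borel"
      by (rule section_measurable[OF hm])
    have "energy lborel (g y) = energy lborel (\<lambda>x. h (x, y))"
      by (simp add: energy_def g_def norm_mult)
    moreover have "energy lborel (fourier (g y)) = energy lborel (g y)"
    proof (rule plancherel_bounded_support)
      show "g y \<in> borel_measurable borel" unfolding g_def by measurable
      show "energy lborel (g y) < \<infinity>"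
        using y calculation by (simp add: L2_iff_energy)
      show "g y x = 0" if "x \<notin> cball 0 R" for x
        using R(2)[OF that] by (simp add: g_def)
    qed fact
    ultimately show "energy lborel (fourier (g y)) = energy lborel (\<lambda>x. h (x, y))"
      by simp
  qed
  also have "\<dots> = energy lborel h"
    by (rule energy_prod(2)[symmetric]) simp
  finally show ?thesis .
qed

section \<open>Existence of the kernel\<close>

lemma AE_lborel_translation:
  fixes a :: "'a::euclidean_space"
  assumes "AE x in lborel. P x"
  shows "AE x in lborel. P (a + x)"
proof (rule AE_distrD[of "(+) a" lborel borel])
  show "AE x in distr lborel borel ((+) a). P x"
    using assms unfolding lborel_distr_plus .
qed simp

lemma indicator_cball_measurable[measurable]:
  "(\<lambda>x :: 'a::euclidean_space. indicator (cball a r) x :: complex) \<in> borel_measurable borel"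
proof -
  have [measurable]: "cball a r \<in> sets borel" by simp
  have "(\<lambda>x :: 'a. complex_of_real (indicator (cball a r) x)) \<in> borel_measurable borel"
    by measurable
  then show ?thesis by (simp add: of_real_indicator)
qed

lemma L2_bounded_support_integrable:
  assumes f: "f \<in> L2 lborel" and supp: "\<And>x :: 'a::euclidean_space. x \<notin> cball 0 R \<Longrightarrow> f x = 0"
  shows "integrable lborel f"
proof -
  have "(\<lambda>x. indicator (cball 0 R) x) \<in> L2 (lborel :: 'a measure)"
    unfolding L2_iff_energy
  proof
    have "energy lborel (\<lambda>x. indicator (cball (0::'a) R) x) = emeasure lborel (cball (0::'a) R)"
    proof -
      have "(\<lambda>x. ennreal ((cmod (indicator (cball (0::'a) R) x))\<^sup>2)) = indicator (cball 0 R)"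
        by (auto simp: fun_eq_iff split: split_indicator)
      then show ?thesis
        by (simp add: energy_def)
    qed
    also have "\<dots> < \<infinity>" by (rule emeasure_bounded_finite) simp
    finally show "energy lborel (\<lambda>x. indicator (cball (0::'a) R) x) < \<infinity>" .
  qed simp
  from L2_mult_integrable[OF f this] show ?thesis
  proof (rule back_subst[of "integrable lborel"])
    show "(\<lambda>x. f x * cnj (indicator (cball 0 R) x)) = f"
      using supp by (auto simp: fun_eq_iff split: split_indicator)
  qed
qed

lemma bounded_first_cmult: "bounded_first h \<Longrightarrow> bounded_first (\<lambda>z. c * h z)"
  unfolding bounded_first_def by fastforce

lemma bounded_first_sum:
  fixes h :: "'j \<Rightarrow> 'a::real_normed_vector \<times> 'b \<Rightarrow> complex"
  assumes "finite J" "\<And>j. j \<in> J \<Longrightarrow> bounded_first (h j)"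
  shows "bounded_first (\<lambda>z. \<Sum>j\<in>J. h j z)"
  using assms
proof (induction J)
  case (insert j J)
  obtain R where R: "R \<ge> 0" "\<And>x y. x \<notin> cball 0 R \<Longrightarrow> h j (x, y) = 0"
    using insert.prems[of j] by (auto simp: bounded_first_def)
  obtain S where S: "S \<ge> 0" "\<And>x y. x \<notin> cball 0 S \<Longrightarrow> (\<Sum>j\<in>J. h j (x, y)) = 0"
    using insert by (auto simp: bounded_first_def)
  show ?case
    unfolding bounded_first_def
  proof (intro exI[of _ "max R S"] conjI allI impI)
    fix x :: 'a and y :: 'b assume "x \<notin> cball 0 (max R S)"
    then have "x \<notin> cball 0 R" "x \<notin> cball 0 S" by auto
    then show "(\<Sum>j\<in>insert j J. h j (x, y)) = 0"
      using insert R S by simp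
  qed (use R in simp)
qed (auto simp: bounded_first_def)

lemma weyl_integral_L2:
  "h \<in> L2 lborel \<Longrightarrow> bounded_first h \<Longrightarrow> weyl_integral h \<in> L2 lborel"
  using weyl_integral_isometry[of h] by (auto simp: L2_iff_energy)

text \<open>Linearity holds only almost everywhere: at points where some section fails to be integrable, the
  Bochner integral takes its default value.\<close>

lemma weyl_integral_sum:
  fixes h :: "'j \<Rightarrow> (real^'n) \<times> (real^'n) \<Rightarrow> complex"
  assumes "finite J" and h: "\<And>j. j \<in> J \<Longrightarrow> h j \<in> L2 lborel" and supp: "\<And>j. j \<in> J \<Longrightarrow> bounded_first (h j)"
  shows "AE z in lborel. weyl_integral (\<lambda>w. \<Sum>j\<in>J. c j * h j w) z = (\<Sum>j\<in>J. c j * weyl_integral (h j) z)"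
proof -
  have [measurable]: "h j \<in> borel_measurable borel" if "j \<in> J" for j
    using h[OF that] by (auto simp: L2_iff_energy)
  have "AE y in lborel. \<forall>j\<in>J. (\<lambda>x. h j (x, y)) \<in> L2 lborel"
    using L2_sections(2)[OF h] \<open>finite J\<close> by (subst AE_finite_all) auto
  then have good: "AE y in lborel. \<forall>j\<in>J. integrable lborel (\<lambda>x. h j (x, y))"
  proof eventually_elim
    case (elim y)
    show ?case
    proof
      fix j assume j: "j \<in> J"
      obtain R where "\<And>x y. x \<notin> cball 0 R \<Longrightarrow> h j (x, y) = 0"
        using supp[OF j] by (auto simp: bounded_first_def)
      then show "integrable lborel (\<lambda>x. h j (x, y))"
        using elim j by (intro L2_bounded_support_integrable[of _ R]) auto
    qed
  qed
  have eq: "weyl_integral (\<lambda>w. \<Sum>j\<in>J. c j * h j w) (\<xi>, \<eta>) = (\<Sum>j\<in>J. c j * weyl_integral (h j) (\<xi>, \<eta>))"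
    if "\<forall>j\<in>J. integrable lborel (\<lambda>x. h j (x, - \<xi> + \<eta>))" for \<xi> \<eta>
  proof -
    have i: "integrable lborel (\<lambda>x. h j (x, \<eta> - \<xi>) * cis (pi * (x \<bullet> (\<xi> + \<eta>))))" if j: "j \<in> J" for j
    proof (rule Bochner_Integration.integrable_bound)
      show "integrable lborel (\<lambda>x. h j (x, \<eta> - \<xi>))"
        using \<open>\<forall>j\<in>J. _ j\<close> j by simp
      then have "(\<lambda>x. h j (x, \<eta> - \<xi>)) \<in> borel_measurable lborel" by simp
      then show "(\<lambda>x. h j (x, \<eta> - \<xi>) * cis (pi * (x \<bullet> (\<xi> + \<eta>)))) \<in> borel_measurable lborel"
        by (intro borel_measurable_times cis_measurable) auto
    qed (simp add: norm_mult)
    show ?thesis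
      unfolding weyl_integral_def prod.case
      using i by (simp add: sum_distrib_right mult.assoc Bochner_Integration.integral_sum integrable_mult_right)
  qed
  have "AE \<xi> in lborel. AE \<eta> in lborel. weyl_integral (\<lambda>w. \<Sum>j\<in>J. c j * h j w) (\<xi>, \<eta>)
      = (\<Sum>j\<in>J. c j * weyl_integral (h j) (\<xi>, \<eta>))"
  proof (rule AE_I2)
    fix \<xi> :: "real^'n"
    show "AE \<eta> in lborel. weyl_integral (\<lambda>w. \<Sum>j\<in>J. c j * h j w) (\<xi>, \<eta>)
        = (\<Sum>j\<in>J. c j * weyl_integral (h j) (\<xi>, \<eta>))"
      using AE_lborel_translation[OF good, of "- \<xi>"] by eventually_elim (rule eq)
  qed
  moreover have "{z \<in> space (lborel \<Otimes>\<^sub>M lborel). weyl_integral (\<lambda>w. \<Sum>j\<in>J. c j * h j w) z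
      = (\<Sum>j\<in>J. c j * weyl_integral (h j) z)} \<in> sets (lborel \<Otimes>\<^sub>M lborel)"
    unfolding lborel_prod by measurable
  ultimately have "AE z in lborel \<Otimes>\<^sub>M lborel. weyl_integral (\<lambda>w. \<Sum>j\<in>J. c j * h j w) z
      = (\<Sum>j\<in>J. c j * weyl_integral (h j) z)"
    by (intro lborel_pair.AE_pair_measure) auto
  then show ?thesis unfolding lborel_prod .
qed

definition cut_first :: "nat \<Rightarrow> ('a::euclidean_space \<times> 'b \<Rightarrow> complex) \<Rightarrow> 'a \<times> 'b \<Rightarrow> complex" where
  "cut_first N f = (\<lambda>(x, y). indicator (cball 0 (real N)) x * f (x, y))"

lemma truncated_weyl_kernel_eq: "truncated_weyl_kernel N f = weyl_integral (cut_first N f)"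
  by (auto simp: truncated_weyl_kernel_def weyl_integral_def cut_first_def set_lebesgue_integral_def
      fun_eq_iff scaleR_conv_of_real mult.assoc of_real_indicator intro!: Bochner_Integration.integral_cong)

lemma bounded_first_cut: "bounded_first (cut_first N f)"
  unfolding bounded_first_def cut_first_def by (intro exI[of _ "real N"]) auto

lemma cut_first_L2:
  fixes f :: "'a::euclidean_space \<times> 'b::euclidean_space \<Rightarrow> complex"
  assumes f: "f \<in> L2 lborel"
  shows "cut_first N f \<in> L2 lborel"
proof -
  have fm: "f \<in> borel_measurable borel" and fin: "energy lborel f < \<infinity>"
    using f by (auto simp: L2_iff_energy)
  have "cut_first N f \<in> borel_measurable borel"
  proof -
    have "cut_first N f = (\<lambda>z. indicator (cball 0 (real N)) (fst z) * f z)"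
      by (simp add: cut_first_def split_beta')
    moreover have "(\<lambda>z :: 'a \<times> 'b. indicator (cball 0 (real N)) (fst z) :: complex) \<in> borel_measurable borel"
      unfolding borel_prod[symmetric] by (rule measurable_compose[OF measurable_fst indicator_cball_measurable])
    ultimately show ?thesis
      using fm by simp
  qed
  moreover have "energy lborel (cut_first N f) \<le> energy lborel f"
    unfolding energy_def cut_first_def
    by (intro nn_integral_mono) (auto split: split_indicator)
  ultimately show ?thesis
    using fin by (auto simp: L2_iff_energy)
qed

lemma cut_first_converges:
  fixes f :: "'a::euclidean_space \<times> 'b::euclidean_space \<Rightarrow> complex"
  assumes f: "f \<in> L2 lborel"
  shows "L2_converges lborel (\<lambda>N. cut_first N f) f"
proof -
  have "(\<lambda>N. \<integral>z. (cmod (cut_first N f z - f z))\<^sup>2 \<partial>lborel) \<longlonglongrightarrow> (\<integral>z. 0 \<partial>(lborel :: ('a \<times> 'b) measure))"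
  proof (rule integral_dominated_convergence)
    show "integrable lborel (\<lambda>z. (cmod (f z))\<^sup>2)" using f by (simp add: L2_def)
    show "(\<lambda>z. (cmod (cut_first N f z - f z))\<^sup>2) \<in> borel_measurable lborel" for N
    proof -
      have [measurable]: "(\<lambda>z. cut_first N f z - f z) \<in> borel_measurable lborel"
        using L2_diff[OF cut_first_L2[OF f] f] by (simp only: L2_iff_energy)
      show ?thesis by measurable
    qed
    show "AE z in lborel. (\<lambda>N. (cmod (cut_first N f z - f z))\<^sup>2) \<longlonglongrightarrow> 0"
    proof (rule AE_I2)
      fix z :: "'a \<times> 'b"
      obtain N0 where N0: "norm (fst z) \<le> real N0" using real_arch_simple by blast
      show "(\<lambda>N. (cmod (cut_first N f z - f z))\<^sup>2) \<longlonglongrightarrow> 0"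
      proof (rule tendsto_eventually, rule eventually_sequentiallyI[of N0])
        fix N assume "N0 \<le> N"
        then have "fst z \<in> cball 0 (real N)" using N0 by simp
        then show "(cmod (cut_first N f z - f z))\<^sup>2 = 0"
          by (simp add: cut_first_def split_beta')
      qed
    qed
    show "AE z in lborel. norm ((cmod (cut_first N f z - f z))\<^sup>2) \<le> (cmod (f z))\<^sup>2" for N
      by (intro AE_I2) (auto simp: cut_first_def split_beta' split: split_indicator)
  qed auto
  then have "(\<lambda>N. L2_norm lborel (\<lambda>z. cut_first N f z - f z)) \<longlonglongrightarrow> 0"
    unfolding L2_norm_def using tendsto_real_sqrt by fastforce
  then show ?thesis
    using cut_first_L2 f by (auto simp: L2_converges_def)
qed

lemma L2_norm_eqI: "energy M f = energy N g \<Longrightarrow> f \<in> L2 M \<Longrightarrow> g \<in> L2 N \<Longrightarrow> L2_norm M f = L2_norm N g"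
  by (simp add: energy_eq_L2_norm)

text \<open>The isometry turns the convergence of the cut-off functions into a Cauchy condition for their
  kernels.\<close>

theorem weyl_kernel_exists:
  fixes f :: "(real^'n) \<times> (real^'n) \<Rightarrow> complex"
  assumes f: "f \<in> L2 lborel"
  shows "is_weyl_kernel f (weyl_kernel f)"
proof -
  define u where "u = (\<lambda>N. weyl_integral (cut_first N f))"
  have u: "u N \<in> L2 lborel" for N
    unfolding u_def by (intro weyl_integral_L2 cut_first_L2 f bounded_first_cut)
  have norm_diff: "L2_norm lborel (\<lambda>z. u m z - u n z) = L2_norm lborel (\<lambda>z. cut_first m f z - cut_first n f z)" for m n
  proof (rule L2_norm_eqI)
    define h where "h = (\<lambda>b. cut_first (if b then m else n) f)"
    define c :: "bool \<Rightarrow> complex" where "c = (\<lambda>b. if b then 1 else -1)"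
    define d where "d = (\<lambda>w. \<Sum>b\<in>UNIV. c b * h b w)"
    have d: "d = (\<lambda>z. cut_first m f z - cut_first n f z)"
      by (simp add: d_def c_def h_def UNIV_bool fun_eq_iff)
    have "AE z in lborel. weyl_integral d z = (\<Sum>b\<in>UNIV. c b * weyl_integral (h b) z)"
      unfolding d_def by (rule weyl_integral_sum) (auto simp: h_def intro: cut_first_L2 f bounded_first_cut)
    then have "energy lborel (\<lambda>z. u m z - u n z) = energy lborel (weyl_integral d)"
      by (intro energy_cong_AE) (auto simp: c_def h_def UNIV_bool u_def)
    also have "\<dots> = energy lborel d"
    proof (rule weyl_integral_isometry)
      show "d \<in> L2 lborel" unfolding d by (intro L2_diff cut_first_L2 f)
      show "bounded_first d" unfolding d_def h_def by (intro bounded_first_sum bounded_first_cmult bounded_first_cut) simp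
    qed
    finally show "energy lborel (\<lambda>z. u m z - u n z) = energy lborel (\<lambda>z. cut_first m f z - cut_first n f z)"
      by (simp add: d)
  qed (intro L2_diff u cut_first_L2 f)+
  have "\<exists>K. L2_converges lborel u K"
    by (rule L2_complete[OF u]) (use L2_converges_imp_Cauchy[OF cut_first_converges[OF f]] in \<open>simp add: norm_diff\<close>)
  then have "\<exists>K. is_weyl_kernel f K"
    by (simp add: is_weyl_kernel_def truncated_weyl_kernel_eq u_def)
  then show ?thesis
    unfolding weyl_kernel_def by (rule someI_ex)
qed

section \<open>Twisted translations in the Weyl picture\<close>

definition weyl_phase :: "(int^'n) \<times> (int^'n) \<Rightarrow> real^'n \<Rightarrow> complex" where
  "weyl_phase = (\<lambda>(k, l) \<xi>. cis (pi * (vec_of_int k \<bullet> vec_of_int l)) * character k \<xi>)"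

lemma norm_weyl_phase[simp]: "cmod (weyl_phase j \<xi>) = 1"
  by (simp add: weyl_phase_def norm_mult split_beta')

lemma weyl_phase_measurable[measurable]: "weyl_phase j \<in> borel_measurable borel"
  unfolding weyl_phase_def split_beta' by measurable

text \<open>Substituting \<open>x + k\<close> for \<open>x\<close> turns a twisted translation into a translation of the first variable
  of the kernel together with a unimodular factor. In that factor the phase of the twist combines
  with the Weyl phase in such a way that only \<open>\<xi>\<close> survives.\<close>

lemma weyl_integral_twisted_translation:
  fixes h :: "(real^'n) \<times> (real^'n) \<Rightarrow> complex" and k l :: "int^'n"
  assumes [measurable]: "h \<in> borel_measurable borel"
  shows "weyl_integral (twisted_translation (k, l) h) (\<xi>, \<eta>)
    = weyl_phase (k, l) \<xi> * weyl_integral h (\<xi> + vec_of_int l, \<eta>)"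
proof -
  define K L where "K = vec_of_int k" and "L = vec_of_int l"
  define F where "F = (\<lambda>x. cis (pi * (x \<bullet> L - (\<eta> - \<xi>) \<bullet> K)) * h (x - K, \<eta> - \<xi> - L) * cis (pi * (x \<bullet> (\<xi> + \<eta>))))"
  have [measurable]: "(\<lambda>x. h (x, y)) \<in> borel_measurable borel" for y
    by (rule section_measurable) simp
  have "(\<lambda>x. h (x - K, y)) \<in> borel_measurable borel" for y
    by (rule measurable_compose[of "\<lambda>x. x - K"]) measurable
  then have Fm: "F \<in> borel_measurable borel"
    unfolding F_def by measurable
  have "weyl_integral (twisted_translation (k, l) h) (\<xi>, \<eta>) = (\<integral>x. F x \<partial>lborel)"
    by (simp add: weyl_integral_def twisted_translation_def F_def K_def L_def)
  also have "\<dots> = (\<integral>x. F (K + x) \<partial>lborel)"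
    using lborel_integral_affine[OF Fm, of 1 K] by simp
  also have "\<dots> = (\<integral>x. weyl_phase (k, l) \<xi> *
      (h (x, \<eta> - (\<xi> + L)) * cis (pi * (x \<bullet> (\<xi> + L + \<eta>)))) \<partial>lborel)"
  proof (rule Bochner_Integration.integral_cong)
    fix x :: "real^'n"
    have "pi * ((K + x) \<bullet> L - (\<eta> - \<xi>) \<bullet> K) + pi * ((K + x) \<bullet> (\<xi> + \<eta>))
        = pi * (K \<bullet> L) + 2 * pi * (\<xi> \<bullet> K) + pi * (x \<bullet> (\<xi> + L + \<eta>))"
      by (simp add: inner_add_left inner_add_right inner_diff_left algebra_simps inner_commute[of _ K])
    then have "cis (pi * ((K + x) \<bullet> L - (\<eta> - \<xi>) \<bullet> K)) * cis (pi * ((K + x) \<bullet> (\<xi> + \<eta>)))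
        = weyl_phase (k, l) \<xi> * cis (pi * (x \<bullet> (\<xi> + L + \<eta>)))"
      by (simp add: weyl_phase_def character_def cis_mult K_def[symmetric] L_def[symmetric])
    moreover have "F (K + x) = (cis (pi * ((K + x) \<bullet> L - (\<eta> - \<xi>) \<bullet> K)) * cis (pi * ((K + x) \<bullet> (\<xi> + \<eta>))))
        * h (x, \<eta> - (\<xi> + L))"
      by (simp add: F_def diff_diff_eq mult_ac)
    ultimately show "F (K + x) = weyl_phase (k, l) \<xi> * (h (x, \<eta> - (\<xi> + L)) * cis (pi * (x \<bullet> (\<xi> + L + \<eta>))))"
      by (simp add: mult_ac)
  qed simp
  also have "\<dots> = weyl_phase (k, l) \<xi> * weyl_integral h (\<xi> + L, \<eta>)"
    by (simp add: weyl_integral_def)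
  finally show ?thesis by (simp add: L_def)
qed

lemma L2_converges_combination:
  assumes conv: "\<And>j. j \<in> J \<Longrightarrow> L2_converges M (u j) (g j)"
  shows "L2_converges M (\<lambda>N x. \<Sum>j\<in>J. c j * u j N x) (\<lambda>x. \<Sum>j\<in>J. c j * g j x)"
proof -
  have u: "\<And>j N. j \<in> J \<Longrightarrow> u j N \<in> L2 M" and g: "\<And>j. j \<in> J \<Longrightarrow> g j \<in> L2 M"
    and lim: "\<And>j. j \<in> J \<Longrightarrow> (\<lambda>N. L2_norm M (\<lambda>x. u j N x - g j x)) \<longlonglongrightarrow> 0"
    using conv by (auto simp: L2_converges_def)
  have "(\<lambda>N. L2_norm M (\<lambda>x. (\<Sum>j\<in>J. c j * u j N x) - (\<Sum>j\<in>J. c j * g j x))) \<longlonglongrightarrow> 0"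
  proof (rule Lim_null_comparison)
    show "(\<lambda>N. \<Sum>j\<in>J. cmod (c j) * L2_norm M (\<lambda>x. u j N x - g j x)) \<longlonglongrightarrow> 0"
      by (rule tendsto_null_sum) (rule tendsto_mult_right_zero[OF lim])
    show "\<forall>\<^sub>F N in sequentially. norm (L2_norm M (\<lambda>x. (\<Sum>j\<in>J. c j * u j N x) - (\<Sum>j\<in>J. c j * g j x)))
        \<le> (\<Sum>j\<in>J. cmod (c j) * L2_norm M (\<lambda>x. u j N x - g j x))"
    proof (rule always_eventually, rule allI)
      fix N
      have "L2_norm M (\<lambda>x. \<Sum>j\<in>J. c j * (u j N x - g j x))
          \<le> (\<Sum>j\<in>J. L2_norm M (\<lambda>x. c j * (u j N x - g j x)))"
        by (rule L2_norm_sum_le) (intro L2_cmult L2_diff u g)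
      then have "L2_norm M (\<lambda>x. \<Sum>j\<in>J. c j * (u j N x - g j x))
          \<le> (\<Sum>j\<in>J. cmod (c j) * L2_norm M (\<lambda>x. u j N x - g j x))"
        by (simp only: L2_norm_cmult)
      then show "norm (L2_norm M (\<lambda>x. (\<Sum>j\<in>J. c j * u j N x) - (\<Sum>j\<in>J. c j * g j x)))
          \<le> (\<Sum>j\<in>J. cmod (c j) * L2_norm M (\<lambda>x. u j N x - g j x))"
        by (simp add: right_diff_distrib sum_subtractf)
    qed
  qed
  then show ?thesis
    unfolding L2_converges_def by (intro conjI allI L2_sum L2_cmult u g)
qed

text \<open>Twisted translations and their counterparts on the kernel side are both of this form, so that
  their isometry and continuity need to be shown only once.\<close>

definition modulated_shift :: "('a::euclidean_space \<Rightarrow> complex) \<Rightarrow> 'a \<Rightarrow> ('a \<Rightarrow> complex) \<Rightarrow> 'a \<Rightarrow> complex" where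
  "modulated_shift m a f = (\<lambda>z. m z * f (z + a))"

lemma energy_modulated_shift:
  assumes [measurable]: "f \<in> borel_measurable borel" and m: "\<And>z. cmod (m z) = 1"
  shows "energy lborel (modulated_shift m a f) = energy lborel f"
  unfolding energy_def modulated_shift_def
  using nn_integral_lborel_translation[of "\<lambda>z. ennreal ((cmod (f z))\<^sup>2)" a] by (simp add: norm_mult m)

lemma modulated_shift_L2:
  assumes f: "f \<in> L2 lborel" and mm[measurable]: "m \<in> borel_measurable borel" and m: "\<And>z. cmod (m z) = 1"
  shows "modulated_shift m a f \<in> L2 lborel"
proof -
  have [measurable]: "f \<in> borel_measurable borel" using f by (auto simp: L2_iff_energy)
  have "(\<lambda>z. f (z + a)) \<in> borel_measurable borel"
    by (rule measurable_compose[of "\<lambda>z. z + a"]) measurable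
  then have "modulated_shift m a f \<in> borel_measurable borel"
    unfolding modulated_shift_def by measurable
  then show ?thesis
    using f energy_modulated_shift[of f m a, OF _ m] by (auto simp: L2_iff_energy)
qed

lemma modulated_shift_converges:
  assumes conv: "L2_converges lborel u g" and mm: "m \<in> borel_measurable borel" and m: "\<And>z. cmod (m z) = 1"
  shows "L2_converges lborel (\<lambda>N. modulated_shift m a (u N)) (modulated_shift m a g)"
proof -
  have u: "\<And>N. u N \<in> L2 lborel" and g: "g \<in> L2 lborel"
    and lim: "(\<lambda>N. L2_norm lborel (\<lambda>x. u N x - g x)) \<longlonglongrightarrow> 0"
    using conv by (auto simp: L2_converges_def)
  have "L2_norm lborel (\<lambda>z. modulated_shift m a (u N) z - modulated_shift m a g z)
      = L2_norm lborel (\<lambda>x. u N x - g x)" for N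
  proof -
    have d: "(\<lambda>x. u N x - g x) \<in> L2 lborel" by (intro L2_diff u g)
    have "(\<lambda>z. modulated_shift m a (u N) z - modulated_shift m a g z) = modulated_shift m a (\<lambda>x. u N x - g x)"
      by (simp add: modulated_shift_def right_diff_distrib)
    moreover have "L2_norm lborel (modulated_shift m a (\<lambda>x. u N x - g x)) = L2_norm lborel (\<lambda>x. u N x - g x)"
      using d by (intro L2_norm_eqI energy_modulated_shift modulated_shift_L2 mm m) (auto simp: L2_iff_energy)
    ultimately show ?thesis by simp
  qed
  then show ?thesis
    using lim unfolding L2_converges_def by (auto intro!: modulated_shift_L2 u g mm m)
qed

definition translation_phase :: "(int^'n) \<times> (int^'n) \<Rightarrow> (real^'n) \<times> (real^'n) \<Rightarrow> complex" where
  "translation_phase j z = cis (pi * (fst z \<bullet> vec_of_int (snd j) - snd z \<bullet> vec_of_int (fst j)))"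

lemma twisted_translation_eq:
  "twisted_translation j f = modulated_shift (translation_phase j) (- vec_of_int (fst j), - vec_of_int (snd j)) f"
  by (simp add: twisted_translation_def modulated_shift_def translation_phase_def split_beta' fun_eq_iff)

lemma translation_phase_measurable[measurable]: "translation_phase j \<in> borel_measurable borel"
  unfolding translation_phase_def borel_prod[symmetric] by measurable

lemma norm_translation_phase[simp]: "cmod (translation_phase j z) = 1"
  by (simp add: translation_phase_def)

lemma twisted_translation_L2:
  "f \<in> L2 lborel \<Longrightarrow> twisted_translation j f \<in> L2 lborel"
  unfolding twisted_translation_eq by (intro modulated_shift_L2) auto

lemma bounded_first_twisted_translation:
  fixes h :: "(real^'n) \<times> (real^'n) \<Rightarrow> complex"
  assumes "bounded_first h"
  shows "bounded_first (twisted_translation j h)"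
proof -
  obtain R where R: "R \<ge> 0" "\<And>x y. x \<notin> cball 0 R \<Longrightarrow> h (x, y) = 0"
    using assms by (auto simp: bounded_first_def)
  define a where "a = (vec_of_int (fst j) :: real^'n)"
  show ?thesis
    unfolding bounded_first_def
  proof (intro exI[of _ "R + norm a"] conjI allI impI)
    fix x y :: "real^'n" assume "x \<notin> cball 0 (R + norm a)"
    then have "x - a \<notin> cball 0 R"
      using norm_triangle_sub[of x a] by auto
    then show "twisted_translation j h (x, y) = 0"
      by (simp add: twisted_translation_def split_beta' R(2) a_def[symmetric])
  qed (use R in simp)
qed

definition weyl_translation ::
  "(int^'n) \<times> (int^'n) \<Rightarrow> ((real^'n) \<times> (real^'n) \<Rightarrow> complex) \<Rightarrow> (real^'n) \<times> (real^'n) \<Rightarrow> complex" where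
  "weyl_translation j = modulated_shift (\<lambda>z. weyl_phase j (fst z)) (vec_of_int (snd j), 0)"

lemma weyl_phase_fst_measurable[measurable]:
  "(\<lambda>z :: (real^'n) \<times> (real^'n). weyl_phase j (fst z)) \<in> borel_measurable borel"
  unfolding borel_prod[symmetric] by measurable

text \<open>For the cut-off functions this is the isometry of the Weyl transform and its covariance under
  twisted translations. Both sides pass to the \<open>L\<^sup>2\<close> limit.\<close>

theorem twisted_combination_norm:
  fixes \<phi> :: "(real^'n) \<times> (real^'n) \<Rightarrow> complex"
  assumes \<phi>: "\<phi> \<in> L2 lborel" and J: "finite J"
  shows "L2_norm lborel (\<lambda>z. \<Sum>j\<in>J. c j * twisted_translation j \<phi> z)
    = L2_norm lborel (\<lambda>z. \<Sum>j\<in>J. c j * weyl_translation j (weyl_kernel \<phi>) z)"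
proof (rule LIMSEQ_unique)
  define U where "U = (\<lambda>N z. \<Sum>j\<in>J. c j * twisted_translation j (cut_first N \<phi>) z)"
  define V where "V = (\<lambda>N z. \<Sum>j\<in>J. c j * weyl_translation j (weyl_integral (cut_first N \<phi>)) z)"
  have "L2_converges lborel U (\<lambda>z. \<Sum>j\<in>J. c j * twisted_translation j \<phi> z)"
    unfolding U_def twisted_translation_eq
    by (intro L2_converges_combination modulated_shift_converges cut_first_converges \<phi>) auto
  then show "(\<lambda>N. L2_norm lborel (U N)) \<longlonglongrightarrow> L2_norm lborel (\<lambda>z. \<Sum>j\<in>J. c j * twisted_translation j \<phi> z)"
    by (rule L2_converges_norm)
  have "L2_converges lborel (\<lambda>N. weyl_integral (cut_first N \<phi>)) (weyl_kernel \<phi>)"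
    using weyl_kernel_exists[OF \<phi>] by (simp add: is_weyl_kernel_def truncated_weyl_kernel_eq)
  then have V: "L2_converges lborel V (\<lambda>z. \<Sum>j\<in>J. c j * weyl_translation j (weyl_kernel \<phi>) z)"
    unfolding V_def weyl_translation_def
    by (intro L2_converges_combination modulated_shift_converges) auto
  have "L2_norm lborel (U N) = L2_norm lborel (V N)" for N
  proof (rule L2_norm_eqI)
    have cm: "cut_first N \<phi> \<in> borel_measurable borel"
      using cut_first_L2[OF \<phi>, of N] by (auto simp: L2_iff_energy)
    have "AE z in lborel. weyl_integral (U N) z
        = (\<Sum>j\<in>J. c j * weyl_integral (twisted_translation j (cut_first N \<phi>)) z)"
      unfolding U_def
      by (intro weyl_integral_sum J twisted_translation_L2 cut_first_L2 \<phi> bounded_first_twisted_translation bounded_first_cut)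
    moreover have "weyl_integral (twisted_translation j (cut_first N \<phi>)) z
        = weyl_translation j (weyl_integral (cut_first N \<phi>)) z" for j z
      by (cases j; cases z)
         (simp add: weyl_integral_twisted_translation[OF cm] weyl_translation_def modulated_shift_def)
    ultimately have "energy lborel (weyl_integral (U N)) = energy lborel (V N)"
      unfolding V_def by (intro energy_cong_AE) simp
    moreover show UN: "U N \<in> L2 lborel"
      unfolding U_def by (intro L2_sum L2_cmult twisted_translation_L2 cut_first_L2 \<phi>)
    moreover have "bounded_first (U N)"
      unfolding U_def by (intro bounded_first_sum J bounded_first_cmult bounded_first_twisted_translation bounded_first_cut)
    ultimately show "energy lborel (U N) = energy lborel (V N)"
      using weyl_integral_isometry[of "U N"] by simp
    show "V N \<in> L2 lborel" using V by (simp add: L2_converges_def)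
  qed
  then show "(\<lambda>N. L2_norm lborel (U N)) \<longlonglongrightarrow> L2_norm lborel (\<lambda>z. \<Sum>j\<in>J. c j * weyl_translation j (weyl_kernel \<phi>) z)"
    using L2_converges_norm[OF V] by simp
qed

section \<open>Orthogonality of shifted fibres\<close>

lemma L2_norm_combination_power2:
  assumes F: "\<And>l. l \<in> L \<Longrightarrow> F l \<in> L2 M"
  shows "complex_of_real ((L2_norm M (\<lambda>x. \<Sum>l\<in>L. a l * F l x))\<^sup>2)
    = (\<Sum>l\<in>L. \<Sum>l'\<in>L. (a l * cnj (a l')) * L2_inner M (F l) (F l'))"
proof -
  define f where "f = (\<lambda>x. \<Sum>l\<in>L. a l * F l x)"
  have f: "f \<in> L2 M" unfolding f_def by (intro L2_sum L2_cmult F)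
  have "L2_inner M f (F l') = (\<Sum>l\<in>L. a l * L2_inner M (F l) (F l'))" if "l' \<in> L" for l'
  proof -
    have "L2_inner M f (F l') = cnj (L2_inner M (F l') f)"
      by (rule L2_inner_commute)
    also have "\<dots> = cnj (\<Sum>l\<in>L. cnj (a l) * L2_inner M (F l') (F l))"
      unfolding f_def by (simp only: L2_inner_sum_right[OF F[OF that] F])
    finally show ?thesis
      by (simp add: L2_inner_commute[symmetric])
  qed
  then have "L2_inner M f f = (\<Sum>l'\<in>L. cnj (a l') * (\<Sum>l\<in>L. a l * L2_inner M (F l) (F l')))"
    by (subst (2) f_def) (simp add: L2_inner_sum_right[OF f F])
  also have "\<dots> = (\<Sum>l\<in>L. \<Sum>l'\<in>L. (a l * cnj (a l')) * L2_inner M (F l) (F l'))"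
    unfolding sum_distrib_left by (subst sum.swap) (simp add: mult_ac)
  finally show ?thesis
    by (simp only: L2_norm_power2_inner[OF f] f_def[symmetric])
qed

lemma has_sum_sum:
  fixes f :: "'i \<Rightarrow> 'j \<Rightarrow> 'b::topological_comm_monoid_add"
  assumes "\<And>i. i \<in> I \<Longrightarrow> (f i has_sum s i) A"
  shows "((\<lambda>x. \<Sum>i\<in>I. f i x) has_sum (\<Sum>i\<in>I. s i)) A"
  using assms by (induction I rule: infinite_finite_induct) (auto intro: has_sum_add)

lemma has_sum_translate:
  fixes f :: "'g::ab_group_add \<Rightarrow> 'b::{topological_space, comm_monoid_add}"
  assumes "(f has_sum s) UNIV"
  shows "((\<lambda>m. f (m + l)) has_sum s) UNIV"
  using assms by (subst (asm) has_sum_reindex_bij_betw[symmetric, of "\<lambda>m. m + l" UNIV])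
    (auto intro!: bij_betwI[of _ _ _ "\<lambda>m. m - l"])

lemma has_sum_if_nn_integral_finite:
  fixes f :: "'j::countable \<Rightarrow> real"
  assumes "\<And>j. f j \<ge> 0" and w: "(\<integral>\<^sup>+j. ennreal (f j) \<partial>count_space UNIV) = ennreal w" "w \<ge> 0"
  shows "(f has_sum w) UNIV"
proof -
  have bound: "sum f J \<le> w" if "finite J" for J
  proof -
    have "ennreal (sum f J) = (\<Sum>j\<in>J. ennreal (f j))"
      using assms by (simp add: sum_ennreal)
    also have "\<dots> \<le> (\<Sum>\<^sub>\<infinity>j. ennreal (f j))"
      by (subst nonneg_infsum_complete) (use that in \<open>auto intro: SUP_upper\<close>)
    also have "\<dots> = ennreal w"
      by (simp add: infsum_ennreal_eq_nn_integral w)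
    finally show ?thesis using w by simp
  qed
  have "f summable_on UNIV"
    by (rule nonneg_bdd_above_summable_on) (use assms bound in \<open>auto intro!: bdd_aboveI2[of _ _ w]\<close>)
  moreover from this have "ennreal (infsum f UNIV) = ennreal w"
    using infsum_nonneg_is_SUPREMUM_ennreal[of f UNIV] assms
      nonneg_infsum_complete[of UNIV "\<lambda>j. ennreal (f j)"]
    by (simp add: infsum_ennreal_eq_nn_integral w sum_ennreal)
  then have "infsum f UNIV = w"
    using w assms by (simp add: infsum_nonneg)
  ultimately show ?thesis
    using has_sum_infsum by blast
qed

lemma nn_integral_if_has_sum:
  fixes f :: "'j::countable \<Rightarrow> real"
  assumes "(f has_sum w) UNIV" "\<And>j. f j \<ge> 0"
  shows "(\<integral>\<^sup>+j. ennreal (f j) \<partial>count_space UNIV) = ennreal w"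
  using assms infsum_nonneg_is_SUPREMUM_ennreal[of f UNIV] has_sum_imp_summable[OF assms(1)]
    nonneg_infsum_complete[of UNIV "\<lambda>j. ennreal (f j)"] infsumI[OF assms(1)]
  by (simp add: infsum_ennreal_eq_nn_integral[symmetric] sum_ennreal)

text \<open>The squared norm of each combination is expanded into inner products. After summation over \<open>m\<close>,
  translation invariance leaves only the difference \<open>l' - l\<close>, so the orthogonality hypothesis
  kills all off-diagonal terms.\<close>

lemma fibre_energy_sum:
  fixes k :: "int^'n \<Rightarrow> 'b \<Rightarrow> complex"
  assumes k: "\<And>m. k m \<in> L2 M" and "finite L"
    and w: "(\<integral>\<^sup>+m. energy M (k m) \<partial>count_space UNIV) < \<infinity>"
    and orth: "\<And>l. l \<noteq> 0 \<Longrightarrow> ((\<lambda>m. L2_inner M (k m) (k (m + l))) has_sum 0) UNIV"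
  shows "(\<integral>\<^sup>+m. energy M (\<lambda>x. \<Sum>l\<in>L. a l * k (m + l) x) \<partial>count_space UNIV)
    = ennreal (\<Sum>l\<in>L. (cmod (a l))\<^sup>2) * (\<integral>\<^sup>+m. energy M (k m) \<partial>count_space UNIV)"
proof -
  obtain W where W: "(\<integral>\<^sup>+m. energy M (k m) \<partial>count_space UNIV) = ennreal W" "W \<ge> 0"
    using w by (cases "\<integral>\<^sup>+m. energy M (k m) \<partial>count_space UNIV") auto
  have "((\<lambda>m. (L2_norm M (k m))\<^sup>2) has_sum W) UNIV"
    by (rule has_sum_if_nn_integral_finite) (use W in \<open>auto simp: energy_eq_L2_norm[OF k]\<close>)
  then have "((\<lambda>m. complex_of_real ((L2_norm M (k m))\<^sup>2)) has_sum complex_of_real W) UNIV"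
    by (rule has_sum_of_real)
  then have diag: "((\<lambda>m. L2_inner M (k m) (k m)) has_sum complex_of_real W) UNIV"
    by (simp only: L2_norm_power2_inner[OF k])
  have inner: "((\<lambda>m. L2_inner M (k (m + l)) (k (m + l'))) has_sum (if l = l' then complex_of_real W else 0)) UNIV" for l l'
  proof (cases "l = l'")
    case True
    then show ?thesis using has_sum_translate[OF diag, of l] by simp
  next
    case False
    then have "l' - l \<noteq> 0" by simp
    from has_sum_translate[OF orth[OF this], of l] False show ?thesis
      by (simp add: add.assoc)
  qed
  define f where "f = (\<lambda>m x. \<Sum>l\<in>L. a l * k (m + l) x)"
  have f: "f m \<in> L2 M" for m unfolding f_def by (intro L2_sum L2_cmult k)
  have "((\<lambda>m. \<Sum>l\<in>L. \<Sum>l'\<in>L. (a l * cnj (a l')) * L2_inner M (k (m + l)) (k (m + l')))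
      has_sum (\<Sum>l\<in>L. \<Sum>l'\<in>L. (a l * cnj (a l')) * (if l = l' then complex_of_real W else 0))) UNIV"
    by (intro has_sum_sum has_sum_cmult_right inner \<open>finite L\<close>)
  moreover have "(\<Sum>l\<in>L. \<Sum>l'\<in>L. (a l * cnj (a l')) * (if l = l' then complex_of_real W else 0))
      = complex_of_real ((\<Sum>l\<in>L. (cmod (a l))\<^sup>2) * W)"
    using \<open>finite L\<close>
    by (simp add: if_distrib sum_distrib_right complex_norm_square[symmetric] cong: if_cong flip: of_real_power)
  moreover have "(\<Sum>l\<in>L. \<Sum>l'\<in>L. (a l * cnj (a l')) * L2_inner M (k (m + l)) (k (m + l')))
      = complex_of_real ((L2_norm M (f m))\<^sup>2)" for m
    unfolding f_def by (rule L2_norm_combination_power2[symmetric]) (rule k)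
  ultimately have "((\<lambda>m. complex_of_real ((L2_norm M (f m))\<^sup>2)) has_sum complex_of_real ((\<Sum>l\<in>L. (cmod (a l))\<^sup>2) * W)) UNIV"
    by simp
  then have "((\<lambda>m. (L2_norm M (f m))\<^sup>2) has_sum ((\<Sum>l\<in>L. (cmod (a l))\<^sup>2) * W)) UNIV"
    by (simp only: has_sum_of_real_iff)
  then have "(\<integral>\<^sup>+m. ennreal ((L2_norm M (f m))\<^sup>2) \<partial>count_space UNIV) = ennreal ((\<Sum>l\<in>L. (cmod (a l))\<^sup>2) * W)"
    by (rule nn_integral_if_has_sum) simp
  then show ?thesis
    by (simp add: W energy_eq_L2_norm[OF f, symmetric] ennreal_mult sum_nonneg) (simp add: f_def)
qed

section \<open>Norms of twisted combinations and the weight\<close>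

lemma weyl_kernel_L2: "f \<in> L2 lborel \<Longrightarrow> weyl_kernel f \<in> L2 lborel"
  using weyl_kernel_exists[of f] by (simp add: is_weyl_kernel_def L2_converges_def)

lemma weight_eq_nn_integral:
  "weight \<phi> \<xi> = (\<integral>\<^sup>+m. energy lborel (\<lambda>\<eta>. weyl_kernel \<phi> (\<xi> + vec_of_int m, \<eta>)) \<partial>count_space UNIV)"
  unfolding weight_def energy_def by (rule infsum_ennreal_eq_nn_integral)

lemma energy_sections_measurable:
  fixes f :: "'a::euclidean_space \<times> 'b::euclidean_space \<Rightarrow> complex"
  assumes "f \<in> borel_measurable borel"
  shows "(\<lambda>x. energy lborel (\<lambda>y. f (x, y))) \<in> borel_measurable borel"
proof -
  have m: "(\<lambda>z. ennreal ((cmod (f z))\<^sup>2)) \<in> borel_measurable (lborel \<Otimes>\<^sub>M lborel)"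
    using assms by (simp add: borel_prod lborel_prod)
  show ?thesis
    using lborel.borel_measurable_nn_integral_fst[OF m] by (simp add: energy_def)
qed

lemma energy_periodization:
  fixes f :: "(real^'n) \<times> (real^'n) \<Rightarrow> complex"
  assumes f: "f \<in> borel_measurable borel"
  shows "energy lborel f
    = (\<integral>\<^sup>+\<xi>. (\<integral>\<^sup>+m. energy lborel (\<lambda>\<eta>. f (\<xi> + vec_of_int m, \<eta>)) \<partial>count_space UNIV) \<partial>torus)"
  using nn_integral_periodization[OF energy_sections_measurable[OF f]]
  by (simp add: energy_prod(1)[OF f])

lemma weight_measurable:
  fixes \<phi> :: "(real^'n) \<times> (real^'n) \<Rightarrow> complex"
  assumes \<phi>: "\<phi> \<in> L2 lborel"
  shows "weight \<phi> \<in> borel_measurable torus"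
proof -
  have Km: "weyl_kernel \<phi> \<in> borel_measurable borel"
    using weyl_kernel_L2[OF \<phi>] by (auto simp: L2_iff_energy)
  have "(\<lambda>\<xi>. energy lborel (\<lambda>\<eta>. weyl_kernel \<phi> (\<xi> + vec_of_int m, \<eta>))) \<in> borel_measurable torus" for m
    by (intro measurable_torusI measurable_compose[OF _ energy_sections_measurable[OF Km]]) measurable
  then show ?thesis
    unfolding weight_eq_nn_integral[abs_def] by (rule borel_measurable_nn_integral_count_space)
qed

lemma nn_integral_weight:
  assumes \<phi>: "\<phi> \<in> L2 lborel"
  shows "(\<integral>\<^sup>+\<xi>. weight \<phi> \<xi> \<partial>torus) = energy lborel (weyl_kernel \<phi>)"
  using weyl_kernel_L2[OF \<phi>] unfolding weight_eq_nn_integral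
  by (intro energy_periodization[symmetric]) (auto simp: L2_iff_energy)

lemma AE_torus_of_AE_lborel: "AE \<xi> in lborel. P \<xi> \<Longrightarrow> AE \<xi> in torus. P \<xi>"
  unfolding torus_eq by (subst AE_restrict_space_iff) auto

text \<open>For fixed \<open>l\<close>, the factor \<open>\<Sum>k. c (k, l) * weyl_phase (k, l) \<xi>\<close> in front of the fibre shifted by
  \<open>l\<close>. The sign \<open>cis (pi * (k \<bullet> l))\<close> of the phase is absorbed into the coefficients and leaves
  their moduli unchanged.\<close>

definition row_polynomial ::
  "((int^'n) \<times> (int^'n) \<Rightarrow> complex) \<Rightarrow> ((int^'n) \<times> (int^'n)) set \<Rightarrow> int^'n \<Rightarrow> real^'n \<Rightarrow> complex" where
  "row_polynomial c J l = trig_sum (\<lambda>k. c (k, l) * cis (pi * (vec_of_int k \<bullet> vec_of_int l))) {k. (k, l) \<in> J}"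

lemma finite_row: "finite J \<Longrightarrow> finite {k. (k, l) \<in> J}"
  by (rule finite_subset[of _ "fst ` J"]) (auto intro: rev_image_eqI)

lemma sum_rows:
  fixes g :: "'a \<times> 'b \<Rightarrow> 'c::comm_monoid_add"
  assumes "finite J"
  shows "(\<Sum>j\<in>J. g j) = (\<Sum>l\<in>snd ` J. \<Sum>k\<in>{k. (k, l) \<in> J}. g (k, l))"
proof -
  have "(\<Sum>l\<in>snd ` J. \<Sum>k\<in>{k. (k, l) \<in> J}. g (k, l))
      = (\<Sum>(l, k)\<in>(SIGMA l:snd ` J. {k. (k, l) \<in> J}). g (k, l))"
  proof (rule sum.Sigma)
    show "finite (snd ` J)" using assms by simp
    show "\<forall>l\<in>snd ` J. finite {k. (k, l) \<in> J}"
      using assms by (auto intro!: finite_subset[of "{k. (k, _) \<in> J}" "fst ` J"] intro: rev_image_eqI)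
  qed
  also have "\<dots> = (\<Sum>j\<in>J. g j)"
    by (rule sum.reindex_bij_witness[of _ "\<lambda>(k, l). (l, k)" "\<lambda>(l, k). (k, l)"]) (auto intro: rev_image_eqI)
  finally show ?thesis by simp
qed

text \<open>By periodization the norm on the kernel side is an integral over the torus of sums
  over fibres; the row polynomials are periodic and act as constant coefficients on each fibre, and
  condition C makes the shifted fibres orthogonal. The norm becomes a weighted norm of the row
  polynomials.\<close>

theorem twisted_combination_energy:
  fixes \<phi> :: "(real^'n) \<times> (real^'n) \<Rightarrow> complex"
  assumes \<phi>: "\<phi> \<in> L2 lborel" and C: "condition_C \<phi>" and J: "finite J"
  shows "ennreal ((L2_norm lborel (\<lambda>z. \<Sum>j\<in>J. c j * twisted_translation j \<phi> z))\<^sup>2)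
    = (\<integral>\<^sup>+\<xi>. ennreal (\<Sum>l\<in>snd ` J. (cmod (row_polynomial c J l \<xi>))\<^sup>2) * weight \<phi> \<xi> \<partial>torus)"
proof -
  define K where "K = weyl_kernel \<phi>"
  define G where "G = (\<lambda>z. \<Sum>j\<in>J. c j * weyl_translation j K z)"
  have K: "K \<in> L2 lborel" unfolding K_def by (rule weyl_kernel_L2[OF \<phi>])
  have G: "G \<in> L2 lborel"
    unfolding G_def weyl_translation_def by (intro L2_sum L2_cmult modulated_shift_L2 K) auto
  have Km: "K \<in> borel_measurable borel" and Gm: "G \<in> borel_measurable borel"
    using K G by (auto simp: L2_iff_energy)
  have "ennreal ((L2_norm lborel (\<lambda>z. \<Sum>j\<in>J. c j * twisted_translation j \<phi> z))\<^sup>2) = energy lborel G"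
    unfolding twisted_combination_norm[OF \<phi> J] using energy_eq_L2_norm[OF G] by (simp add: G_def K_def)
  also have "\<dots> = (\<integral>\<^sup>+\<xi>. (\<integral>\<^sup>+m. energy lborel (\<lambda>\<eta>. G (\<xi> + vec_of_int m, \<eta>)) \<partial>count_space UNIV) \<partial>torus)"
    by (rule energy_periodization[OF Gm])
  also have "\<dots> = (\<integral>\<^sup>+\<xi>. ennreal (\<Sum>l\<in>snd ` J. (cmod (row_polynomial c J l \<xi>))\<^sup>2) * weight \<phi> \<xi> \<partial>torus)"
  proof (rule nn_integral_cong_AE)
    have "AE \<xi> in lborel. \<forall>m. (\<lambda>\<eta>. K (vec_of_int m + \<xi>, \<eta>)) \<in> L2 lborel"
      unfolding AE_all_countable by (intro allI AE_lborel_translation L2_sections(1) K)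
    then have 1: "AE \<xi> in torus. \<forall>m. (\<lambda>\<eta>. K (vec_of_int m + \<xi>, \<eta>)) \<in> L2 lborel"
      by (rule AE_torus_of_AE_lborel)
    have "(\<integral>\<^sup>+\<xi>. weight \<phi> \<xi> \<partial>torus) \<noteq> \<infinity>"
      using nn_integral_weight[OF \<phi>] K by (auto simp: K_def L2_iff_energy)
    then have 2: "AE \<xi> in torus. weight \<phi> \<xi> \<noteq> \<infinity>"
      by (rule nn_integral_PInf_AE[rotated]) (rule weight_measurable[OF \<phi>])
    have 3: "AE \<xi> in torus. \<forall>l. l \<noteq> 0 \<longrightarrow> ((\<lambda>m :: int^'n. \<integral>\<eta>. K (\<xi> + vec_of_int m, \<eta>) *
         cnj (K (\<xi> + vec_of_int m + vec_of_int l, \<eta>)) \<partial>lborel) has_sum 0) UNIV"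
      using C unfolding AE_all_countable condition_C_def K_def by auto
    show "AE \<xi> in torus. (\<integral>\<^sup>+m. energy lborel (\<lambda>\<eta>. G (\<xi> + vec_of_int m, \<eta>)) \<partial>count_space UNIV)
        = ennreal (\<Sum>l\<in>snd ` J. (cmod (row_polynomial c J l \<xi>))\<^sup>2) * weight \<phi> \<xi>"
      using 1 2 3
    proof eventually_elim
      case (elim \<xi>)
      define k where "k = (\<lambda>m \<eta>. K (\<xi> + vec_of_int m, \<eta>))"
      have "G (\<xi> + vec_of_int m, \<eta>) = (\<Sum>l\<in>snd ` J. row_polynomial c J l \<xi> * k (m + l) \<eta>)" for m \<eta>
      proof -
        have "G (\<xi> + vec_of_int m, \<eta>)
            = (\<Sum>l\<in>snd ` J. \<Sum>i\<in>{i. (i, l) \<in> J}. c (i, l) * weyl_translation (i, l) K (\<xi> + vec_of_int m, \<eta>))"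
          unfolding G_def by (rule sum_rows[OF J])
        also have "\<dots> = (\<Sum>l\<in>snd ` J. row_polynomial c J l \<xi> * k (m + l) \<eta>)"
          unfolding row_polynomial_def trig_sum_def sum_distrib_right
          by (intro sum.cong refl)
             (simp add: weyl_translation_def modulated_shift_def weyl_phase_def character_periodic
               k_def vec_of_int_add add.assoc)
        finally show ?thesis .
      qed
      moreover have "(\<integral>\<^sup>+m. energy lborel (\<lambda>\<eta>. \<Sum>l\<in>snd ` J. row_polynomial c J l \<xi> * k (m + l) \<eta>) \<partial>count_space UNIV)
          = ennreal (\<Sum>l\<in>snd ` J. (cmod (row_polynomial c J l \<xi>))\<^sup>2) * (\<integral>\<^sup>+m. energy lborel (k m) \<partial>count_space UNIV)"
      proof (rule fibre_energy_sum)
        show "k m \<in> L2 lborel" for m using elim(1) by (simp add: k_def add.commute)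
        show "finite (snd ` J)" using J by simp
        show "(\<integral>\<^sup>+m. energy lborel (k m) \<partial>count_space UNIV) < \<infinity>"
          using elim(2) by (simp add: weight_eq_nn_integral k_def K_def less_top)
        show "((\<lambda>m. L2_inner lborel (k m) (k (m + l))) has_sum 0) UNIV" if "l \<noteq> 0" for l
          using elim(3) that by (simp add: L2_inner_def k_def vec_of_int_add add.assoc)
      qed
      ultimately show ?case
        by (simp add: weight_eq_nn_integral k_def K_def)
    qed
  qed
  finally show ?thesis .
qed

lemma nn_integral_trig_sum:
  "finite A \<Longrightarrow> (\<integral>\<^sup>+\<xi>. ennreal ((cmod (trig_sum c A \<xi>))\<^sup>2) \<partial>torus) = ennreal (\<Sum>k\<in>A. (cmod (c k))\<^sup>2)"
  using energy_eq_L2_norm[OF trig_sum_L2, of c A] by (simp add: energy_def L2_norm_trig_sum)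

text \<open>The characters are orthonormal, so the unweighted norms of the row polynomials add up to the
  norm of the coefficients.\<close>

lemma synthesis_bound_if_weight_bounded:
  fixes \<phi> :: "(real^'n) \<times> (real^'n) \<Rightarrow> complex"
  assumes \<phi>: "\<phi> \<in> L2 lborel" and C: "condition_C \<phi>" and B: "AE \<xi> in torus. weight \<phi> \<xi> \<le> ennreal B" "B \<ge> 0"
  shows "synthesis_bound lborel (\<lambda>j. twisted_translation j \<phi>) B"
  unfolding synthesis_bound_def
proof (intro allI impI)
  fix J :: "((int^'n) \<times> (int^'n)) set" and c :: "(int^'n) \<times> (int^'n) \<Rightarrow> complex"
  assume J: "finite J"
  have [measurable]: "row_polynomial c J l \<in> borel_measurable torus" for l
    unfolding row_polynomial_def by measurable
  have "ennreal ((L2_norm lborel (\<lambda>z. \<Sum>j\<in>J. c j * twisted_translation j \<phi> z))\<^sup>2)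
      \<le> (\<integral>\<^sup>+\<xi>. ennreal (\<Sum>l\<in>snd ` J. (cmod (row_polynomial c J l \<xi>))\<^sup>2) * ennreal B \<partial>torus)"
    unfolding twisted_combination_energy[OF \<phi> C J]
    by (intro nn_integral_mono_AE) (use B(1) in \<open>eventually_elim; auto intro!: mult_left_mono\<close>)
  also have "\<dots> = (\<Sum>l\<in>snd ` J. \<integral>\<^sup>+\<xi>. ennreal ((cmod (row_polynomial c J l \<xi>))\<^sup>2) \<partial>torus) * ennreal B"
    by (simp add: nn_integral_multc nn_integral_sum flip: sum_ennreal)
  also have "\<dots> = (\<Sum>l\<in>snd ` J. ennreal (\<Sum>k\<in>{k. (k, l) \<in> J}. (cmod (c (k, l)))\<^sup>2)) * ennreal B"
    unfolding row_polynomial_def by (simp add: nn_integral_trig_sum finite_row[OF J] norm_mult)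
  also have "\<dots> = ennreal (B * (\<Sum>j\<in>J. (cmod (c j))\<^sup>2))"
    using B(2) by (subst sum_rows[OF J]) (simp add: sum_ennreal sum_nonneg ennreal_mult mult.commute)
  finally show "(L2_norm lborel (\<lambda>z. \<Sum>j\<in>J. c j * twisted_translation j \<phi> z))\<^sup>2 \<le> B * (\<Sum>j\<in>J. (cmod (c j))\<^sup>2)"
    using B(2) by (subst (asm) ennreal_le_iff) (auto intro!: mult_nonneg_nonneg sum_nonneg)
qed

text \<open>Coefficients supported in the row \<open>l = 0\<close> produce an arbitrary trigonometric polynomial, and the
  synthesis bound compares the density \<open>weight \<phi>\<close> with the constant \<open>B\<close> against its square.\<close>

lemma weight_bounded_if_synthesis_bound:
  fixes \<phi> :: "(real^'n) \<times> (real^'n) \<Rightarrow> complex"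
  assumes \<phi>: "\<phi> \<in> L2 lborel" and C: "condition_C \<phi>"
    and B: "synthesis_bound lborel (\<lambda>j. twisted_translation j \<phi>) B"
  shows "AE \<xi> in torus. weight \<phi> \<xi> \<le> ennreal B"
proof (rule AE_le_if_trig_poly_integrals_le)
  show "weight \<phi> \<in> borel_measurable torus" by (rule weight_measurable[OF \<phi>])
  show "(\<integral>\<^sup>+\<xi>. weight \<phi> \<xi> \<partial>torus) < \<infinity>"
    using nn_integral_weight[OF \<phi>] weyl_kernel_L2[OF \<phi>] by (simp add: L2_iff_energy)
  show "(\<integral>\<^sup>+\<xi>. ennreal B \<partial>(torus :: (real^'n) measure)) < \<infinity>"
    by (simp add: emeasure_torus)
  fix p :: "real^'n \<Rightarrow> complex" assume "p \<in> trig_polys"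
  then obtain A c where A: "finite A" and p: "p = trig_sum c A"
    by (auto simp: trig_polys_def)
  define J where "J = (\<lambda>k. (k, 0 :: int^'n)) ` A"
  have J: "finite J" using A by (simp add: J_def)
  have row: "row_polynomial (\<lambda>j. c (fst j)) J 0 = p"
  proof -
    have "{k. (k, 0) \<in> J} = A" by (auto simp: J_def)
    then show ?thesis by (simp add: row_polynomial_def p)
  qed
  have "(\<integral>\<^sup>+\<xi>. ennreal ((cmod (p \<xi>))\<^sup>2) * weight \<phi> \<xi> \<partial>torus)
      = ennreal ((L2_norm lborel (\<lambda>z. \<Sum>j\<in>J. c (fst j) * twisted_translation j \<phi> z))\<^sup>2)"
  proof (cases "A = {}")
    case False
    then have "snd ` J = {0}" by (auto simp: J_def image_image)
    then show ?thesis
      using twisted_combination_energy[OF \<phi> C J, of "\<lambda>j. c (fst j)"] by (simp add: row)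
  qed (simp add: p trig_sum_def J_def L2_norm_def)
  also have "\<dots> \<le> ennreal (B * (\<Sum>j\<in>J. (cmod (c (fst j)))\<^sup>2))"
    by (intro ennreal_leI synthesis_boundD[OF B J])
  also have "(\<Sum>j\<in>J. (cmod (c (fst j)))\<^sup>2) = (\<Sum>k\<in>A. (cmod (c k))\<^sup>2)"
    unfolding J_def by (subst sum.reindex) (auto simp: inj_on_def)
  also have "ennreal (B * (\<Sum>k\<in>A. (cmod (c k))\<^sup>2)) = ennreal (\<Sum>k\<in>A. (cmod (c k))\<^sup>2) * ennreal B"
    by (simp add: mult.commute[of B] ennreal_mult' sum_nonneg)
  also have "\<dots> = (\<integral>\<^sup>+\<xi>. ennreal ((cmod (p \<xi>))\<^sup>2) * ennreal B \<partial>torus)"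
    unfolding p by (subst nn_integral_multc) (auto simp: nn_integral_trig_sum A)
  finally show "(\<integral>\<^sup>+\<xi>. ennreal ((cmod (p \<xi>))\<^sup>2) * weight \<phi> \<xi> \<partial>torus)
      \<le> (\<integral>\<^sup>+\<xi>. ennreal ((cmod (p \<xi>))\<^sup>2) * ennreal B \<partial>torus)" .
qed simp

theorem theorem5p3:
  fixes \<phi> :: "(real^'n) \<times> (real^'n) \<Rightarrow> complex"
  assumes "\<phi> \<in> L2 lborel"
    and "condition_C \<phi>"
    and "(\<lambda>\<xi>. 1 / weight \<phi> \<xi>) \<in> L1_ennreal torus"
  shows "(hilbertian lborel (\<lambda>j. twisted_translation j \<phi>) \<longleftrightarrow> esssup torus (weight \<phi>) < \<infinity>) \<and>
    (esssup torus (weight \<phi>) < \<infinity> \<longleftrightarrow> bessel_sequence lborel (\<lambda>j. twisted_translation j \<phi>))"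
proof -
  let ?F = "\<lambda>j. twisted_translation j \<phi>"
  have F: "?F j \<in> L2 lborel" for j
    by (rule twisted_translation_L2[OF assms(1)])
  have "hilbertian lborel ?F \<longleftrightarrow> (\<exists>B. synthesis_bound lborel ?F B)"
    using hilbertian_imp_synthesis_bound[of lborel ?F] synthesis_bound_imp_hilbertian[of ?F, OF F] by blast
  moreover have "bessel_sequence lborel ?F \<longleftrightarrow> (\<exists>B. synthesis_bound lborel ?F B)"
    using bessel_imp_synthesis_bound[of lborel ?F] synthesis_bound_imp_bessel[of ?F, OF F] by blast
  moreover have "esssup torus (weight \<phi>) < \<infinity> \<longleftrightarrow> (\<exists>B. synthesis_bound lborel ?F B)"
  proof
    assume "esssup torus (weight \<phi>) < \<infinity>"
    then obtain B where B: "esssup torus (weight \<phi>) = ennreal B" "B \<ge> 0"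
      by (cases "esssup torus (weight \<phi>)") auto
    have "AE \<xi> in torus. weight \<phi> \<xi> \<le> ennreal B"
      using esssup_AE[of "weight \<phi>" torus] by (simp add: B)
    then show "\<exists>B. synthesis_bound lborel ?F B"
      using synthesis_bound_if_weight_bounded[OF assms(1,2)] B by blast
  next
    assume "\<exists>B. synthesis_bound lborel ?F B"
    then obtain B where "AE \<xi> in torus. weight \<phi> \<xi> \<le> ennreal B"
      using weight_bounded_if_synthesis_bound[OF assms(1,2)] by blast
    then have "esssup torus (weight \<phi>) \<le> ennreal B"
      by (intro esssup_I weight_measurable assms(1))
    then show "esssup torus (weight \<phi>) < \<infinity>"
      by (rule order.strict_trans1) simp
  qed
  ultimately show ?thesis by blast
qed

end
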